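(* Let $A$ be a unital $\varphi$-algebra over $\Bbbk$ and let $\mathbb{M}=(M_s,\dots,M_k)$ be its associated $k$-admissible sequence (the empty sequence when $k=0$). Put $$f_{\Gamma_1}=z_1,\qquad f_{\Gamma_2}=[y_2,y_1]+[z_2,y_1]+z_1z_2,$$ $$f_{\Gamma_3}=[y_3,y_2,y_1]+[y_3,z_2,y_1]+z_3[y_2,y_1]+[y_3,z_2,z_1]+z_3[z_2,y_1]+z_1z_2z_3,$$ $$f_4=f_{\Gamma_3}\,y_4+[y_2,y_1][y_4,y_3].$$ (1) If $k=0$: when $\varphi$ is an antiautomorphism, $f_{\Gamma_1}=z_1$ is a generating identity of $A$; when $\varphi$ is an automorphism, $f_{\Gamma_1}y_2+[y_2,y_1]$ is a generating identity of $A$. (2) If $k=1$, then $f_{\Gamma_2}$ is a generating identity of $A$. (3) If $k=2$, a generating identity of $A$ is given as follows. For a $2$-admissible singleton $\mathbb{M}=(M_2)$, according to $M_2$: (a) $M_2=V_{(1^2),\emptyset}$: $[y_2,y_1]y_3+f_{\Gamma_3}$ (both for $\varphi$ an automorphism and an antiautomorphism). (b) $M_2=V_{(1),(1)}\oplus V_{(1^2),\emptyset}$: $([z_2,y_1]+[y_2,y_1])y_3+f_{\Gamma_3}$ (both cases). (c) $M_2=V_{\emptyset,(2)}\oplus V_{(1^2),\emptyset}$: $(z_2\circ z_1+[y_2,y_1])y_3+f_{\Gamma_3}$ (both cases). (d) $M_2=V_{\emptyset,(1^2)}\oplus V_{(1^2),\emptyset}$: $([z_2,z_1]+[y_2,y_1])y_3+f_{\Gamma_3}$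 (both cases). (e) $M_2=V_{(1),(1)}\oplus V_{\emptyset,(1^2)}\oplus V_{(1^2),\emptyset}$: $([z_2,y_1]+[z_2,z_1]+[y_2,y_1])y_3+f_{\Gamma_3}$ (both cases). (f) $M_2=V_{(1),(1)}\oplus V_{\emptyset,(2)}\oplus V_{(1^2),\emptyset}$: $([z_2,y_1]+z_2\circ z_1+[y_2,y_1])y_3+f_{\Gamma_3}$ if $\varphi$ is an automorphism; $[z_2,y_1]+z_2\circ z_1+[y_2,y_1]$ if $\varphi$ is an antiautomorphism. (g) $M_2=V_{\emptyset,(2)}\oplus V_{\emptyset,(1^2)}\oplus V_{(1^2),\emptyset}$: $(z_1z_2+[y_2,y_1])y_3+f_{\Gamma_3}$ if $\varphi$ is an automorphism; $z_1z_2+[y_2,y_1]$ if $\varphi$ is an antiautomorphism. (h) $M_2=0$: $f_4$ if $\varphi$ is an automorphism; $f_{\Gamma_3}$ if $\varphi$ is an antiautomorphism. (i) $M_2=V_{(1),(1)}$: $[z_2,y_1]y_3y_4+f_4$ if automorphism; $[z_2,y_1]y_3+f_{\Gamma_3}$ if antiautomorphism. (j) $M_2=V_{\emptyset,(2)}$: $(z_2\circ z_1)y_3y_4+f_4$ if automorphism; $(z_2\circ z_1)y_3+f_{\Gamma_3}$ if antiautomorphism. (k) $M_2=V_{\emptyset,(1^2)}$: $[z_2,z_1]y_3y_4+f_4$ if automorphism; $[z_2,z_1]y_3+f_{\Gamma_3}$ if antiautomorphism. (l) $M_2=V_{\emptyset,(2)}\oplus V_{\emptyset,(1^2)}$: $z_1z_2y_3y_4+f_4$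 if automorphism; $z_1z_2y_3+f_{\Gamma_3}$ if antiautomorphism. (m) $M_2=V_{(1),(1)}\oplus V_{\emptyset,(1^2)}$: $([z_2,y_1]+[z_2,z_1])y_3y_4+f_4$ if automorphism; $([z_2,y_1]+[z_2,z_1])y_3+f_{\Gamma_3}$ if antiautomorphism. (n) $M_2=V_{(1),(1)}\oplus V_{\emptyset,(2)}$: $([z_2,y_1]+z_2\circ z_1)y_3y_4+f_4$ if automorphism; $[z_2,y_1]+z_2\circ z_1$ if antiautomorphism. (o) $M_2=V_{(1),(1)}\oplus V_{\emptyset,(2)}\oplus V_{\emptyset,(1^2)}$: $([z_2,y_1]+z_1z_2)y_3y_4+f_4$ if automorphism; $[z_2,y_1]+z_1z_2$ if antiautomorphism. Finally, for the $2$-admissible pair $\mathbb{M}=(\Gamma_1^\varphi,\;V_{(1),(1)}\oplus V_{\emptyset,(2)}\oplus V_{\emptyset,(1^2)})$ (which occurs only when $\varphi$ is an automorphism): $z_1y_2y_3y_4+f_4$.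
   Context: $\Bbbk$ is a field of characteristic zero; all algebras are associative and unital over $\Bbbk$. A $\varphi$-algebra is a pair $(A,\varphi)$ where $\varphi$ is an automorphism or an antiautomorphism of the algebra $A$ with $\varphi^2=\mathrm{id}_A$ (the type, automorphism or antiautomorphism, is fixed throughout). Put $A^{+}=\{a:\varphi(a)=a\}$, $A^{-}=\{a:\varphi(a)=-a\}$. The free $\varphi$-algebra is the free unital associative algebra $\Bbbk\langle Y,Z\rangle$ on $Y=\{y_1,y_2,\dots\}$, $Z=\{z_1,z_2,\dots\}$ with the automorphism (resp. antiautomorphism) $\varphi$ determined by $\varphi(y_i)=y_i$, $\varphi(z_i)=-z_i$. A polynomial is a $\varphi$-identity of $A$ if it vanishes under every substitution of the $y_i$ by elements of $A^+$ and the $z_i$ by elements of $A^-$; $\mathrm{Id}^\varphi(A)$ is the set of these. It is a $\mathrm{T}^\varphi$-ideal: an ideal of $\Bbbk\langle Y,Z\rangle$ invariant under all algebra endomorphisms commuting with $\varphi$. $\langle S\rangle_{\mathrm{T}^\varphi}$ is the $\mathrm{T}^\varphi$-ideal generated by $S$. $V_n^\varphi$ is the span of the monomials $v_{\sigma(1)}\cdots v_{\sigma(n)}$, $\sigma\in\mathbb{S}_n$, $v_i\in\{y_i,z_i\}$. A multilinear polynomial $f\in V_n^\varphi$ is a generating identity of $A$ if $\langle f\rangle_{\mathrm{T}^\varphi}=\mathrm{Id}^\varphi(A)$ and no $\varphi$-identity of degree less than $n$ generates $\mathrm{Id}^\varphi(A)$ as a $\mathrm{T}^\varphi$-ideal.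 Notation: $[a,b]=ab-ba$, $[v_1,\dots,v_t]=[[v_1,\dots,v_{t-1}],v_t]$, $a\circ b=ab+ba$. $B(Y)$ is the subalgebra of $\Bbbk\langle Y,Z\rangle$ generated by $Z$ and all commutators of elements of $Y\cup Z$; $\Gamma_n^\varphi=B(Y)\cap V_n^\varphi$, $\Gamma_0^\varphi=\Bbbk$. The hyperoctahedral group $\mathbb{H}_n=\mathbb{Z}_2\wr\mathbb{S}_n$, with elements $(a_1,\dots,a_n;\sigma)$, $a_i\in\{1,-1\}$, acts on $V_n^\varphi$ by $y_i\mapsto y_{\sigma(i)}$, $z_i\mapsto a_{\sigma(i)}z_{\sigma(i)}$; $\Gamma_n^\varphi$ is a submodule. One has $\Gamma_1^\varphi=\Bbbk z_1$ and $\Gamma_2^\varphi=V_{(1^2),\emptyset}\oplus V_{(1),(1)}\oplus V_{\emptyset,(2)}\oplus V_{\emptyset,(1^2)}$, where $V_{(1^2),\emptyset}=\mathrm{span}\{[y_2,y_1]\}$, $V_{(1),(1)}=\mathrm{span}\{[z_2,y_1],[y_2,z_1]\}$, $V_{\emptyset,(2)}=\mathrm{span}\{z_1\circ z_2\}$, $V_{\emptyset,(1^2)}=\mathrm{span}\{[z_2,z_1]\}$. For $1\le s\le k$, a sequence $\mathbb{M}=(M_s,\dots,M_k)$, with each $M_i$ a left $\Bbbk\mathbb{H}_i$-submodule of $\Gamma_i^\varphi$ satisfying $\varphi(M_i)\subset M_i$, is $k$-admissible if: (1) if $s<k$ then $M_s\ne0$; (2) $M_k\subsetneq\Gamma_k^\varphi$;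 (3) for $s+1\le j\le k$, $(\langle M_s\rangle_{\mathrm{T}^\varphi}+\dots+\langle M_{j-1}\rangle_{\mathrm{T}^\varphi})\cap\Gamma_j^\varphi\subset M_j$. It is a singleton if of the form $(M_k)$ and a pair if of the form $(M_{k-1},M_k)$. $A$ is associated with $\mathbb{M}$ if $\Gamma_i^\varphi\cap\mathrm{Id}^\varphi(A)=0$ for $1\le i<s$, $=M_i$ for $s\le i\le k$, and $=\Gamma_i^\varphi$ for $i>k$. The case $k=0$ corresponds to the empty admissible sequence, meaning that $\Gamma_i^\varphi\subset\mathrm{Id}^\varphi(A)$ for all $i\ge1$. *)

theory Defs
  imports
    Complex_Main
    "HOL-Library.Poly_Mapping"
    "HOL-Library.Set_Algebras"
    "HOL-Combinatorics.Permutations"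
    HOL.Hull
begin

(* Algebras are nonzero, since the class ring_1 contains 0 \<noteq> 1. *)
locale unital_algebra = vector_space scale
  for scale :: "'k::field_char_0 \<Rightarrow> 'a::ring_1 \<Rightarrow> 'a" +
  assumes scale_mult_left: "scale c (a * b) = scale c a * b"
    and scale_mult_right: "scale c (a * b) = a * scale c b"

datatype phi_kind = Automorphism | Antiautomorphism

(* The type of \<phi> is a parameter: on a commutative algebra the same map may be
   considered with either type, and the two choices have different free algebras. *)
locale phi_algebra = unital_algebra scale
  for kind :: phi_kind
    and scale :: "'k::field_char_0 \<Rightarrow> 'a::ring_1 \<Rightarrow> 'a"
    and \<phi> :: "'a \<Rightarrow> 'a" +
  assumes phi_linear: "Vector_Spaces.linear scale scale \<phi>"
    and phi_one: "\<phi> 1 = 1"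
    and phi_mult: "\<phi> (a * b) =
      (case kind of Automorphism \<Rightarrow> \<phi> a * \<phi> b | Antiautomorphism \<Rightarrow> \<phi> b * \<phi> a)"
    and phi_involution: "\<phi> (\<phi> a) = a"

(* Letters carry an arbitrary index in nat; y_0 and z_0 are just one more variable of
   each sort in the countably infinite supply. The multilinear spaces use 1..n only. *)
datatype letter = Y nat | Z nat

(* The free monoid on the letters, written additively so that poly_mapping provides
   its monoid algebra. *)
datatype word = Word (letters: "letter list")

instantiation word :: monoid_add
begin

definition zero_word :: word where
  "zero_word = Word []"

definition plus_word :: "word \<Rightarrow> word \<Rightarrow> word" where
  "plus_word u w = Word (letters u @ letters w)"

instance
  by standard (simp_all add: zero_word_def plus_word_def)

end

type_synonym 'k free_algebra = "word \<Rightarrow>\<^sub>0 'k"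

definition monomial :: "letter list \<Rightarrow> 'k::field_char_0 free_algebra" where
  "monomial ls = Poly_Mapping.single (Word ls) 1"

definition fscale :: "'k::field_char_0 \<Rightarrow> 'k free_algebra \<Rightarrow> 'k free_algebra" where
  "fscale c p = Poly_Mapping.map ((*) c) p"

definition yv :: "nat \<Rightarrow> 'k::field_char_0 free_algebra" where
  "yv i = monomial [Y i]"

definition zv :: "nat \<Rightarrow> 'k::field_char_0 free_algebra" where
  "zv i = monomial [Z i]"

(* Length of the longest monomial that occurs; the zero polynomial gets degree 0. *)
definition total_degree :: "'k::field_char_0 free_algebra \<Rightarrow> nat" where
  "total_degree p = Max (insert 0 ((\<lambda>w. length (letters w)) ` Poly_Mapping.keys p))"

lemma fscale_conv_mult: "fscale c p = Poly_Mapping.single 0 c * p"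
  by (simp add: fscale_def mult_map_scale_conv_mult)

lemma lookup_fscale [simp]:
  "Poly_Mapping.lookup (fscale c p) w = c * Poly_Mapping.lookup p w"
  by (simp add: fscale_def Poly_Mapping.map.rep_eq when_def)

global_interpretation free: vector_space fscale
  defines free_span = free.span
    and free_subspace = free.subspace
  by standard (auto intro!: poly_mapping_eqI simp: lookup_add algebra_simps)

definition eval ::
  "('k::field_char_0 \<Rightarrow> 'a::ring_1 \<Rightarrow> 'a) \<Rightarrow> (letter \<Rightarrow> 'a) \<Rightarrow> 'k free_algebra \<Rightarrow> 'a" where
  "eval scale v p =
    (\<Sum>w\<in>Poly_Mapping.keys p. scale (Poly_Mapping.lookup p w) (prod_list (map v (letters w))))"

(* Linear extension of the (anti)homomorphism of words with y_i \<mapsto> y_i and z_i \<mapsto> - z_i. *)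
definition free_phi :: "phi_kind \<Rightarrow> 'k::field_char_0 free_algebra \<Rightarrow> 'k free_algebra" where
  "free_phi kind p =
    (let v = (\<lambda>l. case l of Y i \<Rightarrow> yv i | Z i \<Rightarrow> - zv i) in
     \<Sum>w\<in>Poly_Mapping.keys p. fscale (Poly_Mapping.lookup p w)
       (prod_list (map v (case kind of Automorphism \<Rightarrow> letters w
                                    | Antiautomorphism \<Rightarrow> rev (letters w)))))"

definition phi_identities ::
  "('k::field_char_0 \<Rightarrow> 'a::ring_1 \<Rightarrow> 'a) \<Rightarrow> ('a \<Rightarrow> 'a) \<Rightarrow> 'k free_algebra set" where
  "phi_identities scale \<phi> =
    {f. \<forall>v. (\<forall>i. \<phi> (v (Y i)) = v (Y i)) \<and> (\<forall>i. \<phi> (v (Z i)) = - v (Z i))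
          \<longrightarrow> eval scale v f = 0}"

definition free_endomorphism ::
  "('k::field_char_0 free_algebra \<Rightarrow> 'k free_algebra) \<Rightarrow> bool" where
  "free_endomorphism h \<longleftrightarrow>
    Vector_Spaces.linear fscale fscale h \<and> h 1 = 1 \<and> (\<forall>p q. h (p * q) = h p * h q)"

definition two_sided_ideal :: "'a::ring_1 set \<Rightarrow> bool" where
  "two_sided_ideal I \<longleftrightarrow>
    0 \<in> I \<and> (\<forall>a\<in>I. \<forall>b\<in>I. a + b \<in> I) \<and> (\<forall>a\<in>I. \<forall>r. r * a \<in> I \<and> a * r \<in> I)"

definition T_ideal :: "phi_kind \<Rightarrow> 'k::field_char_0 free_algebra set \<Rightarrow> bool" where
  "T_ideal kind I \<longleftrightarrow>
    two_sided_ideal I \<and>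
    (\<forall>h. free_endomorphism h \<and> h \<circ> free_phi kind = free_phi kind \<circ> h \<longrightarrow> h ` I \<subseteq> I)"

definition T_generated ::
  "phi_kind \<Rightarrow> 'k::field_char_0 free_algebra set \<Rightarrow> 'k free_algebra set" where
  "T_generated kind S = T_ideal kind hull S"

definition V_space :: "nat \<Rightarrow> 'k::field_char_0 free_algebra set" where
  "V_space n = free_span
    {monomial (map (\<lambda>i. v (\<sigma> i)) [1..<Suc n]) |v \<sigma>.
      \<sigma> permutes {1..n} \<and> (\<forall>i. v i \<in> {Y i, Z i})}"

definition commutator :: "'a::ring \<Rightarrow> 'a \<Rightarrow> 'a" where
  "commutator a b = a * b - b * a"

(* Left-normed: lie [v1, ..., vt] = [[v1, ..., v(t-1)], vt]. *)
fun lie :: "'a::ring list \<Rightarrow> 'a" where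
  "lie [] = 0"
| "lie (v # vs) = foldl commutator v vs"

definition jordan :: "'a::ring \<Rightarrow> 'a \<Rightarrow> 'a" (infixl \<open>\<odot>\<close> 70) where
  "a \<odot> b = a * b + b * a"

definition free_subalgebra :: "'k::field_char_0 free_algebra set \<Rightarrow> bool" where
  "free_subalgebra B \<longleftrightarrow> free_subspace B \<and> 1 \<in> B \<and> (\<forall>p\<in>B. \<forall>q\<in>B. p * q \<in> B)"

definition B_Y :: "'k::field_char_0 free_algebra set" where
  "B_Y = free_subalgebra hull
    (range zv \<union> {lie vs |vs. length vs \<ge> 2 \<and> set vs \<subseteq> range yv \<union> range zv})"

definition \<Gamma> :: "nat \<Rightarrow> 'k::field_char_0 free_algebra set" where
  "\<Gamma> n = B_Y \<inter> V_space n"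

definition hyperoctahedral :: "nat \<Rightarrow> ((nat \<Rightarrow> 'k::field_char_0) \<times> (nat \<Rightarrow> nat)) set" where
  "hyperoctahedral n =
    {(a, \<sigma>). (\<forall>i\<in>{1..n}. a i \<in> {1, -1}) \<and> (\<forall>i. i \<notin> {1..n} \<longrightarrow> a i = 1) \<and> \<sigma> permutes {1..n}}"

(* Defined on the whole free algebra by substitution; it maps V_space n to itself. *)
definition hyp_act ::
  "(nat \<Rightarrow> 'k::field_char_0) \<times> (nat \<Rightarrow> nat) \<Rightarrow> 'k free_algebra \<Rightarrow> 'k free_algebra" where
  "hyp_act g =
    (case g of (a, \<sigma>) \<Rightarrow>
      eval fscale (\<lambda>l. case l of Y i \<Rightarrow> yv (\<sigma> i) | Z i \<Rightarrow> fscale (a (\<sigma> i)) (zv (\<sigma> i))))"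

definition hyp_submodule :: "nat \<Rightarrow> 'k::field_char_0 free_algebra set \<Rightarrow> bool" where
  "hyp_submodule n M \<longleftrightarrow>
    free_subspace M \<and> M \<subseteq> \<Gamma> n \<and> (\<forall>g\<in>hyperoctahedral n. hyp_act g ` M \<subseteq> M)"

(* V_lambda_mu: the H_2-irreducible summand of \<Gamma> 2 for the bipartition (lambda, mu) of 2;
   0 stands for the empty partition, 11 for (1,1). *)
definition V_11_0 :: "'k::field_char_0 free_algebra set" where
  "V_11_0 = free_span {lie [yv 2, yv 1]}"

definition V_1_1 :: "'k::field_char_0 free_algebra set" where
  "V_1_1 = free_span {lie [zv 2, yv 1], lie [yv 2, zv 1]}"

definition V_0_2 :: "'k::field_char_0 free_algebra set" where
  "V_0_2 = free_span {zv 1 \<odot> zv 2}"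

definition V_0_11 :: "'k::field_char_0 free_algebra set" where
  "V_0_11 = free_span {lie [zv 2, zv 1]}"

(* A sequence (M_s, ..., M_k) is given by s, k and a function M, whose values outside
   {s..k} play no role. The sum in the last condition is the elementwise sum of sets. *)
definition admissible ::
  "phi_kind \<Rightarrow> nat \<Rightarrow> nat \<Rightarrow> (nat \<Rightarrow> 'k::field_char_0 free_algebra set) \<Rightarrow> bool" where
  "admissible kind s k M \<longleftrightarrow>
    1 \<le> s \<and> s \<le> k \<and>
    (\<forall>i\<in>{s..k}. hyp_submodule i (M i) \<and> free_phi kind ` M i \<subseteq> M i) \<and>
    (s < k \<longrightarrow> M s \<noteq> {0}) \<and>
    M k \<subset> \<Gamma> k \<and>
    (\<forall>j\<in>{s+1..k}. (\<Sum>i\<in>{s..<j}. T_generated kind (M i)) \<inter> \<Gamma> j \<subseteq> M j)"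

definition associated ::
  "('k::field_char_0 \<Rightarrow> 'a::ring_1 \<Rightarrow> 'a) \<Rightarrow> ('a \<Rightarrow> 'a) \<Rightarrow>
    nat \<Rightarrow> nat \<Rightarrow> (nat \<Rightarrow> 'k free_algebra set) \<Rightarrow> bool" where
  "associated scale \<phi> s k M \<longleftrightarrow>
    (\<forall>i\<in>{1..<s}. \<Gamma> i \<inter> phi_identities scale \<phi> = {0}) \<and>
    (\<forall>i\<in>{s..k}. \<Gamma> i \<inter> phi_identities scale \<phi> = M i) \<and>
    (\<forall>i>k. \<Gamma> i \<inter> phi_identities scale \<phi> = \<Gamma> i)"

definition associated_empty ::
  "('k::field_char_0 \<Rightarrow> 'a::ring_1 \<Rightarrow> 'a) \<Rightarrow> ('a \<Rightarrow> 'a) \<Rightarrow> bool" where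
  "associated_empty scale \<phi> \<longleftrightarrow> (\<forall>i\<ge>1. \<Gamma> i \<subseteq> phi_identities scale \<phi>)"

definition generating_identity ::
  "phi_kind \<Rightarrow> ('k::field_char_0 \<Rightarrow> 'a::ring_1 \<Rightarrow> 'a) \<Rightarrow> ('a \<Rightarrow> 'a) \<Rightarrow> 'k free_algebra \<Rightarrow> bool" where
  "generating_identity kind scale \<phi> f \<longleftrightarrow>
    (\<exists>n. f \<in> V_space n \<and>
      T_generated kind {f} = phi_identities scale \<phi> \<and>
      (\<forall>g\<in>phi_identities scale \<phi>. total_degree g < n \<longrightarrow>
        T_generated kind {g} \<noteq> phi_identities scale \<phi>))"

definition f_\<Gamma>1 :: "'k::field_char_0 free_algebra" where
  "f_\<Gamma>1 = zv 1"

definition f_\<Gamma>2 :: "'k::field_char_0 free_algebra" where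
  "f_\<Gamma>2 = lie [yv 2, yv 1] + lie [zv 2, yv 1] + zv 1 * zv 2"

definition f_\<Gamma>3 :: "'k::field_char_0 free_algebra" where
  "f_\<Gamma>3 = lie [yv 3, yv 2, yv 1] + lie [yv 3, zv 2, yv 1] + zv 3 * lie [yv 2, yv 1]
    + lie [yv 3, zv 2, zv 1] + zv 3 * lie [zv 2, yv 1] + zv 1 * zv 2 * zv 3"

definition f_4 :: "'k::field_char_0 free_algebra" where
  "f_4 = f_\<Gamma>3 * yv 4 + lie [yv 2, yv 1] * lie [yv 4, yv 3]"

end

theory Submission
  imports Defs "HOL-Computational_Algebra.Polynomial"
begin

text \<open>
  Let \<open>I\<close> be the ideal of identities of \<open>A\<close>. Two facts reduce the theorem to linear algebra in degree
  two.

  First, \<open>A\<close> is unital and \<open>1\<close> is symmetric, so \<open>y\<^sub>r\<close> may be replaced by \<open>y\<^sub>r + 1\<close> in an identity. Every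
  polynomial is a sum of ordered monomials in the \<open>y\<close>'s times proper polynomials, and differences
  under these shifts isolate the proper coefficients. Hence \<open>I\<close> is generated, as a left ideal, by the
  proper polynomials that it contains (\<open>T_ideal_subset_of_proper\<close>).

  Second, let \<open>J\<close> be a T-ideal that contains the six summands of \<open>f_\<Gamma>3\<close> and \<open>[y\<^sub>2,y\<^sub>1][y\<^sub>4,y\<^sub>3]\<close>. Modulo
  \<open>J\<close> proper products and commutators of degree at least three vanish, and a proper polynomial becomes a
  combination of \<open>1\<close>, \<open>z\<^sub>i\<close>, \<open>[y\<^sub>i,y\<^sub>j]\<close>, \<open>[z\<^sub>i,y\<^sub>j]\<close> and \<open>z\<^sub>i z\<^sub>j\<close>. If such a combination lies in \<open>I\<close>, then
  setting variables to zero, changing signs and exchanging variables shows that every summand lies in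
  \<open>I\<close>, where \<open>z\<^sub>i z\<^sub>j\<close> has to be split into its symmetric and its alternating part
  (\<open>low_form_components\<close>). So \<open>J = I\<close> as soon as \<open>J \<subseteq> I\<close> and \<open>J\<close> contains those of the five
  polynomials \<open>z\<^sub>1\<close>, \<open>[y\<^sub>2,y\<^sub>1]\<close>, \<open>[z\<^sub>2,y\<^sub>1]\<close>, \<open>z\<^sub>1 \<odot> z\<^sub>2\<close>, \<open>[z\<^sub>2,z\<^sub>1]\<close> that are identities
  (\<open>eq_of_atoms_transfer\<close>).

  It remains to see that the T-ideal of the proposed polynomial contains all these pieces. The summands
  are distinguished by the sorts of their variables, so substituting \<open>0\<close> for some variables and \<open>1\<close> for
  some \<open>y\<close>'s separates them. Only \<open>[y\<^sub>2,y\<^sub>1][y\<^sub>4,y\<^sub>3]\<close> depends on the type of \<open>\<phi>\<close>. For an antiautomorphism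
  \<open>[y\<^sub>2,y\<^sub>1]\<close> is skew and may be substituted for \<open>z\<^sub>3\<close> in \<open>z\<^sub>3[y\<^sub>2,y\<^sub>1]\<close>. For an automorphism the product is
  independent of \<open>f_\<Gamma>3\<close>, which is why \<open>f_4\<close> is needed unless \<open>[y\<^sub>2,y\<^sub>1]\<close> is itself an identity. For an
  antiautomorphism commutators and symmetrized products can change between symmetric and skew, and
  therefore some quadratic identities already imply everything in degree three
  (\<open>cubic_of_skew_mult\<close>, \<open>cubic_of_skew_square_zero\<close>); this gives the generating identities of degree
  two.

  Minimality of the degree is shown by models: \<open>K\<close>, the ideal of identities of a suitable
  \<open>\<phi>\<close>-algebra, contains every identity of \<open>A\<close> of smaller degree but not the proposed polynomial. In
  degree three the models are the polynomial ring with \<open>x \<mapsto> - x\<close>, the exterior algebra on three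
  generators with two choices of \<open>\<phi>\<close>, and the algebra of a quiver with two arrows, again with two choices
  of \<open>\<phi>\<close>. In degree four the exterior algebra on four generators with \<open>\<phi> = id\<close> always works, because it
  satisfies \<open>[y\<^sub>3,y\<^sub>2,y\<^sub>1]\<close> but not \<open>[y\<^sub>2,y\<^sub>1][y\<^sub>4,y\<^sub>3]\<close>; it also shows that \<open>z\<^sub>1\<close> alone does not imply
  \<open>[y\<^sub>2,y\<^sub>1]\<close> when \<open>\<phi>\<close> is an automorphism.

  Finally, sign changes and the exchange of the two indices split every submodule of \<open>\<Gamma> 2\<close> into the
  four irreducible components (\<open>hyp_submodule_2_eq\<close>), so that \<open>M 2\<close> is one of the listed sums.
\<close>

section \<open>Evaluation and substitution in the free algebra\<close>

lemma free_algebra_induct [case_names add single]: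
  fixes p :: "'k::field_char_0 free_algebra"
  assumes add: "\<And>p q. P p \<Longrightarrow> P q \<Longrightarrow> P (p + q)"
    and single: "\<And>ls c. P (Poly_Mapping.single (Word ls) c)"
  shows "P p"
proof -
  have "P (\<Sum>w\<in>S. Poly_Mapping.single w (Poly_Mapping.lookup p w))" if "finite S" for S
    using that
  proof (induction S)
    case empty
    show ?case using single[of "[]" 0] by simp
  next
    case (insert w S)
    then show ?case using add single[of "letters w"] by simp
  qed
  moreover have "p = (\<Sum>w\<in>Poly_Mapping.keys p. Poly_Mapping.single w (Poly_Mapping.lookup p w))"
    by (rule poly_mapping_eqI)
      (simp add: lookup_sum lookup_single when_def in_keys_iff)
  ultimately show ?thesis by (metis finite_keys)
qed

lemma fscale_single: "fscale (a::'k::field_char_0) (Poly_Mapping.single w c) = Poly_Mapping.single w (a * c)"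
  by (simp add: fscale_conv_mult mult_single)

context unital_algebra
begin

definition lin_ext :: "(word \<Rightarrow> 'a) \<Rightarrow> 'k free_algebra \<Rightarrow> 'a" where
  "lin_ext f p = (\<Sum>w\<in>Poly_Mapping.keys p. scale (Poly_Mapping.lookup p w) (f w))"

lemma lin_ext_superset:
  fixes p :: "'k free_algebra"
  assumes "finite S" "Poly_Mapping.keys p \<subseteq> S"
  shows "lin_ext f p = (\<Sum>w\<in>S. scale (Poly_Mapping.lookup p w) (f w))"
  unfolding lin_ext_def
  by (rule sum.mono_neutral_left) (use assms in \<open>auto simp: in_keys_iff\<close>)

lemma lin_ext_add: "lin_ext f (p + q) = lin_ext f p + lin_ext f q"
proof -
  let ?S = "Poly_Mapping.keys p \<union> Poly_Mapping.keys q"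
  have "Poly_Mapping.keys (p + q) \<subseteq> ?S"
    by (rule Poly_Mapping.keys_add)
  then show ?thesis
    by (simp add: lin_ext_superset[of ?S] lookup_add scale_left_distrib sum.distrib)
qed

lemma lin_ext_single: "lin_ext f (Poly_Mapping.single w c) = scale c (f w)"
  by (cases "c = 0") (simp_all add: lin_ext_def)

end

global_interpretation free: unital_algebra "fscale :: 'k::field_char_0 \<Rightarrow> _"
proof
  fix c :: 'k and a b :: "'k free_algebra"
  show "fscale c (a * b) = fscale c a * b"
    by (simp add: fscale_conv_mult mult.assoc)
  show "fscale c (a * b) = a * fscale c b"
  proof (induction a rule: free_algebra_induct)
    case (add p q)
    then show ?case by (simp add: algebra_simps free.scale_right_distrib)
  next
    case (single ls d)
    have "Poly_Mapping.single 0 c * Poly_Mapping.single (Word ls) d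
        = Poly_Mapping.single (Word ls) d * Poly_Mapping.single 0 c"
      by (simp add: mult_single mult.commute)
    then show ?case by (metis fscale_conv_mult mult.assoc)
  qed
qed

lemma monomial_append: "monomial (ls @ ms) = monomial ls * monomial ms"
  by (simp add: monomial_def mult_single plus_word_def)

lemma monomial_Cons: "monomial (l # ls) = monomial [l] * monomial ls"
  using monomial_append[of "[l]" ls] by simp

lemma monomial_Nil: "monomial [] = 1"
  by (simp add: monomial_def flip: zero_word_def)

lemma single_eq_fscale_monomial: "Poly_Mapping.single (Word ls) (c::'k::field_char_0) = fscale c (monomial ls)"
  by (simp add: monomial_def fscale_single)

context unital_algebra
begin

lemma scale_mult_scale: "scale c a * scale d b = scale (c * d) (a * b)"
  by (metis scale_mult_left scale_mult_right scale_scale)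

lemma eval_eq_lin_ext: "eval scale v = lin_ext (\<lambda>w. prod_list (map v (letters w)))"
  by (simp add: fun_eq_iff eval_def lin_ext_def)

lemma eval_add: "eval scale v (p + q) = eval scale v p + eval scale v q"
  by (simp add: eval_eq_lin_ext lin_ext_add)

lemma eval_single: "eval scale v (Poly_Mapping.single (Word ls) c) = scale c (prod_list (map v ls))"
  by (simp add: eval_eq_lin_ext lin_ext_single)

lemma eval_zero: "eval scale v 0 = 0"
  by (simp add: eval_def)

lemma eval_one: "eval scale v 1 = 1"
  using eval_single[of v "[]" 1] by (simp flip: zero_word_def)

lemma eval_monomial: "eval scale v (monomial ls) = prod_list (map v ls)"
  by (simp add: monomial_def eval_single)

lemma eval_yv: "eval scale v (yv i) = v (Y i)"
  by (simp add: yv_def eval_monomial)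

lemma eval_zv: "eval scale v (zv i) = v (Z i)"
  by (simp add: zv_def eval_monomial)

lemma eval_uminus: "eval scale v (- p) = - eval scale v p"
  by (metis add.inverse_unique add.right_inverse eval_add eval_zero)

lemma eval_diff: "eval scale v (p - q) = eval scale v p - eval scale v q"
  by (metis eval_add eval_uminus diff_conv_add_uminus)

lemma eval_mult: "eval scale v (p * q) = eval scale v p * eval scale v q"
proof (induction p rule: free_algebra_induct)
  case (add p p')
  then show ?case by (simp add: algebra_simps eval_add)
next
  case (single ls c)
  show ?case
  proof (induction q rule: free_algebra_induct)
    case (add q q')
    then show ?case by (simp add: algebra_simps eval_add)
  next
    case (single ms d)
    show ?case
      by (simp add: mult_single plus_word_def eval_single scale_mult_scale)
  qed
qed

lemma eval_fscale: "eval scale v (fscale c p) = scale c (eval scale v p)"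
proof -
  have "eval scale v (Poly_Mapping.single 0 c) = scale c 1"
    using eval_single[of v "[]" c] by (simp flip: zero_word_def)
  then show ?thesis
    by (simp add: fscale_conv_mult eval_mult flip: scale_mult_left)
qed

lemma eval_sum: "eval scale v (sum f S) = (\<Sum>i\<in>S. eval scale v (f i))"
  by (induction S rule: infinite_finite_induct) (simp_all add: eval_zero eval_add)

lemma eval_numeral: "eval scale v (numeral m) = numeral m"
proof -
  have "eval scale v (of_nat m) = of_nat m" for m
    by (induction m) (simp_all add: eval_zero eval_add eval_one)
  from this[of "numeral m"] show ?thesis by simp
qed

lemma eval_commutator: "eval scale v (commutator p q) = commutator (eval scale v p) (eval scale v q)"
  by (simp add: commutator_def eval_mult eval_diff)

lemma eval_jordan: "eval scale v (p \<odot> q) = eval scale v p \<odot> eval scale v q"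
  by (simp add: jordan_def eval_mult eval_add)

lemmas eval_simps = eval_zero eval_one eval_add eval_uminus eval_diff eval_mult eval_fscale
  eval_yv eval_zv eval_commutator eval_jordan eval_sum eval_numeral

lemma commutator_scale:
  "commutator (scale c a) b = scale c (commutator a b)"
  "commutator a (scale c b) = scale c (commutator a b)"
  by (simp_all add: commutator_def scale_right_diff_distrib flip: scale_mult_left scale_mult_right)

end

abbreviation sub :: "(letter \<Rightarrow> 'k::field_char_0 free_algebra) \<Rightarrow> 'k free_algebra \<Rightarrow> 'k free_algebra" where
  "sub \<equiv> eval fscale"

text \<open>Substitution is evaluation in the free algebra; composing the two is again an
  evaluation, because both are homomorphisms fixed by their values on letters.\<close>

lemma (in unital_algebra) eval_sub: "eval scale v (sub u p) = eval scale (\<lambda>l. eval scale v (u l)) p"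
proof (induction p rule: free_algebra_induct)
  case (add p q)
  then show ?case by (simp add: eval_simps free.eval_simps)
next
  case (single ls c)
  have "eval scale v (prod_list (map u ls)) = prod_list (map (\<lambda>l. eval scale v (u l)) ls)"
    by (induction ls) (simp_all add: eval_simps)
  then show ?case
    by (simp only: eval_single free.eval_single eval_fscale)
qed

section \<open>Ideals of identities\<close>

lemma free_phi_eq_lin_ext:
  "free_phi kind = free.lin_ext (\<lambda>w. prod_list (map (case_letter yv (\<lambda>i. - zv i))
      (case kind of Automorphism \<Rightarrow> letters w | Antiautomorphism \<Rightarrow> rev (letters w))))"
  by (simp add: fun_eq_iff free_phi_def free.lin_ext_def Let_def)

lemma free_phi_add: "free_phi kind (p + q) = free_phi kind p + free_phi kind q"
  by (simp add: free_phi_eq_lin_ext free.lin_ext_add)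

lemma free_phi_single:
  "free_phi kind (Poly_Mapping.single (Word ls) c) = fscale c (prod_list (map (case_letter yv (\<lambda>i. - zv i))
      (case kind of Automorphism \<Rightarrow> ls | Antiautomorphism \<Rightarrow> rev ls)))"
  by (cases kind) (simp_all add: free_phi_eq_lin_ext free.lin_ext_single)

lemma free_phi_one: "free_phi kind 1 = 1"
  using free_phi_single[of kind "[]" 1] by (cases kind) (simp_all flip: zero_word_def)

lemma free_phi_yv: "free_phi kind (yv i) = yv i"
  by (cases kind) (simp_all add: yv_def monomial_def free_phi_single)

lemma free_phi_zv: "free_phi kind (zv i) = - zv i"
  by (cases kind) (simp_all add: zv_def monomial_def free_phi_single)

lemma free_phi_mult:
  "free_phi kind (p * q) = (case kind of Automorphism \<Rightarrow> free_phi kind p * free_phi kind q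
     | Antiautomorphism \<Rightarrow> free_phi kind q * free_phi kind p)"
proof (induction p rule: free_algebra_induct)
  case (add p p')
  then show ?case by (cases kind) (simp_all add: algebra_simps free_phi_add)
next
  case (single ls c)
  show ?case
  proof (induction q rule: free_algebra_induct)
    case (add q q')
    then show ?case by (cases kind) (simp_all add: algebra_simps free_phi_add)
  next
    case (single ms d)
    show ?case
      by (cases kind)
        (simp_all add: mult_single plus_word_def free_phi_single free.scale_mult_scale mult.commute)
  qed
qed

lemma free_phi_fscale: "free_phi kind (fscale c p) = fscale c (free_phi kind p)"
proof -
  have "free_phi kind (Poly_Mapping.single 0 c) = fscale c 1"
    using free_phi_single[of kind "[]" c] by (cases kind) (simp_all flip: zero_word_def)
  then have "free_phi kind (fscale c 1) = fscale c 1"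
    by (simp add: fscale_conv_mult)
  then show ?thesis
    using free_phi_mult[of kind "fscale c 1" p]
    by (cases kind) (simp_all flip: free.scale_mult_left free.scale_mult_right)
qed

lemma free_phi_uminus: "free_phi kind (- p) = - free_phi kind p"
  using free_phi_fscale[of kind "- 1" p] by simp

lemma free_phi_involution:
  fixes p :: "'k::field_char_0 free_algebra"
  shows "free_phi kind (free_phi kind p) = p"
proof (induction p rule: free_algebra_induct)
  case (add p q)
  then show ?case by (simp add: free_phi_add)
next
  case (single ls c)
  have letter: "free_phi k (free_phi k (monomial [l])) = (monomial [l] :: 'k free_algebra)" for k l
    by (cases l) (simp_all add: free_phi_yv free_phi_zv free_phi_uminus flip: yv_def zv_def)
  have "free_phi kind (free_phi kind (monomial ls)) = (monomial ls :: 'k free_algebra)"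
  proof (induction ls)
    case Nil
    then show ?case by (simp add: monomial_Nil free_phi_one)
  next
    case (Cons l ls)
    then show ?case
      by (cases kind) (simp_all add: monomial_Cons[of l ls] free_phi_mult letter)
  qed
  then show ?case by (simp add: single_eq_fscale_monomial free_phi_fscale)
qed

global_interpretation free: phi_algebra kind fscale "free_phi kind" for kind
  by standard (simp_all add: free_phi_add free_phi_fscale free_phi_one free_phi_mult free_phi_involution)

definition admissible_valuation :: "('a::ring_1 \<Rightarrow> 'a) \<Rightarrow> (letter \<Rightarrow> 'a) \<Rightarrow> bool" where
  "admissible_valuation \<phi> v \<longleftrightarrow> (\<forall>i. \<phi> (v (Y i)) = v (Y i)) \<and> (\<forall>i. \<phi> (v (Z i)) = - v (Z i))"

context phi_algebra
begin

lemma phi_add: "\<phi> (a + b) = \<phi> a + \<phi> b"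
  and phi_scale: "\<phi> (scale c a) = scale c (\<phi> a)"
  using phi_linear by (simp_all add: Vector_Spaces.linear_iff)

lemma phi_zero: "\<phi> 0 = 0"
  using phi_add[of 0 0] by simp

lemma phi_uminus: "\<phi> (- a) = - \<phi> a"
  using phi_add[of a "- a"] by (simp add: phi_zero add_eq_0_iff)

lemma phi_diff: "\<phi> (a - b) = \<phi> a - \<phi> b"
  using phi_add[of a "- b"] by (simp add: phi_uminus)

text \<open>An admissible valuation intertwines the two involutive maps: both sides are linear and
  (anti)multiplicative in \<open>p\<close> and agree on letters.\<close>

lemma phi_eval:
  assumes "admissible_valuation \<phi> v"
  shows "\<phi> (eval scale v p) = eval scale v (free_phi kind p)"
proof (induction p rule: free_algebra_induct)
  case (add p q)
  then show ?case by (simp add: phi_add free_phi_add eval_add)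
next
  case (single ls c)
  have "\<phi> (eval scale v (monomial ls)) = eval scale v (free_phi kind (monomial ls))"
  proof (induction ls)
    case Nil
    then show ?case
      by (simp add: monomial_Nil free_phi_one phi_one eval_one)
  next
    case (Cons l ls)
    have "\<phi> (eval scale v (monomial [l])) = eval scale v (free_phi kind (monomial [l]))"
      using assms
      by (cases l) (simp_all add: admissible_valuation_def eval_simps free_phi_yv free_phi_zv
          flip: yv_def zv_def)
    then show ?case using Cons
      by (cases kind) (simp_all add: monomial_Cons[of l ls] free_phi_mult phi_mult eval_mult)
  qed
  then show ?case by (simp add: single_eq_fscale_monomial free_phi_fscale phi_scale eval_fscale)
qed

end

lemma phi_identities_iff:
  "f \<in> phi_identities scale \<phi> \<longleftrightarrow> (\<forall>v. admissible_valuation \<phi> v \<longrightarrow> eval scale v f = 0)"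
  by (simp add: phi_identities_def admissible_valuation_def)

text \<open>An endomorphism is determined by the images of the letters.\<close>

lemma free_endomorphism_eq_sub:
  assumes "free_endomorphism h"
  shows "h p = sub (\<lambda>l. h (monomial [l])) p"
proof (induction p rule: free_algebra_induct)
  case (add p q)
  then show ?case
    using assms by (simp add: free_endomorphism_def Vector_Spaces.linear_iff free.eval_add)
next
  case (single ls c)
  have "h (monomial ls) = prod_list (map (\<lambda>l. h (monomial [l])) ls)"
  proof (induction ls)
    case Nil
    then show ?case
      using assms by (simp add: free_endomorphism_def monomial_Nil)
  next
    case (Cons l ls)
    show ?case using Cons assms by (simp add: monomial_Cons[of l ls] free_endomorphism_def)
  qed
  then show ?case
    using assms by (simp add: single_eq_fscale_monomial free_endomorphism_def Vector_Spaces.linear_iff free.eval_fscale free.eval_monomial)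
qed

lemma T_ideal_sub:
  assumes "T_ideal kind I" "admissible_valuation (free_phi kind) u" "p \<in> I"
  shows "sub u p \<in> I"
proof -
  have "free_endomorphism (sub u)"
    unfolding free_endomorphism_def
    by (simp add: Vector_Spaces.linear_iff free.eval_simps free.vector_space_axioms)
  moreover have "sub u \<circ> free_phi kind = free_phi kind \<circ> sub u"
    using free.phi_eval[OF assms(2)] by (simp add: fun_eq_iff)
  ultimately show ?thesis
    using assms unfolding T_ideal_def by blast
qed

lemma T_ideal_zero: "T_ideal kind I \<Longrightarrow> 0 \<in> I"
  and T_ideal_add: "T_ideal kind I \<Longrightarrow> p \<in> I \<Longrightarrow> q \<in> I \<Longrightarrow> p + q \<in> I"
  and T_ideal_mult_left: "T_ideal kind I \<Longrightarrow> p \<in> I \<Longrightarrow> r * p \<in> I"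
  and T_ideal_mult_right: "T_ideal kind I \<Longrightarrow> p \<in> I \<Longrightarrow> p * r \<in> I"
  by (simp_all add: T_ideal_def two_sided_ideal_def)

lemma T_ideal_fscale: "T_ideal kind I \<Longrightarrow> p \<in> I \<Longrightarrow> fscale c p \<in> I"
  by (simp add: fscale_conv_mult T_ideal_mult_left)

lemma T_ideal_uminus: "T_ideal kind I \<Longrightarrow> p \<in> I \<Longrightarrow> - p \<in> I"
  using T_ideal_mult_left[of kind I p "-1"] by simp

lemma T_ideal_diff: "T_ideal kind I \<Longrightarrow> p \<in> I \<Longrightarrow> q \<in> I \<Longrightarrow> p - q \<in> I"
  using T_ideal_add[of kind I p "- q"] by (simp add: T_ideal_uminus)

lemma T_ideal_sum:
  "T_ideal kind I \<Longrightarrow> (\<And>i. i \<in> S \<Longrightarrow> f i \<in> I) \<Longrightarrow> sum f S \<in> I"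
  by (induction S rule: infinite_finite_induct) (simp_all add: T_ideal_zero T_ideal_add)

lemma T_ideal_fscale_iff:
  assumes "T_ideal kind I" "c \<noteq> 0"
  shows "fscale c p \<in> I \<longleftrightarrow> p \<in> I"
  using T_ideal_fscale[OF assms(1), of "fscale c p" "inverse c"] T_ideal_fscale[OF assms(1), of p c] assms(2)
  by auto

text \<open>Composing an admissible valuation with an endomorphism that commutes with
  \<open>free_phi\<close> yields an admissible valuation.\<close>

theorem (in phi_algebra) T_ideal_phi_identities: "T_ideal kind (phi_identities scale \<phi>)"
  unfolding T_ideal_def
proof (intro conjI allI impI)
  show "two_sided_ideal (phi_identities scale \<phi>)"
    by (auto simp: two_sided_ideal_def phi_identities_iff eval_simps)
  fix h :: "'k free_algebra \<Rightarrow> 'k free_algebra"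
  assume h: "free_endomorphism h \<and> h \<circ> free_phi kind = free_phi kind \<circ> h"
  then have comm: "free_phi kind (h p) = h (free_phi kind p)" for p
    by (metis comp_apply)
  have "h (fscale c q) = fscale c (h q)" for c q
    using h unfolding free_endomorphism_def Vector_Spaces.linear_iff by blast
  from this[of "- 1"] have lin: "h (- q) = - h q" for q
    by simp
  show "h ` phi_identities scale \<phi> \<subseteq> phi_identities scale \<phi>"
  proof clarify
    fix p
    assume p: "p \<in> phi_identities scale \<phi>"
    show "h p \<in> phi_identities scale \<phi>"
      unfolding phi_identities_iff
    proof (intro allI impI)
      fix v
      assume v: "admissible_valuation \<phi> v"
      define u where "u = (\<lambda>l. h (monomial [l]))"
      have "free_phi kind (u (Y i)) = u (Y i)" "free_phi kind (u (Z i)) = - u (Z i)" for i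
        by (simp_all add: u_def comm lin free_phi_yv free_phi_zv flip: yv_def zv_def)
      then have "admissible_valuation \<phi> (\<lambda>l. eval scale v (u l))"
        unfolding admissible_valuation_def by (simp add: phi_eval[OF v] eval_uminus)
      moreover have "h p = sub u p"
        unfolding u_def by (rule free_endomorphism_eq_sub) (use h in blast)
      ultimately show "eval scale v (h p) = 0"
        using p by (simp add: phi_identities_iff eval_sub)
    qed
  qed
qed

lemma T_ideal_Inter: "(\<And>I. I \<in> \<I> \<Longrightarrow> T_ideal kind I) \<Longrightarrow> T_ideal kind (\<Inter>\<I>)"
  unfolding T_ideal_def two_sided_ideal_def by (simp add: image_subset_iff)

lemma T_ideal_Int: "T_ideal kind I \<Longrightarrow> T_ideal kind J \<Longrightarrow> T_ideal kind (I \<inter> J)"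
  using T_ideal_Inter[of "{I, J}"] by auto

lemma T_ideal_T_generated: "T_ideal kind (T_generated kind S)"
  unfolding T_generated_def by (rule hull_in) (simp add: T_ideal_Inter Ball_def)

lemma T_generated_subset: "T_ideal kind I \<Longrightarrow> S \<subseteq> I \<Longrightarrow> T_generated kind S \<subseteq> I"
  unfolding T_generated_def by (rule hull_minimal)

lemma in_T_generated: "p \<in> S \<Longrightarrow> p \<in> T_generated kind S"
  unfolding T_generated_def by (rule hull_inc)

section \<open>Proper polynomials generate unital T-ideals\<close>

primrec letter_index :: "letter \<Rightarrow> nat" where
  "letter_index (Y i) = i"
| "letter_index (Z i) = i"

text \<open>The elements of degree at most \<open>d\<close>, in variables with index below
  \<open>n\<close>, of the subalgebra generated by the \<open>z\<close>'s and all commutators.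
  Closure under brackets with a \<open>y\<close> takes the place of longer commutators; brackets
  with a \<open>z\<close> come from products.\<close>

inductive proper :: "nat \<Rightarrow> nat \<Rightarrow> 'k::field_char_0 free_algebra \<Rightarrow> bool" for n where
  const: "proper n d (fscale c 1)"
| zv: "i < n \<Longrightarrow> 1 \<le> d \<Longrightarrow> proper n d (zv i)"
| yv_yv: "i < n \<Longrightarrow> j < n \<Longrightarrow> 2 \<le> d \<Longrightarrow> proper n d (commutator (yv i) (yv j))"
| bracket: "proper n d p \<Longrightarrow> i < n \<Longrightarrow> proper n (Suc d) (commutator p (yv i))"
| add: "proper n d p \<Longrightarrow> proper n d q \<Longrightarrow> proper n d (p + q)"
| mult: "proper n d p \<Longrightarrow> proper n e q \<Longrightarrow> proper n (d + e) (p * q)"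

lemma proper_mono: "proper n d p \<Longrightarrow> d \<le> e \<Longrightarrow> proper n e p"
proof (induction arbitrary: e rule: proper.induct)
  case (bracket d p i)
  then obtain e' where "e = Suc e'" "d \<le> e'"
    by (metis Suc_le_D Suc_le_mono)
  then show ?case using bracket by (auto intro: proper.bracket)
next
  case (mult d1 p d2 q)
  then show ?case
    using proper.mult[of n "e - d2" p d2 q] by simp
qed (auto intro: proper.intros)

text \<open>Sums of products \<open>y\<^sub>s\<^sub>1 y\<^sub>s\<^sub>2 \<dots> y\<^sub>s\<^sub>k
  p\<close> with \<open>r > s\<^sub>1 \<ge> s\<^sub>2 \<ge> \<dots>\<close> and \<open>p\<close>
  proper. The bound on the indices makes an induction on \<open>r\<close> possible, in which one
  \<open>y\<close> is treated at a time.\<close>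

inductive ordered :: "nat \<Rightarrow> nat \<Rightarrow> nat \<Rightarrow> 'k::field_char_0 free_algebra \<Rightarrow> bool" for n where
  proper: "proper n d p \<Longrightarrow> ordered n r d p"
| add: "ordered n r d p \<Longrightarrow> ordered n r d q \<Longrightarrow> ordered n r d (p + q)"
| yv: "ordered n (Suc s) d p \<Longrightarrow> s < r \<Longrightarrow> s < n \<Longrightarrow> ordered n r (Suc d) (yv s * p)"

lemma ordered_mono: "ordered n r d p \<Longrightarrow> r \<le> r' \<Longrightarrow> d \<le> d' \<Longrightarrow> ordered n r' d' p"
proof (induction arbitrary: r' d' rule: ordered.induct)
  case (yv s d p r)
  then obtain e where "d' = Suc e" "d \<le> e"
    by (metis Suc_le_D Suc_le_mono)
  then show ?case using yv by (auto intro: ordered.yv)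
qed (auto intro: ordered.proper ordered.add proper_mono)

text \<open>A proper factor moves to the right past \<open>y\<^sub>s\<close> at the cost of its
  commutator with \<open>y\<^sub>s\<close>, which is proper again and one degree higher.\<close>

lemma ordered_mult_proper:
  "ordered n r d p \<Longrightarrow> proper n e b \<Longrightarrow> ordered n r (d + e) (b * p)"
proof (induction arbitrary: e b rule: ordered.induct)
  case (proper d p r)
  then show ?case
    using proper.mult[of n e b d p] by (auto intro: ordered.proper simp: add.commute)
next
  case (add r d p q)
  then show ?case by (simp add: distrib_left ordered.add)
next
  case (yv s d p r)
  have "ordered n r (Suc (d + e)) (yv s * (b * p))"
    using yv by (auto intro: ordered.yv)
  moreover have "ordered n (Suc s) (d + Suc e) (commutator b (yv s) * p)"
    by (rule yv.IH) (use yv in \<open>auto intro: proper.bracket\<close>)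
  then have "ordered n r (Suc (d + e)) (commutator b (yv s) * p)"
    by (rule ordered_mono) (use yv in auto)
  moreover have "b * (yv s * p) = yv s * (b * p) + commutator b (yv s) * p"
    by (simp add: commutator_def algebra_simps)
  ultimately show ?case by (auto intro: ordered.add)
qed

lemma ordered_commutator_yv:
  "ordered n r d p \<Longrightarrow> i < n \<Longrightarrow> ordered n r (Suc d) (commutator p (yv i))"
proof (induction rule: ordered.induct)
  case (proper d p r)
  then show ?case by (auto intro: ordered.proper proper.bracket)
next
  case (add r d p q)
  then have "ordered n r (Suc d) (commutator p (yv i) + commutator q (yv i))"
    by (auto intro: ordered.add)
  then show ?case by (simp add: commutator_def algebra_simps)
next
  case (yv s d p r)
  have "ordered n r (Suc (Suc d)) (yv s * commutator p (yv i))"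
    using yv by (auto intro: ordered.yv)
  moreover have "ordered n r (d + 2) (commutator (yv s) (yv i) * p)"
    by (intro ordered_mult_proper proper.yv_yv ordered_mono[OF yv(1)]) (use yv in auto)
  moreover have "commutator (yv s * p) (yv i) = yv s * commutator p (yv i) + commutator (yv s) (yv i) * p"
    by (simp add: commutator_def algebra_simps)
  ultimately show ?case by (auto intro: ordered.add)
qed

text \<open>If \<open>i\<close> exceeds the leading index then \<open>y\<^sub>i\<close> is moved to
  the very front, and the commutator that arises is covered by \<open>ordered_commutator_yv\<close>;
  otherwise it passes the leading factor unchanged.\<close>

lemma ordered_mult_yv:
  "ordered n r d p \<Longrightarrow> i < r \<Longrightarrow> i < n \<Longrightarrow> ordered n r (Suc d) (p * yv i)"
proof (induction rule: ordered.induct)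
  case (proper d p r)
  have "ordered n r (Suc d) (yv i * p + commutator p (yv i))"
    using proper by (auto intro!: ordered.add ordered.yv intro: ordered.proper proper.bracket)
  then show ?case by (simp add: commutator_def)
next
  case (add r d p q)
  then show ?case by (simp add: distrib_right ordered.add)
next
  case (yv s d p r)
  show ?case
  proof (cases "i \<le> s")
    case True
    then show ?thesis using yv by (auto intro!: ordered.yv simp: mult.assoc)
  next
    case False
    have "ordered n (Suc i) (Suc d) (yv s * p)"
      using yv False by (auto intro: ordered.yv)
    then have "ordered n r (Suc (Suc d)) (yv i * (yv s * p))"
      using yv by (auto intro: ordered.yv)
    moreover have "ordered n r (Suc (Suc d)) (commutator (yv s * p) (yv i))"
      using yv by (auto intro!: ordered_commutator_yv ordered.yv)
    moreover have "yv s * p * yv i = yv i * (yv s * p) + commutator (yv s * p) (yv i)"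
      by (simp add: commutator_def)
    ultimately show ?thesis by (auto intro: ordered.add)
  qed
qed

lemma ordered_mult_zv:
  "ordered n r d p \<Longrightarrow> i < n \<Longrightarrow> ordered n r (Suc d) (p * zv i)"
proof (induction rule: ordered.induct)
  case (proper d p r)
  then show ?case
    using proper.mult[of n d p 1 "zv i"] by (simp add: ordered.proper proper.zv)
next
  case (add r d p q)
  then show ?case by (simp add: distrib_right ordered.add)
next
  case (yv s d p r)
  then show ?case by (auto intro!: ordered.yv simp: mult.assoc)
qed

lemma ordered_single:
  "letter_index ` set ls \<subseteq> {..<n} \<Longrightarrow> ordered n n (length ls) (Poly_Mapping.single (Word ls) c)"
proof (induction ls rule: rev_induct)
  case Nil
  have "ordered n n 0 (fscale c 1)"
    by (intro ordered.proper proper.const)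
  then show ?case by (simp add: fscale_conv_mult flip: zero_word_def)
next
  case (snoc l ls)
  have "ordered n n (Suc (length ls)) (Poly_Mapping.single (Word ls) c * monomial [l])"
    using snoc
    by (cases l) (simp_all add: ordered_mult_yv ordered_mult_zv flip: yv_def zv_def)
  then show ?case by (simp add: monomial_def mult_single plus_word_def)
qed

text \<open>The spanning half of the Poincare-Birkhoff-Witt theorem for the variables
  \<open>y\<close>, with control of the degree. Its counterpart, independence, enters through
  \<open>shift_coefficients\<close>.\<close>

lemma ordered_of_bounded:
  assumes "\<And>w. w \<in> Poly_Mapping.keys p \<Longrightarrow> letter_index ` set (letters w) \<subseteq> {..<n} \<and> length (letters w) \<le> d"
  shows "ordered n n d p"
proof -
  have zero: "ordered n n d 0"
    using ordered.proper[OF proper.const[of n d 0]] by simp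
  have "ordered n n d (\<Sum>w\<in>S. Poly_Mapping.single w (Poly_Mapping.lookup p w))"
    if "finite S" "S \<subseteq> Poly_Mapping.keys p" for S
    using that
  proof (induction S)
    case (insert w S)
    then have "ordered n n d (Poly_Mapping.single w (Poly_Mapping.lookup p w))"
      using assms[of w] ordered_mono[OF ordered_single[of "letters w" n "Poly_Mapping.lookup p w"]]
      by simp
    then show ?case using insert by (auto intro: ordered.add)
  qed (simp add: zero)
  moreover have "p = (\<Sum>w\<in>Poly_Mapping.keys p. Poly_Mapping.single w (Poly_Mapping.lookup p w))"
    by (rule poly_mapping_eqI)
      (simp add: lookup_sum lookup_single when_def in_keys_iff)
  ultimately show ?thesis by (metis finite_keys order_refl)
qed

lemma length_le_total_degree: "w \<in> Poly_Mapping.keys p \<Longrightarrow> length (letters w) \<le> total_degree p"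
  unfolding total_degree_def by (rule Max_ge) auto

lemma letters_bounded:
  obtains n where "\<And>w. w \<in> Poly_Mapping.keys p \<Longrightarrow> letter_index ` set (letters w) \<subseteq> {..<n}"
proof -
  have "finite (\<Union>w\<in>Poly_Mapping.keys p. letter_index ` set (letters w))" by simp
  then obtain n where "\<forall>i\<in>(\<Union>w\<in>Poly_Mapping.keys p. letter_index ` set (letters w)). i < n"
    unfolding finite_nat_set_iff_bounded by blast
  then show ?thesis by (intro that) blast
qed

text \<open>Collecting the powers of the largest variable \<open>y\<^sub>r\<close> turns an ordered
  polynomial into a polynomial in \<open>y\<^sub>r\<close> whose coefficients involve only smaller
  \<open>y\<close>'s outside proper factors.\<close>

lemma ordered_Suc_expansion:
  assumes "ordered n (Suc r) d p"
  shows "\<exists>u m. (\<forall>j. ordered n r d (u j)) \<and> p = (\<Sum>j\<le>m. yv r ^ j * u j)"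
proof -
  have zero: "ordered n r d 0" for d
    using ordered.proper[OF proper.const[of n d 0]] by simp
  have "\<exists>u m. (\<forall>j. ordered n r d (u j)) \<and> (\<forall>j>m. u j = 0) \<and> p = (\<Sum>j\<le>m. yv r ^ j * u j)"
    if "ordered n r' d p" "r' \<le> Suc r" for r' d and p :: "'a free_algebra"
    using that
  proof (induction rule: ordered.induct)
    case (proper d p r')
    then show ?case
      by (intro exI[of _ "\<lambda>j. if j = 0 then p else 0"] exI[of _ 0])
        (auto intro: ordered.proper zero)
  next
    case (add r' d p q)
    then obtain u m v k where
      u: "\<And>j. ordered n r d (u j)" "\<And>j. j > m \<Longrightarrow> u j = 0" "p = (\<Sum>j\<le>m. yv r ^ j * u j)" and
      v: "\<And>j. ordered n r d (v j)" "\<And>j. j > k \<Longrightarrow> v j = 0" "q = (\<Sum>j\<le>k. yv r ^ j * v j)"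
      by blast
    have "p = (\<Sum>j\<le>max m k. yv r ^ j * u j)" "q = (\<Sum>j\<le>max m k. yv r ^ j * v j)"
      unfolding u(3) v(3) by (rule sum.mono_neutral_left; auto simp: u(2) v(2))+
    then have "p + q = (\<Sum>j\<le>max m k. yv r ^ j * (u j + v j))"
      by (simp add: distrib_left sum.distrib)
    then show ?case
      using u(1,2) v(1,2)
      by (intro exI[of _ "\<lambda>j. u j + v j"] exI[of _ "max m k"]) (auto intro: ordered.add)
  next
    case (yv s d p r')
    show ?case
    proof (cases "s = r")
      case True
      obtain u m where u: "\<And>j. ordered n r d (u j)" "\<And>j. j > m \<Longrightarrow> u j = 0"
          "p = (\<Sum>j\<le>m. yv r ^ j * u j)"
        using yv by force
      have "yv s * p = (\<Sum>j\<le>Suc m. yv r ^ j * (case j of 0 \<Rightarrow> 0 | Suc i \<Rightarrow> u i))"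
        by (simp add: True u(3) sum.atMost_Suc_shift sum_distrib_left mult.assoc del: sum.atMost_Suc)
      then show ?thesis
        using u(1,2)
        by (intro exI[of _ "case_nat 0 u"] exI[of _ "Suc m"])
          (auto split: nat.split intro: zero ordered_mono[OF _ order_refl le_SucI])
    next
      case False
      then have "ordered n r (Suc d) (yv s * p)"
        using yv by (auto intro: ordered.yv)
      then show ?thesis
        by (intro exI[of _ "\<lambda>j. if j = 0 then yv s * p else 0"] exI[of _ 0])
          (auto intro: zero)
    qed
  qed
  then show ?thesis using assms by blast
qed

text \<open>The substitution \<open>y\<^sub>r \<mapsto> y\<^sub>r + 1\<close>. It commutes with
  \<open>free_phi\<close> and fixes commutators, hence all proper polynomials.\<close>

definition shift :: "nat \<Rightarrow> letter \<Rightarrow> 'k::field_char_0 free_algebra" where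
  "shift r l = (if l = Y r then yv r + 1 else monomial [l])"

lemma shift_simps: "shift r (Z i) = zv i" "shift r (Y i) = (if i = r then yv r + 1 else yv i)"
  by (simp_all add: shift_def yv_def zv_def)

lemma admissible_shift: "admissible_valuation (free_phi kind) (shift r)"
  by (simp add: admissible_valuation_def shift_simps free_phi_add free_phi_one free_phi_yv free_phi_zv)

lemma sub_shift_proper: "proper n d p \<Longrightarrow> sub (shift r) p = p"
  by (induction rule: proper.induct)
    (simp_all add: free.eval_simps shift_simps, simp_all add: commutator_def algebra_simps)

lemma sub_shift_ordered: "ordered n r' d p \<Longrightarrow> r' \<le> r \<Longrightarrow> sub (shift r) p = p"
  by (induction rule: ordered.induct)
    (simp_all add: free.eval_simps shift_simps sub_shift_proper)

lemma power_add_one: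
  fixes y :: "'a::ring_1"
  shows "(y + 1) ^ j = (\<Sum>i\<le>j. of_nat (j choose i) * y ^ i)"
proof (induction j)
  case (Suc j)
  have "(\<Sum>i\<le>j. of_nat (j choose i) * y ^ i) = (\<Sum>i\<le>Suc j. of_nat (j choose i) * y ^ i)"
    by (simp add: binomial_eq_0)
  also have "\<dots> = 1 + (\<Sum>i\<le>j. of_nat (j choose Suc i) * y ^ Suc i)"
    by (subst sum.atMost_Suc_shift) simp
  finally have shifted: "(\<Sum>i\<le>j. of_nat (j choose i) * y ^ i) = \<dots>" .
  have "(y + 1) ^ Suc j = (\<Sum>i\<le>j. of_nat (j choose i) * y ^ i) * y + (\<Sum>i\<le>j. of_nat (j choose i) * y ^ i)"
    using Suc by (simp add: power_Suc2 distrib_left del: power_Suc)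
  also have "\<dots> = (\<Sum>i\<le>j. of_nat (j choose i) * y ^ Suc i) + (1 + (\<Sum>i\<le>j. of_nat (j choose Suc i) * y ^ Suc i))"
    by (subst (2) shifted) (simp add: sum_distrib_right power_Suc2 mult.assoc del: power_Suc)
  also have "\<dots> = 1 + (\<Sum>i\<le>j. of_nat (Suc j choose Suc i) * y ^ Suc i)"
    by (simp add: sum.distrib algebra_simps del: power_Suc)
  also have "\<dots> = (\<Sum>i\<le>Suc j. of_nat (Suc j choose i) * y ^ i)"
    by (subst sum.atMost_Suc_shift) simp
  finally show ?case .
qed simp

lemma fscale_of_nat: "fscale (of_nat m) p = of_nat m * p"
  by (induction m) (simp_all add: free.scale_left_distrib distrib_right)

text \<open>The difference of \<open>\<Sum>\<^sub>j y\<^sup>j u\<^sub>j\<close> and its shift has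
  degree one less in \<open>y\<close>, and its top coefficient is a multiple of the old one. By
  induction that coefficient lies in \<open>I\<close>; here characteristic zero is used to divide by
  the multiple. Then the top term can be subtracted.\<close>

lemma shift_coefficients:
  assumes I: "T_ideal kind I" and u: "\<And>j. sub (shift r) (u j) = u j"
    and "(\<Sum>j\<le>m. yv r ^ j * u j) \<in> I" "j \<le> m"
  shows "u j \<in> I"
  using assms(2-)
proof (induction m arbitrary: u j)
  case 0
  then show ?case by simp
next
  case (Suc m)
  let ?y = "yv r :: 'a free_algebra"
  let ?p = "\<Sum>j\<le>Suc m. ?y ^ j * u j"
  \<comment> \<open>The coefficients of the difference; \<open>w m\<close> is \<open>Suc m\<close> times the old top coefficient.\<close>
  define w where "w i = (\<Sum>j\<le>Suc m. if i < j then of_nat (j choose i) * u j else 0)" for i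
  have power: "sub (shift r) (?y ^ j) = (?y + 1) ^ j" for j
    by (induction j) (simp_all add: free.eval_simps shift_simps)
  have difference: "(?y + 1) ^ j * u j - ?y ^ j * u j
      = (\<Sum>i\<le>m. if i < j then ?y ^ i * (of_nat (j choose i) * u j) else 0)" if "j \<le> Suc m" for j
  proof -
    have "(?y + 1) ^ j * u j - ?y ^ j * u j = (\<Sum>i<j. of_nat (j choose i) * ?y ^ i * u j)"
      by (simp add: power_add_one sum_distrib_right distrib_right
          flip: lessThan_Suc_atMost)
    also have "\<dots> = (\<Sum>i<j. ?y ^ i * (of_nat (j choose i) * u j))"
      by (simp add: mult_of_nat_commute[of _ "?y ^ _"] mult.assoc)
    also have "\<dots> = (\<Sum>i\<le>m. if i < j then ?y ^ i * (of_nat (j choose i) * u j) else 0)"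
      using that by (intro sum.mono_neutral_cong_left) auto
    finally show ?thesis .
  qed
  have "sub (shift r) ?p - ?p = (\<Sum>j\<le>Suc m. (?y + 1) ^ j * u j - ?y ^ j * u j)"
    by (simp only: free.eval_sum free.eval_mult power Suc.prems(1) sum_subtractf)
  also have "\<dots> = (\<Sum>j\<le>Suc m. \<Sum>i\<le>m. if i < j then ?y ^ i * (of_nat (j choose i) * u j) else 0)"
    by (rule sum.cong) (simp_all only: difference atMost_iff)
  also have "\<dots> = (\<Sum>i\<le>m. ?y ^ i * w i)"
    by (subst sum.swap) (simp only: w_def sum_distrib_left if_distrib[of "(*) (?y ^ _)"] mult_zero_right)
  finally have "(\<Sum>i\<le>m. ?y ^ i * w i) \<in> I"
    using T_ideal_diff[OF I T_ideal_sub[OF I admissible_shift[of kind r] Suc.prems(2)] Suc.prems(2)]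
    by (simp only:)
  moreover have "sub (shift r) (w i) = w i" for i
    unfolding w_def free.eval_sum
    by (intro sum.cong refl)
      (simp add: free.eval_zero free.eval_fscale Suc.prems(1) flip: fscale_of_nat)
  ultimately have "w m \<in> I"
    using Suc.IH[of w m] by simp
  moreover have "w m = (\<Sum>j\<in>{Suc m}. of_nat (j choose m) * u j)"
    unfolding w_def by (rule sum.mono_neutral_cong_right) auto
  ultimately have "fscale (of_nat (Suc m)) (u (Suc m)) \<in> I"
    by (simp only: fscale_of_nat) simp
  then have top: "u (Suc m) \<in> I"
    using T_ideal_fscale_iff[OF I, of "of_nat (Suc m)" "u (Suc m)"] of_nat_neq_0 by blast
  then have "(\<Sum>j\<le>m. ?y ^ j * u j) \<in> I"
    using T_ideal_diff[OF I Suc.prems(2) T_ideal_mult_left[OF I top, of "?y ^ Suc m"]] by simp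
  then show ?case
    using Suc.IH[of u j] Suc.prems top by (cases "j = Suc m") auto
qed

lemma ordered_0: "ordered n 0 d p \<Longrightarrow> proper n d p"
  by (induction "0 :: nat" d p rule: ordered.induct) (auto intro: proper.add)

text \<open>A unital T-ideal is generated by its proper elements. The set \<open>K\<close> is only a
  left ideal, and the degree bound is kept, so that the result serves both for generation and for
  identities of small degree.\<close>

theorem T_ideal_subset_of_proper:
  assumes I: "T_ideal kind I" and "p \<in> I" "total_degree p \<le> d"
    and zero: "0 \<in> K" and add: "\<And>p q. p \<in> K \<Longrightarrow> q \<in> K \<Longrightarrow> p + q \<in> K"
    and mult: "\<And>p r. p \<in> K \<Longrightarrow> r * p \<in> K"
    and proper: "\<And>n p. proper n d p \<Longrightarrow> p \<in> I \<Longrightarrow> p \<in> K"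
  shows "p \<in> K"
proof -
  obtain n where "\<And>w. w \<in> Poly_Mapping.keys p \<Longrightarrow> letter_index ` set (letters w) \<subseteq> {..<n}"
    using letters_bounded by metis
  then have "ordered n n d p"
    using ordered_of_bounded length_le_total_degree assms(3) by (metis le_trans)
  moreover have "p \<in> K" if "ordered n r d p" "p \<in> I" for r p
    using that
  proof (induction r arbitrary: p)
    case 0
    then show ?case using ordered_0 proper by blast
  next
    case (Suc r)
    obtain u m where u: "\<And>j. ordered n r d (u j)" "p = (\<Sum>j\<le>m. yv r ^ j * u j)"
      using ordered_Suc_expansion[OF Suc.prems(1)] by blast
    have "u j \<in> I" if "j \<le> m" for j
      by (rule shift_coefficients[OF I _ _ that])
        (use u(2) Suc.prems(2) sub_shift_ordered[OF u(1) order_refl] in auto)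
    then have terms: "yv r ^ j * u j \<in> K" if "j \<le> m" for j
      using that u(1) Suc.IH mult by blast
    have "(\<Sum>j\<in>S. yv r ^ j * u j) \<in> K" if "finite S" "S \<subseteq> {..m}" for S
      using that by (induction S rule: finite_induct) (auto simp: zero add terms)
    then show ?case unfolding u(2) by blast
  qed
  ultimately show ?thesis using assms(2) by blast
qed

section \<open>Proper polynomials of degree at most two\<close>

definition quadratic_atoms :: "nat \<Rightarrow> 'k::field_char_0 free_algebra set" where
  "quadratic_atoms n = {commutator (yv i) (yv j) |i j. i < n \<and> j < n}
    \<union> {commutator (zv i) (yv j) |i j. i < n \<and> j < n} \<union> {zv i * zv j |i j. i < n \<and> j < n}"

lemma quadratic_atomsI:
  assumes "i < n" "j < n"
  shows "commutator (yv i) (yv j) \<in> quadratic_atoms n" "commutator (zv i) (yv j) \<in> quadratic_atoms n"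
    "zv i * zv j \<in> quadratic_atoms n"
  using assms unfolding quadratic_atoms_def by fast+

definition atoms :: "nat \<Rightarrow> nat \<Rightarrow> 'k::field_char_0 free_algebra set" where
  "atoms n d = insert 1 ((if 1 \<le> d then zv ` {..<n} else {}) \<union> (if 2 \<le> d then quadratic_atoms n else {}))"

lemma atoms_two: "atoms n 2 = insert 1 (zv ` {..<n} \<union> quadratic_atoms n)"
  by (simp add: atoms_def)

lemma span_map:
  assumes p: "p \<in> free_span A"
    and add: "\<And>p q. T (p + q) = T p + T q" and scale: "\<And>c p. T (fscale c p) = fscale c (T p)"
    and A: "\<And>a. a \<in> A \<Longrightarrow> T a \<in> free_span C"
  shows "T p \<in> free_span C"
  using p
proof (rule free.span_induct)
  have "T 0 = 0"
    using scale[of 0 0] by simp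
  then show "free_subspace {p. T p \<in> free_span C}"
    by (auto simp: free.subspace_def add scale free.span_zero free.span_add free.span_scale)
qed (use A in auto)

lemma span_mult:
  assumes p: "p \<in> free_span A" and q: "q \<in> free_span B"
    and AB: "\<And>a b. a \<in> A \<Longrightarrow> b \<in> B \<Longrightarrow> a * b \<in> free_span C"
  shows "p * q \<in> free_span C"
proof -
  have "a * q \<in> free_span C" if "a \<in> A" for a
    by (rule span_map[OF q, where T = "(*) a"])
      (simp_all add: distrib_left AB that flip: free.scale_mult_right)
  then show ?thesis
    by (intro span_map[OF p, where T = "\<lambda>p. p * q"])
      (simp_all add: distrib_right flip: free.scale_mult_left)
qed

lemma span_commutator_yv:
  assumes p: "p \<in> free_span A"
    and A: "\<And>a. a \<in> A \<Longrightarrow> commutator a (yv i) \<in> free_span C"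
  shows "commutator p (yv i) \<in> free_span C"
  by (rule span_map[OF p, where T = "\<lambda>p. commutator p (yv i)"])
    (simp_all add: A free.commutator_scale, simp add: commutator_def algebra_simps)

lemma fscale_two: "fscale 2 p = p + p"
  using free.scale_left_distrib[of 1 1 p] by simp

lemma atomsI:
  "1 \<in> atoms n d" "i < n \<Longrightarrow> 1 \<le> d \<Longrightarrow> zv i \<in> atoms n d"
  "q \<in> quadratic_atoms n \<Longrightarrow> 2 \<le> d \<Longrightarrow> q \<in> atoms n d"
  by (simp_all add: atoms_def)

lemma atoms_cases:
  assumes "q \<in> atoms n d"
  obtains "q = 1" | i where "i < n" "1 \<le> d" "q = zv i" | "q \<in> quadratic_atoms n" "2 \<le> d"
  using assms unfolding atoms_def by (auto split: if_splits)

lemma atoms_mono: "q \<in> atoms n d \<Longrightarrow> d \<le> e \<Longrightarrow> q \<in> atoms n e"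
  by (auto elim!: atoms_cases intro: atomsI)

lemma proper_in_span_atoms: "proper n d p \<Longrightarrow> d \<le> 2 \<Longrightarrow> p \<in> free_span (atoms n d)"
proof (induction rule: proper.induct)
  case (const d c)
  show ?case by (intro free.span_scale free.span_base atomsI)
next
  case (zv i d)
  then show ?case by (intro free.span_base atomsI)
next
  case (yv_yv i j d)
  then show ?case by (intro free.span_base atomsI quadratic_atomsI)
next
  case (bracket d p i)
  have atom: "commutator a (yv i) \<in> free_span (atoms n (Suc d))" if "a \<in> atoms n d" for a
    using that
  proof (cases rule: atoms_cases)
    case 1
    then show ?thesis by (simp add: commutator_def free.span_zero)
  next
    case (2 j)
    then have "commutator a (yv i) \<in> quadratic_atoms n"
      using bracket.hyps by (simp add: quadratic_atomsI)
    then show ?thesis using 2 by (intro free.span_base atomsI) auto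
  next
    case 3
    then show ?thesis using bracket.prems by simp
  qed
  show ?case
    by (rule span_commutator_yv[OF bracket.IH atom]) (use bracket.prems in auto)
next
  case (add d p q)
  then show ?case by (simp add: free.span_add)
next
  case (mult d p e q)
  have atom: "a * b \<in> atoms n (d + e)" if ab: "a \<in> atoms n d" "b \<in> atoms n e" for a b
  proof (cases "a = 1 \<or> b = 1")
    case True
    then show ?thesis
      using atoms_mono[OF ab(1), of "d + e"] atoms_mono[OF ab(2), of "d + e"] by auto
  next
    case False
    then obtain i j where ij: "i < n" "1 \<le> d" "a = zv i" "j < n" "1 \<le> e" "b = zv j"
      using ab mult.prems by (elim atoms_cases) auto
    then show ?thesis by (simp add: atomsI quadratic_atomsI)
  qed
  show ?case
    by (rule span_mult[OF mult.IH]) (use mult.prems atom free.span_base in auto)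
qed

text \<open>The general element of the span of the atoms, with the two sorts of variables restricted to
  the index sets \<open>Q\<close> and \<open>P\<close>.\<close>

definition low_form :: "nat set \<Rightarrow> nat set \<Rightarrow> 'k \<Rightarrow> (nat \<Rightarrow> 'k) \<Rightarrow> (nat \<Rightarrow> nat \<Rightarrow> 'k) \<Rightarrow> (nat \<Rightarrow> nat \<Rightarrow> 'k)
    \<Rightarrow> (nat \<Rightarrow> nat \<Rightarrow> 'k) \<Rightarrow> 'k::field_char_0 free_algebra" where
  "low_form Q P c a b d e = fscale c 1 + (\<Sum>i\<in>P. fscale (a i) (zv i))
    + (\<Sum>i\<in>Q. \<Sum>j\<in>Q. fscale (b i j) (commutator (yv i) (yv j)))
    + (\<Sum>i\<in>P. \<Sum>j\<in>Q. fscale (d i j) (commutator (zv i) (yv j)))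
    + (\<Sum>i\<in>P. \<Sum>j\<in>P. fscale (e i j) (zv i * zv j))"

lemma low_form_add:
  "low_form Q P c a b d e + low_form Q P c' a' b' d' e'
    = low_form Q P (c + c') (\<lambda>i. a i + a' i) (\<lambda>i j. b i j + b' i j) (\<lambda>i j. d i j + d' i j) (\<lambda>i j. e i j + e' i j)"
  by (simp add: low_form_def free.scale_left_distrib sum.distrib)

lemma low_form_fscale:
  "fscale t (low_form Q P c a b d e)
    = low_form Q P (t * c) (\<lambda>i. t * a i) (\<lambda>i j. t * b i j) (\<lambda>i j. t * d i j) (\<lambda>i j. t * e i j)"
  by (simp add: low_form_def free.scale_right_distrib free.scale_sum_right)

lemma sum_fscale_delta:
  assumes "finite A" "i \<in> A"
  shows "(\<Sum>k\<in>A. fscale (if k = i then 1 else 0) (f k)) = f i"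
proof -
  have "(\<Sum>k\<in>A. fscale (if k = i then 1 else 0) (f k)) = (\<Sum>k\<in>A. if k = i then f k else 0)"
    by (rule sum.cong) auto
  then show ?thesis using assms by simp
qed

lemma sum_fscale_delta2:
  assumes "finite A" "i \<in> A" "finite B" "j \<in> B"
  shows "(\<Sum>k\<in>A. \<Sum>l\<in>B. fscale (if k = i \<and> l = j then 1 else 0) (f k l)) = f i j"
proof -
  have "(\<Sum>k\<in>A. \<Sum>l\<in>B. fscale (if k = i \<and> l = j then 1 else 0) (f k l))
      = (\<Sum>k\<in>A. if k = i then (\<Sum>l\<in>B. fscale (if l = j then 1 else 0) (f k l)) else 0)"
    by (rule sum.cong) auto
  then show ?thesis using assms by (simp add: sum_fscale_delta)
qed

lemma low_form_of_span:
  fixes p :: "'k::field_char_0 free_algebra"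
  assumes "p \<in> free_span (atoms n 2)"
  shows "\<exists>c a b d e. p = low_form {..<n} {..<n} c a b d e"
  using assms
proof (rule free.span_induct)
  let ?L = "low_form {..<n} {..<n} :: 'k \<Rightarrow> _"
  show "free_subspace {p. \<exists>c a b d e. p = ?L c a b d e}" (is "free_subspace ?S")
  proof (rule free.subspaceI)
    have "0 = ?L 0 (\<lambda>_. 0) (\<lambda>_ _. 0) (\<lambda>_ _. 0) (\<lambda>_ _. 0)"
      by (simp add: low_form_def)
    then show "0 \<in> ?S" by blast
  next
    fix p q :: "'k free_algebra"
    assume "p \<in> ?S" "q \<in> ?S"
    then show "p + q \<in> ?S" using low_form_add by blast
  next
    fix t and p :: "'k free_algebra"
    assume "p \<in> ?S"
    then show "fscale t p \<in> ?S" using low_form_fscale by blast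
  qed
  fix p :: "'k free_algebra"
  assume "p \<in> atoms n 2"
  then consider "p = 1" | i where "i < n" "p = zv i"
    | i j where "i < n" "j < n" "p = commutator (yv i) (yv j)"
    | i j where "i < n" "j < n" "p = commutator (zv i) (yv j)"
    | i j where "i < n" "j < n" "p = zv i * zv j"
    by (auto simp: atoms_def quadratic_atoms_def)
  then show "\<exists>c a b d e. p = ?L c a b d e"
  proof cases
    case 1
    then have "p = ?L 1 (\<lambda>_. 0) (\<lambda>_ _. 0) (\<lambda>_ _. 0) (\<lambda>_ _. 0)"
      by (simp add: low_form_def)
    then show ?thesis by blast
  next
    case (2 i)
    then have "p = ?L 0 (\<lambda>k. if k = i then 1 else 0) (\<lambda>_ _. 0) (\<lambda>_ _. 0) (\<lambda>_ _. 0)"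
      by (simp add: low_form_def sum_fscale_delta)
    then show ?thesis by blast
  next
    case (3 i j)
    then have "p = ?L 0 (\<lambda>_. 0) (\<lambda>k l. if k = i \<and> l = j then 1 else 0) (\<lambda>_ _. 0) (\<lambda>_ _. 0)"
      by (simp add: low_form_def sum_fscale_delta2)
    then show ?thesis by blast
  next
    case (4 i j)
    then have "p = ?L 0 (\<lambda>_. 0) (\<lambda>_ _. 0) (\<lambda>k l. if k = i \<and> l = j then 1 else 0) (\<lambda>_ _. 0)"
      by (simp add: low_form_def sum_fscale_delta2)
    then show ?thesis by blast
  next
    case (5 i j)
    then have "p = ?L 0 (\<lambda>_. 0) (\<lambda>_ _. 0) (\<lambda>_ _. 0) (\<lambda>k l. if k = i \<and> l = j then 1 else 0)"
      by (simp add: low_form_def sum_fscale_delta2)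
    then show ?thesis by blast
  qed
qed

lemma linear_form_of_span:
  fixes p :: "'k::field_char_0 free_algebra"
  assumes "p \<in> free_span (atoms n 1)"
  shows "\<exists>c a. p = low_form {..<n} {..<n} c a (\<lambda>_ _. 0) (\<lambda>_ _. 0) (\<lambda>_ _. 0)"
  using assms
proof (rule free.span_induct)
  let ?L = "\<lambda>c a. low_form {..<n} {..<n} c a (\<lambda>_ _. 0) (\<lambda>_ _. 0) (\<lambda>_ _. 0) :: 'k free_algebra"
  show "free_subspace {p. \<exists>c a. p = ?L c a}" (is "free_subspace ?S")
  proof (rule free.subspaceI)
    have "0 = ?L 0 (\<lambda>_. 0)"
      by (simp add: low_form_def)
    then show "0 \<in> ?S" by blast
  next
    fix p q :: "'k free_algebra"
    assume "p \<in> ?S" "q \<in> ?S"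
    then show "p + q \<in> ?S" by (force simp: low_form_add)
  next
    fix t and p :: "'k free_algebra"
    assume "p \<in> ?S"
    then show "fscale t p \<in> ?S" by (force simp: low_form_fscale)
  qed
  fix p :: "'k free_algebra"
  assume "p \<in> atoms n 1"
  then consider "p = 1" | i where "i < n" "p = zv i"
    by (auto simp: atoms_def)
  then show "\<exists>c a. p = ?L c a"
  proof cases
    case 1
    then have "p = ?L 1 (\<lambda>_. 0)"
      by (simp add: low_form_def)
    then show ?thesis by blast
  next
    case (2 i)
    then have "p = ?L 0 (\<lambda>k. if k = i then 1 else 0)"
      by (simp add: low_form_def sum_fscale_delta)
    then show ?thesis by blast
  qed
qed

definition keep :: "nat set \<Rightarrow> nat set \<Rightarrow> letter \<Rightarrow> 'k::field_char_0 free_algebra" where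
  "keep Q P l = (case l of Y i \<Rightarrow> if i \<in> Q then yv i else 0 | Z i \<Rightarrow> if i \<in> P then zv i else 0)"

lemma free_phi_zero: "free_phi kind 0 = 0"
  by (rule free.phi_zero)

lemma admissible_keep: "admissible_valuation (free_phi kind) (keep Q P)"
  by (simp add: admissible_valuation_def keep_def free_phi_yv free_phi_zv free_phi_zero)

lemma commutator_zero: "commutator 0 a = 0" "commutator a 0 = 0"
  by (simp_all add: commutator_def)

lemma sub_keep_low_form:
  assumes "finite Q" "finite P" "Q' \<subseteq> Q" "P' \<subseteq> P"
  shows "sub (keep Q' P') (low_form Q P c a b d e) = low_form Q' P' c a b d e"
proof -
  let ?y = "\<lambda>i. if i \<in> Q' then yv i else (0 :: 'a free_algebra)"
  let ?z = "\<lambda>i. if i \<in> P' then zv i else (0 :: 'a free_algebra)"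
  have restrict: "(\<Sum>i\<in>A. f i) = (\<Sum>i\<in>A'. f i)"
    if "finite A" "A' \<subseteq> A" "\<And>i. i \<in> A - A' \<Longrightarrow> f i = 0" for A A' and f :: "nat \<Rightarrow> 'a free_algebra"
    using that by (intro sum.mono_neutral_right) auto
  have inner: "(\<Sum>j\<in>Q. fscale (b i j) (commutator (?y i) (?y j)))
        = (\<Sum>j\<in>Q'. fscale (b i j) (commutator (?y i) (?y j)))"
      "(\<Sum>j\<in>Q. fscale (d i j) (commutator (?z i) (?y j)))
        = (\<Sum>j\<in>Q'. fscale (d i j) (commutator (?z i) (?y j)))"
      "(\<Sum>j\<in>P. fscale (e i j) (?z i * ?z j)) = (\<Sum>j\<in>P'. fscale (e i j) (?z i * ?z j))" for i
    by (rule restrict; use assms in \<open>auto simp: commutator_zero\<close>)+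
  have outer: "(\<Sum>i\<in>P. fscale (a i) (?z i)) = (\<Sum>i\<in>P'. fscale (a i) (?z i))"
      "(\<Sum>i\<in>Q. \<Sum>j\<in>Q'. fscale (b i j) (commutator (?y i) (?y j)))
        = (\<Sum>i\<in>Q'. \<Sum>j\<in>Q'. fscale (b i j) (commutator (?y i) (?y j)))"
      "(\<Sum>i\<in>P. \<Sum>j\<in>Q'. fscale (d i j) (commutator (?z i) (?y j)))
        = (\<Sum>i\<in>P'. \<Sum>j\<in>Q'. fscale (d i j) (commutator (?z i) (?y j)))"
      "(\<Sum>i\<in>P. \<Sum>j\<in>P'. fscale (e i j) (?z i * ?z j))
        = (\<Sum>i\<in>P'. \<Sum>j\<in>P'. fscale (e i j) (?z i * ?z j))"
    by (rule restrict; use assms in \<open>auto simp: commutator_zero\<close>)+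
  have "sub (keep Q' P') (low_form Q P c a b d e) = fscale c 1 + (\<Sum>i\<in>P. fscale (a i) (?z i))
    + (\<Sum>i\<in>Q. \<Sum>j\<in>Q. fscale (b i j) (commutator (?y i) (?y j)))
    + (\<Sum>i\<in>P. \<Sum>j\<in>Q. fscale (d i j) (commutator (?z i) (?y j)))
    + (\<Sum>i\<in>P. \<Sum>j\<in>P. fscale (e i j) (?z i * ?z j))"
    by (simp add: low_form_def free.eval_simps keep_def)
  also have "\<dots> = low_form Q' P' c a b d e"
    unfolding inner outer low_form_def by simp
  finally show ?thesis .
qed

definition rename :: "(nat \<Rightarrow> nat) \<Rightarrow> (nat \<Rightarrow> nat) \<Rightarrow> letter \<Rightarrow> 'k::field_char_0 free_algebra" where
  "rename f g l = (case l of Y i \<Rightarrow> yv (f i) | Z i \<Rightarrow> zv (g i))"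

lemma admissible_rename: "admissible_valuation (free_phi kind) (rename f g)"
  by (simp add: admissible_valuation_def rename_def free_phi_yv free_phi_zv)

lemma T_ideal_rename: "T_ideal kind I \<Longrightarrow> p \<in> I \<Longrightarrow> sub (rename f g) p \<in> I"
  by (rule T_ideal_sub[OF _ admissible_rename])

lemmas sub_rename = free.eval_simps rename_def

text \<open>Keeping at most two variables isolates each coefficient. The linear and the square term
  in one \<open>z\<close> are told apart by the sign change \<open>z \<mapsto> - z\<close>, the
  products \<open>z\<^sub>i z\<^sub>j\<close> and \<open>z\<^sub>j z\<^sub>i\<close> by exchanging
  the variables. For commutators of \<open>y\<close>'s only the difference of the two coefficients
  is determined.\<close>

lemma low_form_components:
  assumes I: "T_ideal kind I" "1 \<notin> I" and "finite Q" "finite P" and p: "low_form Q P c a b d e \<in> I"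
  shows "c = 0"
    and "i \<in> P \<Longrightarrow> fscale (a i) (zv i) \<in> I"
    and "i \<in> Q \<Longrightarrow> j \<in> Q \<Longrightarrow> fscale (b i j - b j i) (commutator (yv i) (yv j)) \<in> I"
    and "i \<in> P \<Longrightarrow> j \<in> Q \<Longrightarrow> fscale (d i j) (commutator (zv i) (yv j)) \<in> I"
    and "i \<in> P \<Longrightarrow> j \<in> P \<Longrightarrow> fscale (e i j + e j i) (zv i \<odot> zv j) \<in> I"
    and "i \<in> P \<Longrightarrow> j \<in> P \<Longrightarrow> fscale (e i j - e j i) (commutator (zv i) (zv j)) \<in> I"
proof -
  note closed = T_ideal_add[OF I(1)] T_ideal_diff[OF I(1)] T_ideal_fscale[OF I(1)] T_ideal_zero[OF I(1)]
  have restrict: "low_form Q' P' c a b d e \<in> I" if "Q' \<subseteq> Q" "P' \<subseteq> P" for Q' P'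
    using T_ideal_sub[OF I(1) admissible_keep[of kind Q' P'] p] that assms(3,4)
    by (simp add: sub_keep_low_form)
  show c: "c = 0"
    using restrict[of "{}" "{}"] T_ideal_fscale_iff[OF I(1), of c 1] I(2)
    by (auto simp: low_form_def)
  have z: "fscale (a i) (zv i) + fscale (e i i) (zv i * zv i) \<in> I" if "i \<in> P" for i
    using restrict[of "{}" "{i}"] that by (simp add: low_form_def c)
  have negate: "admissible_valuation (free_phi kind) (\<lambda>l. case l of Y i \<Rightarrow> yv i | Z i \<Rightarrow> - zv i)"
    by (simp add: admissible_valuation_def free_phi_yv free_phi_zv free_phi_uminus)
  show az: "fscale (a i) (zv i) \<in> I" if "i \<in> P" for i
  proof -
    have "- fscale (a i) (zv i) + fscale (e i i) (zv i * zv i) \<in> I"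
      using T_ideal_sub[OF I(1) negate z[OF that]] by (simp add: free.eval_simps)
    from closed(2)[OF z[OF that] this] have "fscale 2 (fscale (a i) (zv i)) \<in> I"
      by (simp add: fscale_two del: free.scale_scale)
    then show ?thesis using T_ideal_fscale_iff[OF I(1), of 2] zero_neq_numeral by metis
  qed
  have ezz: "fscale (e i i) (zv i * zv i) \<in> I" if "i \<in> P" for i
    using closed(2)[OF z[OF that] az[OF that]] by simp
  show "fscale (b i j - b j i) (commutator (yv i) (yv j)) \<in> I" if "i \<in> Q" "j \<in> Q" for i j
  proof (cases "i = j")
    case False
    have flip: "commutator (yv j) (yv i) = - commutator (yv i) (yv j :: 'a free_algebra)"
      by (simp add: commutator_def)
    have "commutator (yv k) (yv k) = (0 :: 'a free_algebra)" for k
      by (simp add: commutator_def)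
    then show ?thesis
      using restrict[of "{i, j}" "{}"] that False
      by (simp add: low_form_def c flip free.scale_left_diff_distrib)
  qed (simp add: closed)
  show "fscale (d i j) (commutator (zv i) (yv j)) \<in> I" if "i \<in> P" "j \<in> Q" for i j
  proof -
    have "commutator (yv j) (yv j) = (0 :: 'a free_algebra)"
      by (simp add: commutator_def)
    then have "fscale (a i) (zv i) + fscale (d i j) (commutator (zv i) (yv j)) + fscale (e i i) (zv i * zv i) \<in> I"
      using restrict[of "{j}" "{i}"] that by (simp add: low_form_def c)
    from closed(2)[OF closed(2)[OF this ezz[of i]] az[of i]] that show ?thesis by simp
  qed
  have zz: "fscale (e i j) (zv i * zv j) + fscale (e j i) (zv j * zv i) \<in> I" if "i \<in> P" "j \<in> P" for i j
  proof (cases "i = j")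
    case True
    then show ?thesis using closed(1)[OF ezz ezz] that by simp
  next
    case False
    let ?s = "fscale (e i j) (zv i * zv j) + fscale (e j i) (zv j * zv i)"
    have "fscale (a i) (zv i) + fscale (a j) (zv j) + (fscale (e i i) (zv i * zv i) + ?s + fscale (e j j) (zv j * zv j)) \<in> I"
      using restrict[of "{}" "{i, j}"] that False by (simp add: low_form_def c algebra_simps)
    from closed(2)[OF closed(2)[OF closed(2)[OF closed(2)[OF this az[of i]] az[of j]] ezz[of i]] ezz[of j]] that
    show ?thesis by (simp add: algebra_simps)
  qed
  have swapped: "fscale (e i j) (zv j * zv i) + fscale (e j i) (zv i * zv j) \<in> I" if "i \<in> P" "j \<in> P" for i j
    using T_ideal_rename[OF I(1) zz[OF that], of "\<lambda>i. i" "\<lambda>k. if k = i then j else if k = j then i else k"]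
    by (simp add: sub_rename split: if_splits)
  show "fscale (e i j + e j i) (zv i \<odot> zv j) \<in> I" if "i \<in> P" "j \<in> P" for i j
    using closed(1)[OF zz[OF that] swapped[OF that]]
    by (simp add: jordan_def free.scale_left_distrib free.scale_right_distrib algebra_simps)
  show "fscale (e i j - e j i) (commutator (zv i) (zv j)) \<in> I" if "i \<in> P" "j \<in> P" for i j
    using closed(2)[OF zz[OF that] swapped[OF that]]
    by (simp add: commutator_def free.scale_left_diff_distrib free.scale_right_diff_distrib algebra_simps)
qed

text \<open>This writes a form, up to the factor 4, in terms of the components of
  \<open>low_form_components\<close>.\<close>

lemma low_form_symmetrized:
  "fscale 4 (low_form Q P c a b d e) = fscale (4 * c) 1 + (\<Sum>i\<in>P. fscale 4 (fscale (a i) (zv i)))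
    + (\<Sum>i\<in>Q. \<Sum>j\<in>Q. fscale 2 (fscale (b i j - b j i) (commutator (yv i) (yv j))))
    + (\<Sum>i\<in>P. \<Sum>j\<in>Q. fscale 4 (fscale (d i j) (commutator (zv i) (yv j))))
    + (\<Sum>i\<in>P. \<Sum>j\<in>P. fscale (e i j + e j i) (zv i \<odot> zv j) + fscale (e i j - e j i) (commutator (zv i) (zv j)))"
proof -
  have antisymmetric: "(\<Sum>i\<in>Q. \<Sum>j\<in>Q. fscale (2 * b j i) (commutator (yv i) (yv j)))
      = - (\<Sum>i\<in>Q. \<Sum>j\<in>Q. fscale (2 * b i j) (commutator (yv i) (yv j)))"
  proof -
    have "(\<Sum>i\<in>Q. \<Sum>j\<in>Q. fscale (2 * b j i) (commutator (yv i) (yv j)))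
        = (\<Sum>i\<in>Q. \<Sum>j\<in>Q. fscale (2 * b i j) (commutator (yv j) (yv i)))"
      by (rule sum.swap)
    also have "\<dots> = (\<Sum>i\<in>Q. \<Sum>j\<in>Q. - fscale (2 * b i j) (commutator (yv i) (yv j)))"
      by (intro sum.cong refl) (simp add: commutator_def free.scale_right_diff_distrib)
    finally show ?thesis by (simp add: sum_negf)
  qed
  have yy: "(\<Sum>i\<in>Q. \<Sum>j\<in>Q. fscale 2 (fscale (b i j - b j i) (commutator (yv i) (yv j))))
      = (\<Sum>i\<in>Q. \<Sum>j\<in>Q. fscale (4 * b i j) (commutator (yv i) (yv j)))"
  proof -
    have "(\<Sum>i\<in>Q. \<Sum>j\<in>Q. fscale 2 (fscale (b i j - b j i) (commutator (yv i) (yv j))))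
        = (\<Sum>i\<in>Q. \<Sum>j\<in>Q. fscale (2 * b i j) (commutator (yv i) (yv j)))
          - (\<Sum>i\<in>Q. \<Sum>j\<in>Q. fscale (2 * b j i) (commutator (yv i) (yv j)))"
      by (simp only: free.scale_left_diff_distrib free.scale_right_diff_distrib free.scale_scale sum_subtractf)
    also have "\<dots> = (\<Sum>i\<in>Q. \<Sum>j\<in>Q. fscale (2 * b i j) (commutator (yv i) (yv j)))
          + (\<Sum>i\<in>Q. \<Sum>j\<in>Q. fscale (2 * b i j) (commutator (yv i) (yv j)))"
      by (simp add: antisymmetric)
    also have "\<dots> = (\<Sum>i\<in>Q. \<Sum>j\<in>Q. fscale (2 * b i j + 2 * b i j) (commutator (yv i) (yv j)))"
      by (simp only: free.scale_left_distrib sum.distrib)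
    finally show ?thesis by simp
  qed
  have "(\<Sum>i\<in>P. \<Sum>j\<in>P. fscale (e i j + e j i) (zv i \<odot> zv j) + fscale (e i j - e j i) (commutator (zv i) (zv j)))
      = (\<Sum>i\<in>P. \<Sum>j\<in>P. fscale (2 * e i j) (zv i * zv j)) + (\<Sum>i\<in>P. \<Sum>j\<in>P. fscale (2 * e j i) (zv j * zv i))"
    unfolding sum.distrib[symmetric]
  proof (intro sum.cong refl)
    fix i j
    have "fscale (s + t) (zv i \<odot> zv j) + fscale (s - t) (commutator (zv i) (zv j))
        = fscale (s + s) (zv i * zv j) + fscale (t + t) (zv j * zv i)" for s t :: 'a
      by (simp only: jordan_def commutator_def free.scale_left_distrib free.scale_right_distrib
          free.scale_left_diff_distrib free.scale_right_diff_distrib) simp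
    then show "fscale (e i j + e j i) (zv i \<odot> zv j) + fscale (e i j - e j i) (commutator (zv i) (zv j))
        = fscale (2 * e i j) (zv i * zv j) + fscale (2 * e j i) (zv j * zv i)"
      by (simp only: mult_2)
  qed
  also have "(\<Sum>i\<in>P. \<Sum>j\<in>P. fscale (2 * e j i) (zv j * zv i)) = (\<Sum>i\<in>P. \<Sum>j\<in>P. fscale (2 * e i j) (zv i * zv j))"
    by (rule sum.swap)
  finally have "(\<Sum>i\<in>P. \<Sum>j\<in>P. fscale (e i j + e j i) (zv i \<odot> zv j) + fscale (e i j - e j i) (commutator (zv i) (zv j)))
      = (\<Sum>i\<in>P. \<Sum>j\<in>P. fscale (2 * e i j + 2 * e i j) (zv i * zv j))"
    by (simp only: free.scale_left_distrib sum.distrib)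
  with yy show ?thesis
    by (simp add: low_form_fscale) (simp add: low_form_def)
qed

text \<open>By \<open>low_form_components\<close> these five polynomials decide whether the forms of
  degree at most two in \<open>I\<close> lie in \<open>K\<close>; see
  \<open>low_form_transfer\<close>.\<close>

definition atoms_transfer :: "'k::field_char_0 free_algebra set \<Rightarrow> 'k free_algebra set \<Rightarrow> bool" where
  "atoms_transfer I K \<longleftrightarrow> (\<forall>p\<in>{zv 1, lie [yv 2, yv 1], lie [zv 2, yv 1], zv 1 \<odot> zv 2, lie [zv 2, zv 1]}.
      p \<in> I \<longrightarrow> p \<in> K)"

lemma zv_in_T_ideal_iff: "T_ideal kind I \<Longrightarrow> zv i \<in> I \<longleftrightarrow> zv 1 \<in> I"
  using T_ideal_rename[of kind I "zv i" id "\<lambda>_. 1"] T_ideal_rename[of kind I "zv 1" id "\<lambda>_. i"]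
  by (auto simp: sub_rename)

lemma commutator_yv_yv_in_T_ideal_iff:
  assumes "T_ideal kind I" "i \<noteq> j"
  shows "commutator (yv i) (yv j) \<in> I \<longleftrightarrow> lie [yv 2, yv 1] \<in> I"
  using T_ideal_rename[OF assms(1), of "commutator (yv i) (yv j)" "\<lambda>k. if k = i then 2 else 1" id]
    T_ideal_rename[OF assms(1), of "lie [yv 2, yv 1]" "\<lambda>k. if k = 2 then i else j" id] assms(2)
  by (auto simp: sub_rename)

lemma commutator_zv_zv_in_T_ideal_iff:
  assumes "T_ideal kind I" "i \<noteq> j"
  shows "commutator (zv i) (zv j) \<in> I \<longleftrightarrow> lie [zv 2, zv 1] \<in> I"
  using T_ideal_rename[OF assms(1), of "commutator (zv i) (zv j)" id "\<lambda>k. if k = i then 2 else 1"]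
    T_ideal_rename[OF assms(1), of "lie [zv 2, zv 1]" id "\<lambda>k. if k = 2 then i else j"] assms(2)
  by (auto simp: sub_rename)

lemma commutator_zv_yv_in_T_ideal_iff:
  assumes "T_ideal kind I"
  shows "commutator (zv i) (yv j) \<in> I \<longleftrightarrow> lie [zv 2, yv 1] \<in> I"
  using T_ideal_rename[OF assms(1), of "commutator (zv i) (yv j)" "\<lambda>_. 1" "\<lambda>_. 2"]
    T_ideal_rename[OF assms(1), of "lie [zv 2, yv 1]" "\<lambda>_. j" "\<lambda>_. i"]
  by (auto simp: sub_rename)

text \<open>The case \<open>i = j\<close> is included: \<open>z\<^sup>2\<close> and \<open>z\<^sub>1
  \<odot> z\<^sub>2\<close> are equivalent by linearization.\<close>

lemma jordan_zv_zv_in_T_ideal_iff: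
  assumes I: "T_ideal kind I"
  shows "zv i \<odot> zv j \<in> I \<longleftrightarrow> zv 1 \<odot> zv 2 \<in> I"
proof
  assume "zv 1 \<odot> zv 2 \<in> I"
  from T_ideal_rename[OF I this, of id "\<lambda>k. if k = 1 then i else j"] show "zv i \<odot> zv j \<in> I"
    by (simp add: sub_rename)
next
  assume ij: "zv i \<odot> zv j \<in> I"
  show "zv 1 \<odot> zv 2 \<in> I"
  proof (cases "i = j")
    case False
    then show ?thesis
      using T_ideal_rename[OF I ij, of id "\<lambda>k. if k = i then 1 else 2"] by (simp add: sub_rename)
  next
    case True
    have square: "zv k \<odot> zv k \<in> I" for k
      using T_ideal_rename[OF I ij, of id "\<lambda>_. k"] by (simp add: sub_rename True)
    have "admissible_valuation (free_phi kind) (\<lambda>l. case l of Y i \<Rightarrow> yv i | Z i \<Rightarrow> zv 1 + zv 2)"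
      by (simp add: admissible_valuation_def free_phi_yv free_phi_zv free_phi_add)
    from T_ideal_sub[OF I this ij] have "(zv 1 + zv 2) \<odot> (zv 1 + zv 2) \<in> I"
      by (simp add: free.eval_simps)
    then have "(zv 1 + zv 2) \<odot> (zv 1 + zv 2) - zv 1 \<odot> zv 1 - zv 2 \<odot> zv 2 \<in> I"
      using square by (blast intro: T_ideal_diff[OF I])
    also have "(zv 1 + zv 2) \<odot> (zv 1 + zv 2) - zv 1 \<odot> zv 1 - zv 2 \<odot> zv 2 = fscale 2 (zv 1 \<odot> (zv 2 :: 'a free_algebra))"
      by (simp add: jordan_def algebra_simps fscale_two)
    finally show ?thesis
      using T_ideal_fscale_iff[OF I, of 2] by simp
  qed
qed

lemma low_form_transfer:
  assumes I: "T_ideal kind I" "1 \<notin> I" and K: "T_ideal kind K" and "atoms_transfer I K"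
    and fin: "finite Q" "finite P" and p: "low_form Q P c a b d e \<in> I"
  shows "low_form Q P c a b d e \<in> K"
proof -
  note components = low_form_components[OF I fin p]
  have transfer: "fscale t q \<in> K" if "fscale t q \<in> I" "q \<in> I \<Longrightarrow> q \<in> K" for t q
    using that T_ideal_fscale_iff[OF I(1), of t q] T_ideal_fscale[OF K, of q t] T_ideal_zero[OF K]
    by (cases "t = 0") auto
  have atom: "zv i \<in> I \<Longrightarrow> zv i \<in> K" "i \<noteq> j \<Longrightarrow> commutator (yv i) (yv j) \<in> I \<Longrightarrow> commutator (yv i) (yv j) \<in> K"
    "commutator (zv i) (yv j) \<in> I \<Longrightarrow> commutator (zv i) (yv j) \<in> K"
    "zv i \<odot> zv j \<in> I \<Longrightarrow> zv i \<odot> zv j \<in> K"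
    "i \<noteq> j \<Longrightarrow> commutator (zv i) (zv j) \<in> I \<Longrightarrow> commutator (zv i) (zv j) \<in> K" for i j
    using assms(4) I(1) K
    by (simp_all add: atoms_transfer_def zv_in_T_ideal_iff[of kind _ i] commutator_yv_yv_in_T_ideal_iff
        commutator_zv_yv_in_T_ideal_iff[of kind _ i j] jordan_zv_zv_in_T_ideal_iff[of kind _ i j]
        commutator_zv_zv_in_T_ideal_iff del: lie.simps)
  have same: "commutator q q = 0" for q :: "'a free_algebra"
    by (simp add: commutator_def)
  have "fscale (b i j - b j i) (commutator (yv i) (yv j)) \<in> K" if "i \<in> Q" "j \<in> Q" for i j
    using transfer[OF components(3)[OF that] atom(2)] T_ideal_zero[OF K]
    by (cases "i = j") (simp_all add: same)
  moreover have "fscale (e i j - e j i) (commutator (zv i) (zv j)) \<in> K" if "i \<in> P" "j \<in> P" for i j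
    using transfer[OF components(6)[OF that] atom(5)] T_ideal_zero[OF K]
    by (cases "i = j") (simp_all add: same)
  moreover note transfer[OF components(2) atom(1)] transfer[OF components(4) atom(3)]
    transfer[OF components(5) atom(4)]
  ultimately have "fscale 4 (low_form Q P c a b d e) \<in> K"
    unfolding low_form_symmetrized components(1)
    by (intro T_ideal_add[OF K] T_ideal_sum[OF K])
      (simp_all add: T_ideal_fscale[OF K] T_ideal_zero[OF K] del: free.scale_scale)
  then show ?thesis using T_ideal_fscale_iff[OF K, of 4] by simp
qed

section \<open>T-ideals in which the proper polynomials of degree three vanish\<close>

text \<open>Modulo these seven elements every proper polynomial reduces to degree at most two
  (\<open>proper_in_span_atoms_mod\<close>). The first six are the summands of
  \<open>f_\<Gamma>3\<close>.\<close>

locale cubic_T_ideal =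
  fixes kind :: phi_kind and J :: "'k::field_char_0 free_algebra set"
  assumes T_ideal: "T_ideal kind J"
    and gens: "lie [yv 3, yv 2, yv 1] \<in> J" "lie [yv 3, zv 2, yv 1] \<in> J" "zv 3 * lie [yv 2, yv 1] \<in> J"
      "lie [yv 3, zv 2, zv 1] \<in> J" "zv 3 * lie [zv 2, yv 1] \<in> J" "zv 1 * zv 2 * zv 3 \<in> J"
      "lie [yv 2, yv 1] * lie [yv 4, yv 3] \<in> J"
begin

lemmas closed = T_ideal_add[OF T_ideal] T_ideal_diff[OF T_ideal] T_ideal_uminus[OF T_ideal]
  T_ideal_mult_left[OF T_ideal] T_ideal_mult_right[OF T_ideal] T_ideal_zero[OF T_ideal]

lemma letter_instances:
  "commutator (commutator (yv i) (yv j)) (yv k) \<in> J"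
  "commutator (commutator (yv i) (zv j)) (yv k) \<in> J"
  "zv i * commutator (yv j) (yv k) \<in> J"
  "commutator (commutator (yv i) (zv j)) (zv k) \<in> J"
  "zv i * commutator (zv j) (yv k) \<in> J"
  "zv i * (zv j * zv k) \<in> J"
  "commutator (yv i) (yv j) * commutator (yv k) (yv l) \<in> J"
proof -
  define f where "f = (\<lambda>m :: nat. if m = 3 then i else if m = 2 then j else k)"
  define g where "g = (\<lambda>m :: nat. if m = 1 then i else if m = 2 then j else k)"
  define h where "h = (\<lambda>m :: nat. if m = 2 then i else if m = 1 then j else if m = 4 then k else l)"
  note rename = T_ideal_rename[OF T_ideal]
  show "commutator (commutator (yv i) (yv j)) (yv k) \<in> J"
    using rename[OF gens(1), of f f] by (simp add: sub_rename f_def)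
  show "commutator (commutator (yv i) (zv j)) (yv k) \<in> J"
    using rename[OF gens(2), of f f] by (simp add: sub_rename f_def)
  show "zv i * commutator (yv j) (yv k) \<in> J"
    using rename[OF gens(3), of f f] by (simp add: sub_rename f_def)
  show "commutator (commutator (yv i) (zv j)) (zv k) \<in> J"
    using rename[OF gens(4), of f f] by (simp add: sub_rename f_def)
  show "zv i * commutator (zv j) (yv k) \<in> J"
    using rename[OF gens(5), of f f] by (simp add: sub_rename f_def)
  show "zv i * (zv j * zv k) \<in> J"
    using rename[OF gens(6), of g g] by (simp add: sub_rename g_def mult.assoc)
  show "commutator (yv i) (yv j) * commutator (yv k) (yv l) \<in> J"
    using rename[OF gens(7), of h h] by (simp add: sub_rename h_def)
qed

lemma zv_mult_quadratic: "q \<in> quadratic_atoms n \<Longrightarrow> zv i * q \<in> J"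
  using letter_instances by (auto simp: quadratic_atoms_def)

text \<open>By \<open>zv_mult_quadratic\<close> it suffices that \<open>[q, z\<^sub>i] \<in>
  J\<close>; for \<open>q = [y\<^sub>j,y\<^sub>k]\<close> this is the Jacobi identity.\<close>

lemma quadratic_mult_zv:
  assumes "q \<in> quadratic_atoms n"
  shows "q * zv i \<in> J"
proof -
  consider j k where "q = commutator (yv j) (yv k)" | j k where "q = commutator (zv j) (yv k)"
    | j k where "q = zv j * zv k"
    using assms by (auto simp: quadratic_atoms_def)
  then have "commutator q (zv i) \<in> J"
  proof cases
    case (1 j k)
    have "commutator q (zv i) = commutator (commutator (yv j) (zv i)) (yv k) - commutator (commutator (yv k) (zv i)) (yv j)"
      by (simp add: 1 commutator_def algebra_simps)
    then show ?thesis using letter_instances by (simp add: closed)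
  next
    case (2 j k)
    have "commutator q (zv i) = - commutator (commutator (yv k) (zv j)) (zv i)"
      by (simp add: 2 commutator_def algebra_simps)
    then show ?thesis using letter_instances by (simp add: closed)
  next
    case (3 j k)
    then show ?thesis using letter_instances by (simp add: closed commutator_def mult.assoc)
  qed
  then have "zv i * q + commutator q (zv i) \<in> J"
    using zv_mult_quadratic[OF assms] by (intro closed(1))
  then show ?thesis by (simp add: commutator_def)
qed

lemma commutator_quadratic_yv:
  assumes "q \<in> quadratic_atoms n"
  shows "commutator q (yv i) \<in> J"
proof -
  consider j k where "q = commutator (yv j) (yv k)" | j k where "q = commutator (zv j) (yv k)"
    | j k where "j < n" "k < n" "q = zv j * zv k"
    using assms by (auto simp: quadratic_atoms_def)
  then show ?thesis
  proof cases
    case 1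
    then show ?thesis using letter_instances by simp
  next
    case (2 j k)
    have "commutator q (yv i) = - commutator (commutator (yv k) (zv j)) (yv i)"
      by (simp add: 2 commutator_def algebra_simps)
    then show ?thesis using letter_instances by (simp add: closed)
  next
    case (3 j k)
    have "commutator (zv j) (yv i) \<in> quadratic_atoms (max n (Suc i))"
      using \<open>j < n\<close> by (auto simp: quadratic_atoms_def intro: less_max_iff_disj[THEN iffD2])
    from closed(1)[OF letter_instances(5) quadratic_mult_zv[OF this]]
    have "zv j * commutator (zv k) (yv i) + commutator (zv j) (yv i) * zv k \<in> J" .
    moreover have "commutator q (yv i) = zv j * commutator (zv k) (yv i) + commutator (zv j) (yv i) * zv k"
      by (simp add: 3 commutator_def algebra_simps)
    ultimately show ?thesis by simp
  qed
qed

text \<open>A factor \<open>[z,y]\<close> is expanded, and its \<open>z\<close> is brought next to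
  the other factor, which is central modulo \<open>J\<close> with respect to the
  \<open>y\<close>'s.\<close>

lemma quadratic_mult_quadratic:
  assumes "p \<in> quadratic_atoms n" "q \<in> quadratic_atoms n"
  shows "p * q \<in> J"
proof -
  consider i j where "p = commutator (yv i) (yv j)" | i j where "p = commutator (zv i) (yv j)"
    | i j where "p = zv i * zv j"
    using assms(1) by (auto simp: quadratic_atoms_def)
  then show ?thesis
  proof cases
    case (1 i j)
    consider k l where "q = commutator (yv k) (yv l)" | k l where "q = commutator (zv k) (yv l)"
      | k l where "q = zv k * zv l"
      using assms(2) by (auto simp: quadratic_atoms_def)
    then show ?thesis
    proof cases
      case (1 k l)
      then show ?thesis using \<open>p = _\<close> letter_instances by simp
    next
      case (2 k l)
      have "(p * zv k) * yv l - yv l * (p * zv k) - commutator p (yv l) * zv k \<in> J"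
        by (intro closed(2) closed(5)[of "p * zv k"] closed(4)[of "p * zv k"] closed(5)[of "commutator p (yv l)"]
            quadratic_mult_zv[OF assms(1)] commutator_quadratic_yv[OF assms(1)])
      moreover have "p * q = (p * zv k) * yv l - yv l * (p * zv k) - commutator p (yv l) * zv k"
        by (simp add: 2 commutator_def algebra_simps)
      ultimately show ?thesis by simp
    next
      case (3 k l)
      have "p * zv k * zv l \<in> J"
        by (intro closed(5)[of "p * zv k"] quadratic_mult_zv[OF assms(1)])
      then show ?thesis by (simp add: 3 mult.assoc)
    qed
  next
    case (2 i j)
    have "(zv i * q) * yv j - zv i * commutator q (yv j) - yv j * (zv i * q) \<in> J"
      by (intro closed(2) closed(5)[of "zv i * q"] closed(4)[of "zv i * q"] closed(4)[of "commutator q (yv j)"]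
          zv_mult_quadratic[OF assms(2)] commutator_quadratic_yv[OF assms(2)])
    moreover have "p * q = (zv i * q) * yv j - zv i * commutator q (yv j) - yv j * (zv i * q)"
      by (simp add: 2 commutator_def algebra_simps)
    ultimately show ?thesis by simp
  next
    case (3 i j)
    have "zv i * (zv j * q) \<in> J"
      by (intro closed(4)[of "zv j * q"] zv_mult_quadratic[OF assms(2)])
    then show ?thesis by (simp add: 3 mult.assoc)
  qed
qed

lemma proper_in_span_atoms_mod:
  "proper n d p \<Longrightarrow> p \<in> free_span (atoms n 2 \<union> J)"
proof (induction rule: proper.induct)
  case (const d c)
  show ?case by (rule free.span_scale, rule free.span_base) (simp add: atoms_def)
next
  case (zv i d)
  then show ?case by (intro free.span_base UnI1) (simp add: atoms_two)
next
  case (yv_yv i j d)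
  then show ?case by (intro free.span_base UnI1) (simp add: atoms_two quadratic_atomsI)
next
  case (bracket d p i)
  have "commutator a (yv i) \<in> free_span (atoms n 2 \<union> J)" if a: "a \<in> atoms n 2 \<union> J" for a
  proof -
    consider "a = 1" | j where "j < n" "a = zv j" | "a \<in> quadratic_atoms n" | "a \<in> J"
      using a by (auto simp: atoms_def)
    then show ?thesis
    proof cases
      case 1
      then show ?thesis by (simp add: commutator_def free.span_zero)
    next
      case (2 j)
      then have "commutator a (yv i) \<in> quadratic_atoms n"
        using \<open>i < n\<close> by (simp add: quadratic_atomsI)
      then show ?thesis by (intro free.span_base) (simp add: atoms_def)
    next
      case 3
      then show ?thesis by (intro free.span_base UnI2 commutator_quadratic_yv)
    next
      case 4
      then have "commutator a (yv i) \<in> J"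
        unfolding commutator_def by (intro closed(2,4,5))
      then show ?thesis by (intro free.span_base UnI2)
    qed
  qed
  then show ?case by (rule span_commutator_yv[OF bracket.IH])
next
  case (add d p q)
  then show ?case by (simp add: free.span_add)
next
  case (mult d p e q)
  have "a * b \<in> free_span (atoms n 2 \<union> J)" if ab: "a \<in> atoms n 2 \<union> J" "b \<in> atoms n 2 \<union> J" for a b
  proof -
    consider "a = 1" | "b = 1" | "a \<in> J" | "b \<in> J" | i j where "i < n" "j < n" "a = zv i" "b = zv j"
      | i where "a = zv i" "b \<in> quadratic_atoms n" | i where "a \<in> quadratic_atoms n" "b = zv i"
      | "a \<in> quadratic_atoms n" "b \<in> quadratic_atoms n"
      using ab unfolding atoms_two by blast
    then have "a * b \<in> atoms n 2 \<union> J"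
    proof cases
      case 1
      then show ?thesis using ab by simp
    next
      case 2
      then show ?thesis using ab by simp
    next
      case 3
      then show ?thesis by (intro UnI2 closed(5))
    next
      case 4
      then show ?thesis by (intro UnI2 closed(4))
    next
      case (5 i j)
      then have "a * b \<in> quadratic_atoms n"
        by (simp add: quadratic_atomsI)
      then show ?thesis by (simp add: atoms_two)
    next
      case (6 i)
      then show ?thesis by (simp add: zv_mult_quadratic)
    next
      case (7 i)
      then show ?thesis by (simp add: quadratic_mult_zv)
    next
      case 8
      then show ?thesis by (simp add: quadratic_mult_quadratic)
    qed
    then show ?thesis by (rule free.span_base)
  qed
  with mult.IH show ?case by (rule span_mult)
qed

text \<open>A proper element of \<open>I\<close> is congruent modulo \<open>J \<subseteq> I\<close>
  to a form of degree at most two, which is again in \<open>I\<close> and so has all its components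
  in \<open>I\<close>, hence in \<open>J\<close>.\<close>

theorem eq_of_atoms_transfer:
  assumes I: "T_ideal kind I" "1 \<notin> I" and "J \<subseteq> I" and transfer: "atoms_transfer I J"
  shows "I = J"
proof
  show "I \<subseteq> J"
  proof
    fix p
    assume "p \<in> I"
    then show "p \<in> J"
    proof (rule T_ideal_subset_of_proper[OF I(1) _ order_refl])
      fix n q
      assume q: "proper n (total_degree p) q" "q \<in> I"
      have "free_subspace J"
        by (intro free.subspaceI closed(6,1) T_ideal_fscale[OF T_ideal])
      then have "free_span J = J"
        by (rule free.span_eq_iff[THEN iffD2])
      with proper_in_span_atoms_mod[OF q(1)] obtain r j
        where r: "r \<in> free_span (atoms n 2)" "j \<in> J" "q = r + j"
        unfolding free.span_Un by blast
      have "r \<in> I"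
        using T_ideal_diff[OF I(1) q(2) subsetD[OF \<open>J \<subseteq> I\<close> r(2)]] by (simp add: r(3))
      moreover obtain c a b d e where "r = low_form {..<n} {..<n} c a b d e"
        using low_form_of_span[OF r(1)] by blast
      ultimately have "r \<in> J"
        using low_form_transfer[OF I T_ideal transfer, of "{..<n}" "{..<n}" c a b d e] by simp
      then show "q \<in> J" unfolding r(3) by (intro closed(1) r(2))
    qed (rule closed(6), rule closed(1), assumption+, rule closed(4), assumption)
  qed
qed (rule assms)

end

section \<open>Models that separate degrees\<close>

text \<open>A ring with a distinguished involutive automorphism, along which a new generator can be
  adjoined. Exterior algebras arise by iteration.\<close>

class parity_ring = ring_1 +
  fixes par :: "'a \<Rightarrow> 'a"
  assumes par_add: "par (a + b) = par a + par b"
    and par_mult: "par (a * b) = par a * par b"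
    and par_one: "par 1 = 1"
    and par_par: "par (par a) = a"
begin

lemma par_zero: "par 0 = 0"
  using par_add[of 0 0] by simp

lemma par_uminus: "par (- a) = - par a"
  by (metis minus_unique par_add par_zero right_minus)

lemma par_diff: "par (a - b) = par a - par b"
  using par_add[of a "- b"] by (simp add: par_uminus)

lemmas par_simps = par_add par_mult par_one par_par par_zero par_uminus par_diff

end

text \<open>\<open>Tw a b\<close> is \<open>a + b e\<close>, where \<open>e\<^sup>2 = 0\<close> and \<open>e a = par a e\<close>.\<close>

datatype 'a twisted = Tw (base: 'a) (coefficient: 'a)

lemma twisted_eq_iff: "x = y \<longleftrightarrow> base x = base y \<and> coefficient x = coefficient y"
  by (cases x; cases y) simp

instantiation twisted :: (parity_ring) parity_ring
begin

definition "0 = Tw 0 0"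
definition "1 = Tw 1 0"
definition "x + y = Tw (base x + base y) (coefficient x + coefficient y)"
definition "x - y = Tw (base x - base y) (coefficient x - coefficient y)"
definition "- x = Tw (- base x) (- coefficient x)"
definition "x * y = Tw (base x * base y) (base x * coefficient y + coefficient x * par (base y))"
definition "par x = Tw (par (base x)) (- par (coefficient x))"

lemmas twisted_defs = zero_twisted_def one_twisted_def plus_twisted_def minus_twisted_def
  uminus_twisted_def times_twisted_def par_twisted_def

instance
  by standard (simp_all add: twisted_defs par_simps algebra_simps)

end

text \<open>Supercommutativity, stated with \<open>par\<close> instead of a decomposition into even
  and odd parts: for odd \<open>b\<close>, \<open>b * par c = c * b\<close> says that
  \<open>b\<close> commutes with even and anticommutes with odd elements. In this form it passes to
  \<open>twisted\<close> without dividing by two.\<close>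

class supercommutative_ring = parity_ring +
  assumes even_central: "par a = a \<Longrightarrow> a * c = c * a"
    and odd_supercommutes: "par b = - b \<Longrightarrow> b * par c = c * b"

instance twisted :: (supercommutative_ring) supercommutative_ring
proof
  fix a b c :: "'a twisted"
  assume "par a = a"
  then have "par (base a) = base a" "par (coefficient a) = - coefficient a"
    by (simp_all add: par_twisted_def twisted_eq_iff minus_equation_iff)
  then show "a * c = c * a"
    using even_central[of "base a"] odd_supercommutes[of "coefficient a"]
    by (simp add: times_twisted_def)
next
  fix b c :: "'a twisted"
  assume "par b = - b"
  then have "par (base b) = - base b" "par (coefficient b) = coefficient b"
    by (simp_all add: par_twisted_def uminus_twisted_def)
  then show "b * par c = c * b"
    by (simp add: times_twisted_def par_twisted_def par_simps even_central[of "coefficient b"]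
        odd_supercommutes)
qed

text \<open>The base of the exterior algebras: scalars are extended from the field to its polynomial
  ring, placed in even degree.\<close>

instantiation poly :: (field_char_0) supercommutative_ring
begin

definition "par (p :: 'a poly) = p"

instance
proof
  fix b c :: "'a poly"
  assume "par b = - b"
  then have "2 * b = 0" by (simp add: par_poly_def)
  then have "b = 0" by simp
  then show "b * par c = c * b" by simp
qed (simp_all add: par_poly_def mult.commute)

end

locale parity_algebra = unital_algebra scale
  for scale :: "'k::field_char_0 \<Rightarrow> 'a::parity_ring \<Rightarrow> 'a" +
  assumes par_scale: "par (scale c a) = scale c (par a)"

definition twisted_scale :: "('k \<Rightarrow> 'a \<Rightarrow> 'a) \<Rightarrow> 'k \<Rightarrow> 'a twisted \<Rightarrow> 'a twisted" where
  "twisted_scale scale c x = Tw (scale c (base x)) (scale c (coefficient x))"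

lemma parity_algebra_twisted:
  assumes "parity_algebra scale"
  shows "parity_algebra (twisted_scale scale)"
proof -
  interpret parity_algebra scale by fact
  show ?thesis
    by standard
      (simp_all add: twisted_scale_def twisted_defs par_scale scale_right_distrib scale_left_distrib
        scale_mult_left[symmetric] scale_mult_right[symmetric])
qed

lemma parity_algebra_poly: "parity_algebra (smult :: 'k::field_char_0 \<Rightarrow> _)"
  by standard (simp_all add: par_poly_def smult_add_right smult_add_left)

lemma phi_algebra_par:
  assumes "parity_algebra scale"
  shows "phi_algebra Automorphism scale par"
proof -
  interpret parity_algebra scale by fact
  show ?thesis
    by standard (simp_all add: par_simps par_scale)
qed

lemma phi_algebra_id:
  assumes "unital_algebra scale"
  shows "phi_algebra Automorphism scale (\<lambda>a. a)"
proof -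
  interpret unital_algebra scale by fact
  show ?thesis by standard simp_all
qed

lemma (in unital_algebra) eq_uminus_iff:
  fixes a :: 'a
  shows "a = - a \<longleftrightarrow> a = 0"
proof
  assume "a = - a"
  then have "a + a = 0" by (metis add.right_inverse)
  then have "scale 2 a = 0"
    using scale_left_distrib[of 1 1 a] by simp
  then show "a = 0" by simp
qed simp

lemma commutator_add:
  "commutator (a + b) c = commutator a c + commutator b c"
  "commutator a (b + c) = commutator a b + commutator a c"
  by (simp_all add: commutator_def algebra_simps)

text \<open>Even elements are central, so \<open>4[a,b]\<close> is the commutator of the odd
  elements \<open>a - par a\<close> and \<open>b - par b\<close>; that commutator is even.\<close>

lemma supercommutative_Lie_nilpotent:
  fixes scale :: "'k::field_char_0 \<Rightarrow> 'a::supercommutative_ring \<Rightarrow> 'a"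
  assumes "parity_algebra scale"
  shows "commutator (commutator a b) c = (0 :: 'a)"
proof -
  interpret parity_algebra scale by fact
  define a' b' where "a' = a - par a" and "b' = b - par b"
  have ab: "a + a = (a + par a) + a'" "b + b = (b + par b) + b'"
    by (simp_all add: a'_def b'_def)
  have central: "commutator (a + par a) x = 0" "commutator x (b + par b) = 0" for x
    using even_central[of "a + par a" x] even_central[of "b + par b" x]
    by (simp_all add: commutator_def par_simps add.commute)
  have "par (commutator a' b') = commutator a' b'"
    by (simp add: commutator_def a'_def b'_def par_simps algebra_simps)
  then have "commutator (commutator a' b') c = 0"
    by (simp add: commutator_def even_central)
  moreover have "commutator (a + a) (b + b) = commutator a' b'"
    unfolding ab by (simp only: commutator_add(1)[of "a + par a" a'] commutator_add(2)[of _ "b + par b" b'] central) simp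
  ultimately have "commutator (commutator (a + a) (b + b)) c = 0" by simp
  moreover have "commutator (commutator (a + a) (b + b)) c = scale 4 (commutator (commutator a b) c)"
  proof -
    have "scale 4 x = x + x + (x + x)" for x
      using scale_left_distrib[of 2 2 x] scale_left_distrib[of 1 1 x] by simp
    then show ?thesis by (simp add: commutator_add)
  qed
  ultimately show ?thesis by simp
qed

text \<open>The extension of an antiautomorphism \<open>\<psi>\<close> of the base ring to
  \<open>twisted\<close> that sends \<open>e\<close> to \<open>e\<close> or to \<open>- e\<close>,
  according to \<open>s\<close>; \<open>par\<close> appears because \<open>e\<close> has to be moved
  back to the right.\<close>

definition flip :: "bool \<Rightarrow> ('a \<Rightarrow> 'a) \<Rightarrow> 'a::parity_ring twisted \<Rightarrow> 'a twisted" where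
  "flip s \<psi> x = Tw (\<psi> (base x)) (if s then par (\<psi> (coefficient x)) else - par (\<psi> (coefficient x)))"

lemma phi_algebra_flip:
  assumes par: "parity_algebra scale" and \<psi>: "phi_algebra Antiautomorphism scale \<psi>"
    and comm: "\<And>a. \<psi> (par a) = par (\<psi> a)"
  shows "phi_algebra Antiautomorphism (twisted_scale scale) (flip s \<psi>)"
    and "flip s \<psi> (par x) = par (flip s \<psi> x)"
proof -
  interpret phi_algebra Antiautomorphism scale \<psi> by fact
  interpret parity_algebra scale by fact
  interpret twisted: parity_algebra "twisted_scale scale"
    by (rule parity_algebra_twisted) fact
  show "phi_algebra Antiautomorphism (twisted_scale scale) (flip s \<psi>)"
    by standard
      (auto simp: flip_def twisted_scale_def twisted_defs par_simps phi_add phi_scale phi_one phi_zero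
        phi_uminus phi_mult phi_involution comm par_scale algebra_simps)
  show "flip s \<psi> (par x) = par (flip s \<psi> x)"
    by (simp add: flip_def par_twisted_def comm phi_uminus par_simps)
qed

lemma (in unital_algebra) phi_algebra_id_commutative:
  assumes "\<And>a b :: 'a. a * b = b * a"
  shows "phi_algebra Antiautomorphism scale (\<lambda>a. a)"
  by standard (simp_all add: assms)

type_synonym 'k exterior3 = "'k poly twisted twisted twisted"

abbreviation exterior3_scale :: "'k::field_char_0 \<Rightarrow> 'k exterior3 \<Rightarrow> 'k exterior3" where
  "exterior3_scale \<equiv> twisted_scale (twisted_scale (twisted_scale smult))"

abbreviation exterior4_scale :: "'k::field_char_0 \<Rightarrow> 'k exterior3 twisted \<Rightarrow> 'k exterior3 twisted" where
  "exterior4_scale \<equiv> twisted_scale exterior3_scale"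

text \<open>The innermost generator \<open>s\<close> is symmetric and the other two,
  \<open>e\<^sub>1\<close> and \<open>e\<^sub>2\<close>, are skew. Then
  \<open>e\<^sub>1[e\<^sub>2,s] \<noteq> 0\<close>, although symmetric elements commute and skew
  elements anticommute.\<close>

abbreviation reversal :: "'k::field_char_0 exterior3 \<Rightarrow> 'k exterior3" where
  "reversal \<equiv> flip False (flip False (flip True (\<lambda>p. p)))"

lemma phi_algebra_reversal: "phi_algebra Antiautomorphism (exterior3_scale :: 'k::field_char_0 \<Rightarrow> _) reversal"
proof -
  interpret parity_algebra "smult :: 'k \<Rightarrow> _" by (rule parity_algebra_poly)
  note base = parity_algebra_poly phi_algebra_id_commutative[OF mult.commute]
  have step1: "phi_algebra Antiautomorphism (twisted_scale (smult :: 'k \<Rightarrow> _)) (flip True (\<lambda>p. p))"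
      "flip True (\<lambda>p. p) (par x) = par (flip True (\<lambda>p. p) (x :: 'k poly twisted))" for x
    using phi_algebra_flip[OF base] by simp_all
  note step2 = phi_algebra_flip[OF parity_algebra_twisted[OF parity_algebra_poly] step1]
  show ?thesis
    by (rule phi_algebra_flip(1)[OF parity_algebra_twisted[OF parity_algebra_twisted[OF parity_algebra_poly]] step2])
qed

lemma double_eq_zero: "c + c = 0 \<longleftrightarrow> c = 0" for c :: "'k::field_char_0"
  by (simp flip: mult_2)

text \<open>\<open>Quiver p q a b\<close>: the radical-square-zero path algebra of the quiver with two vertices and one
  arrow in each direction.\<close>

datatype 'k quiver = Quiver (fst_vertex: 'k) (snd_vertex: 'k) (fst_arrow: 'k) (snd_arrow: 'k)

instantiation quiver :: (comm_ring_1) ring_1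
begin

definition "0 = Quiver 0 0 0 0"
definition "1 = Quiver 1 1 0 0"
definition "x + y = Quiver (fst_vertex x + fst_vertex y) (snd_vertex x + snd_vertex y)
  (fst_arrow x + fst_arrow y) (snd_arrow x + snd_arrow y)"
definition "x - y = Quiver (fst_vertex x - fst_vertex y) (snd_vertex x - snd_vertex y)
  (fst_arrow x - fst_arrow y) (snd_arrow x - snd_arrow y)"
definition "- x = Quiver (- fst_vertex x) (- snd_vertex x) (- fst_arrow x) (- snd_arrow x)"
definition "x * y = Quiver (fst_vertex x * fst_vertex y) (snd_vertex x * snd_vertex y)
  (fst_vertex x * fst_arrow y + fst_arrow x * snd_vertex y)
  (snd_vertex x * snd_arrow y + snd_arrow x * fst_vertex y)"

lemmas quiver_defs = zero_quiver_def one_quiver_def plus_quiver_def minus_quiver_def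
  uminus_quiver_def times_quiver_def

instance
  by standard (simp_all add: quiver_defs algebra_simps)

end

definition quiver_scale :: "'k::field_char_0 \<Rightarrow> 'k quiver \<Rightarrow> 'k quiver" where
  "quiver_scale c x = Quiver (c * fst_vertex x) (c * snd_vertex x) (c * fst_arrow x) (c * snd_arrow x)"

definition negate_arrows :: "'k::field_char_0 quiver \<Rightarrow> 'k quiver" where
  "negate_arrows x = Quiver (fst_vertex x) (snd_vertex x) (- fst_arrow x) (- snd_arrow x)"

definition swap_arrows :: "'k::field_char_0 quiver \<Rightarrow> 'k quiver" where
  "swap_arrows x = Quiver (fst_vertex x) (snd_vertex x) (snd_arrow x) (fst_arrow x)"

lemma phi_algebra_quiver:
  "phi_algebra Automorphism (quiver_scale :: 'k::field_char_0 \<Rightarrow> _) negate_arrows"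
  "phi_algebra Antiautomorphism (quiver_scale :: 'k \<Rightarrow> _) swap_arrows"
  by (standard; simp add: quiver_scale_def negate_arrows_def swap_arrows_def quiver_defs algebra_simps)+

text \<open>The polynomial ring is commutative, so this map is an automorphism and an
  antiautomorphism. It satisfies all identities given by commutators, but not \<open>z\<^sub>1
  z\<^sub>2 z\<^sub>3\<close>.\<close>

definition substitute_uminus :: "'k::field_char_0 poly \<Rightarrow> 'k poly" where
  "substitute_uminus p = pcompose p [:0, - 1:]"

lemma phi_algebra_poly: "phi_algebra kind (smult :: 'k::field_char_0 \<Rightarrow> _) substitute_uminus"
proof -
  interpret parity_algebra "smult :: 'k \<Rightarrow> _" by (rule parity_algebra_poly)
  show ?thesis
    by standard
      (auto simp: substitute_uminus_def pcompose_add pcompose_mult pcompose_smult pcompose_1 pcompose_pCons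
        simp flip: pcompose_assoc split: phi_kind.split)
qed


abbreviation commutative_model :: "'k::field_char_0 free_algebra set" where
  "commutative_model \<equiv> phi_identities smult substitute_uminus"

abbreviation exterior_par_model :: "'k::field_char_0 free_algebra set" where
  "exterior_par_model \<equiv> phi_identities exterior3_scale par"

abbreviation exterior_reversal_model :: "'k::field_char_0 free_algebra set" where
  "exterior_reversal_model \<equiv> phi_identities exterior3_scale reversal"

abbreviation exterior_id_model :: "'k::field_char_0 free_algebra set" where
  "exterior_id_model \<equiv> phi_identities exterior4_scale (\<lambda>a. a)"

abbreviation quiver_model :: "('k quiver \<Rightarrow> 'k quiver) \<Rightarrow> 'k::field_char_0 free_algebra set" where
  "quiver_model \<phi> \<equiv> phi_identities quiver_scale \<phi>"

lemma commutative_model: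
  "T_ideal kind (commutative_model :: 'k::field_char_0 free_algebra set)"
  "lie [yv 2, yv 1] \<in> (commutative_model :: 'k free_algebra set)"
  "lie [zv 2, yv 1] \<in> (commutative_model :: 'k free_algebra set)"
  "lie [zv 2, zv 1] \<in> (commutative_model :: 'k free_algebra set)"
  "g * yv 3 + f_\<Gamma>3 \<notin> (commutative_model :: 'k free_algebra set)"
proof -
  interpret phi_algebra kind "smult :: 'k \<Rightarrow> _" substitute_uminus by (rule phi_algebra_poly)
  show "T_ideal kind (commutative_model :: 'k free_algebra set)"
    by (rule T_ideal_phi_identities)
  show "lie [yv 2, yv 1] \<in> (commutative_model :: 'k free_algebra set)"
    "lie [zv 2, yv 1] \<in> (commutative_model :: 'k free_algebra set)"
    "lie [zv 2, zv 1] \<in> (commutative_model :: 'k free_algebra set)"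
    by (simp_all add: phi_identities_iff eval_simps commutator_def mult.commute)
  define v where "v = case_letter (\<lambda>_. 0) (\<lambda>_. [:0, 1 :: 'k:])"
  have "admissible_valuation substitute_uminus v"
    by (simp add: admissible_valuation_def v_def substitute_uminus_def pcompose_pCons)
  moreover have "eval smult v (g * yv 3 + f_\<Gamma>3) \<noteq> 0"
    by (simp add: eval_simps v_def f_\<Gamma>3_def commutator_zero)
  ultimately show "g * yv 3 + f_\<Gamma>3 \<notin> (commutative_model :: 'k free_algebra set)"
    by (auto simp: phi_identities_iff)
qed

lemma exterior_par_model:
  "T_ideal Automorphism (exterior_par_model :: 'k::field_char_0 free_algebra set)"
  "lie [yv 2, yv 1] \<in> (exterior_par_model :: 'k free_algebra set)"
  "lie [zv 2, yv 1] \<in> (exterior_par_model :: 'k free_algebra set)"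
  "zv 1 \<odot> zv 2 \<in> (exterior_par_model :: 'k free_algebra set)"
  "g * yv 3 + f_\<Gamma>3 \<notin> (exterior_par_model :: 'k free_algebra set)"
proof -
  interpret phi_algebra Automorphism "exterior3_scale :: 'k \<Rightarrow> _" par
    by (intro phi_algebra_par parity_algebra_twisted parity_algebra_poly)
  show "T_ideal Automorphism (exterior_par_model :: 'k free_algebra set)"
    by (rule T_ideal_phi_identities)
  have central: "commutator a b = 0" "commutator b a = 0" if "par a = a" for a b :: "'k exterior3"
    using even_central[OF that, of b] by (simp_all add: commutator_def)
  show "lie [yv 2, yv 1] \<in> (exterior_par_model :: 'k free_algebra set)"
    "lie [zv 2, yv 1] \<in> (exterior_par_model :: 'k free_algebra set)"
    by (simp_all add: phi_identities_iff admissible_valuation_def eval_simps central)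
  \<comment> \<open>Odd elements anticommute.\<close>
  have "a * b + b * a = 0" if "par a = - a" "par b = - b" for a b :: "'k exterior3"
    using odd_supercommutes[OF that(1), of b] by (simp add: that(2) add_eq_0_iff minus_equation_iff)
  then show "zv 1 \<odot> zv 2 \<in> (exterior_par_model :: 'k free_algebra set)"
    by (simp add: phi_identities_iff admissible_valuation_def eval_simps jordan_def)
  define e :: "nat \<Rightarrow> 'k exterior3" where
    "e i = (if i = 1 then Tw 0 1 else if i = 2 then Tw (Tw 0 1) 0 else Tw (Tw (Tw 0 1) 0) 0)" for i
  define v where "v = case_letter (\<lambda>_. 0) e"
  have "admissible_valuation par v"
    by (simp add: admissible_valuation_def v_def e_def twisted_defs par_poly_def)
  moreover have "eval exterior3_scale v (g * yv 3 + f_\<Gamma>3) \<noteq> 0"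
    by (simp add: eval_simps v_def f_\<Gamma>3_def commutator_zero)
      (simp add: e_def twisted_defs par_poly_def)
  ultimately show "g * yv 3 + f_\<Gamma>3 \<notin> (exterior_par_model :: 'k free_algebra set)"
    by (auto simp: phi_identities_iff)
qed

lemma exterior_reversal_model:
  "T_ideal Antiautomorphism (exterior_reversal_model :: 'k::field_char_0 free_algebra set)"
  "lie [yv 2, yv 1] \<in> (exterior_reversal_model :: 'k free_algebra set)"
  "zv 1 \<odot> zv 2 \<in> (exterior_reversal_model :: 'k free_algebra set)"
  "g * yv 3 + f_\<Gamma>3 \<notin> (exterior_reversal_model :: 'k free_algebra set)"
proof -
  interpret phi_algebra Antiautomorphism "exterior3_scale :: 'k \<Rightarrow> _" reversal
    by (rule phi_algebra_reversal)
  interpret poly: parity_algebra "smult :: 'k \<Rightarrow> _" by (rule parity_algebra_poly)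
  show "T_ideal Antiautomorphism (exterior_reversal_model :: 'k free_algebra set)"
    by (rule T_ideal_phi_identities)
  \<comment> \<open>The general symmetric and the general skew element, in the basis of monomials in \<open>s\<close>, \<open>e\<^sub>1\<close>, \<open>e\<^sub>2\<close>.\<close>
  define y where "y a b c d = Tw (Tw (Tw a b) (Tw 0 c)) (Tw (Tw 0 d) 0)" for a b c d :: "'k poly"
  define z where "z a b c d = Tw (Tw 0 (Tw a 0)) (Tw (Tw b 0) (Tw c d))" for a b c d :: "'k poly"
  have coordinates: "x = Tw (Tw (Tw (base (base (base x))) (coefficient (base (base x))))
        (Tw (base (coefficient (base x))) (coefficient (coefficient (base x)))))
      (Tw (Tw (base (base (coefficient x))) (coefficient (base (coefficient x))))
        (Tw (base (coefficient (coefficient x))) (coefficient (coefficient (coefficient x)))))" for x :: "'k exterior3"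
    by simp
  have y: "\<exists>a b c d. x = y a b c d" if "reversal x = x" for x :: "'k exterior3"
    using that poly.eq_uminus_iff
    by (subst coordinates) (auto simp: y_def flip_def twisted_defs par_poly_def twisted_eq_iff)
  have z: "\<exists>a b c d. x = z a b c d" if "reversal x = - x" for x :: "'k exterior3"
    using that poly.eq_uminus_iff
    by (subst coordinates) (auto simp: z_def flip_def twisted_defs par_poly_def twisted_eq_iff)
  have "commutator (y a b c d) (y a' b' c' d') = 0" for a b c d a' b' c' d'
    by (simp add: commutator_def y_def twisted_defs par_poly_def algebra_simps)
  then show "lie [yv 2, yv 1] \<in> (exterior_reversal_model :: 'k free_algebra set)"
    using y by (simp add: phi_identities_iff admissible_valuation_def eval_simps) metis
  have "z a b c d \<odot> z a' b' c' d' = 0" for a b c d a' b' c' d'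
    by (simp add: jordan_def z_def twisted_defs par_poly_def algebra_simps)
  then show "zv 1 \<odot> zv 2 \<in> (exterior_reversal_model :: 'k free_algebra set)"
    using z by (simp add: phi_identities_iff admissible_valuation_def eval_simps) metis
  define v where "v = case_letter (\<lambda>i. if i = 1 then y 0 1 0 0 else 0)
    (\<lambda>i. if i = 3 then z 1 0 0 0 else if i = 2 then z 0 1 0 0 else 0)"
  have "admissible_valuation reversal v"
    by (simp add: admissible_valuation_def v_def y_def z_def flip_def twisted_defs par_poly_def)
  moreover have "eval exterior3_scale v (g * yv 3 + f_\<Gamma>3) \<noteq> 0"
    by (simp add: eval_simps v_def f_\<Gamma>3_def commutator_zero)
      (simp add: y_def z_def commutator_def twisted_defs par_poly_def)
  ultimately show "g * yv 3 + f_\<Gamma>3 \<notin> (exterior_reversal_model :: 'k free_algebra set)"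
    by (auto simp: phi_identities_iff)
qed

lemma quiver_negate_model:
  "T_ideal Automorphism (quiver_model negate_arrows :: 'k::field_char_0 free_algebra set)"
  "lie [yv 2, yv 1] \<in> (quiver_model negate_arrows :: 'k free_algebra set)"
  "zv 1 * zv 2 \<in> (quiver_model negate_arrows :: 'k free_algebra set)"
  "(zv 1 * zv 2 + lie [yv 2, yv 1]) * yv 3 + f_\<Gamma>3 \<notin> (quiver_model negate_arrows :: 'k free_algebra set)"
proof -
  interpret phi_algebra Automorphism "quiver_scale :: 'k \<Rightarrow> _" negate_arrows
    by (rule phi_algebra_quiver)
  show "T_ideal Automorphism (quiver_model negate_arrows :: 'k free_algebra set)"
    by (rule T_ideal_phi_identities)
  have y: "\<exists>p q. x = Quiver p q 0 0" if "negate_arrows x = x" for x :: "'k quiver"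
    using that by (cases x) (auto simp: negate_arrows_def swap_arrows_def uminus_quiver_def double_eq_zero eq_neg_iff_add_eq_0 neg_eq_iff_add_eq_0)
  have z: "\<exists>a b. x = Quiver 0 0 a b" if "negate_arrows x = - x" for x :: "'k quiver"
    using that by (cases x) (auto simp: negate_arrows_def swap_arrows_def uminus_quiver_def double_eq_zero eq_neg_iff_add_eq_0 neg_eq_iff_add_eq_0)
  have "commutator (Quiver p q 0 0) (Quiver p' q' 0 0) = (0 :: 'k quiver)" for p q p' q'
    by (simp add: commutator_def quiver_defs)
  then show "lie [yv 2, yv 1] \<in> (quiver_model negate_arrows :: 'k free_algebra set)"
    using y by (simp add: phi_identities_iff admissible_valuation_def eval_simps) metis
  have "Quiver 0 0 a b * Quiver 0 0 a' b' = (0 :: 'k quiver)" for a b a' b'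
    by (simp add: quiver_defs)
  then show "zv 1 * zv 2 \<in> (quiver_model negate_arrows :: 'k free_algebra set)"
    using z by (simp add: phi_identities_iff admissible_valuation_def eval_simps) metis
  define v :: "letter \<Rightarrow> 'k quiver" where
    "v = case_letter (\<lambda>i. if i = 1 \<or> i = 3 then Quiver 1 (- 1) 0 0 else 0)
      (\<lambda>i. if i = 2 then Quiver 0 0 1 1 else 0)"
  have "admissible_valuation negate_arrows v"
    by (simp add: admissible_valuation_def v_def negate_arrows_def swap_arrows_def quiver_defs)
  moreover have "eval quiver_scale v ((zv 1 * zv 2 + lie [yv 2, yv 1]) * yv 3 + f_\<Gamma>3) \<noteq> 0"
    by (simp add: eval_simps v_def f_\<Gamma>3_def commutator_zero)
      (simp add: commutator_def quiver_defs)
  ultimately show "(zv 1 * zv 2 + lie [yv 2, yv 1]) * yv 3 + f_\<Gamma>3 \<notin> (quiver_model negate_arrows :: 'k free_algebra set)"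
    by (auto simp: phi_identities_iff)
qed

lemma quiver_swap_model:
  "T_ideal Antiautomorphism (quiver_model swap_arrows :: 'k::field_char_0 free_algebra set)"
  "zv 1 * zv 2 \<in> (quiver_model swap_arrows :: 'k free_algebra set)"
  "zv 1 * zv 2 * yv 3 + f_\<Gamma>3 \<notin> (quiver_model swap_arrows :: 'k free_algebra set)"
proof -
  interpret phi_algebra Antiautomorphism "quiver_scale :: 'k \<Rightarrow> _" swap_arrows
    by (rule phi_algebra_quiver)
  show "T_ideal Antiautomorphism (quiver_model swap_arrows :: 'k free_algebra set)"
    by (rule T_ideal_phi_identities)
  have z: "\<exists>a b. x = Quiver 0 0 a b" if "swap_arrows x = - x" for x :: "'k quiver"
    using that by (cases x) (auto simp: negate_arrows_def swap_arrows_def uminus_quiver_def double_eq_zero eq_neg_iff_add_eq_0 neg_eq_iff_add_eq_0)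
  have "Quiver 0 0 a b * Quiver 0 0 a' b' = (0 :: 'k quiver)" for a b a' b'
    by (simp add: quiver_defs)
  then show "zv 1 * zv 2 \<in> (quiver_model swap_arrows :: 'k free_algebra set)"
    using z by (simp add: phi_identities_iff admissible_valuation_def eval_simps) metis
  define v :: "letter \<Rightarrow> 'k quiver" where
    "v = case_letter (\<lambda>i. if i = 1 \<or> i = 3 then Quiver 1 (- 1) 0 0 else if i = 2 then Quiver 0 0 1 1 else 0)
      (\<lambda>_. 0)"
  have "admissible_valuation swap_arrows v"
    by (simp add: admissible_valuation_def v_def negate_arrows_def swap_arrows_def quiver_defs)
  moreover have "eval quiver_scale v (zv 1 * zv 2 * yv 3 + f_\<Gamma>3) \<noteq> 0"
    by (simp add: eval_simps v_def f_\<Gamma>3_def commutator_zero)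
      (simp add: commutator_def quiver_defs)
  ultimately show "zv 1 * zv 2 * yv 3 + f_\<Gamma>3 \<notin> (quiver_model swap_arrows :: 'k free_algebra set)"
    by (auto simp: phi_identities_iff)
qed

lemma exterior_id_model:
  fixes g :: "'k::field_char_0 free_algebra"
  shows "T_ideal Automorphism (exterior_id_model :: 'k free_algebra set)"
    and "zv i \<in> (exterior_id_model :: 'k free_algebra set)"
    and "lie [yv 3, yv 2, yv 1] \<in> (exterior_id_model :: 'k free_algebra set)"
    and "p - sub (keep UNIV {}) p \<in> (exterior_id_model :: 'k free_algebra set)"
    and "sub (keep UNIV {}) g = 0 \<Longrightarrow> g + lie [yv 2, yv 1] \<notin> (exterior_id_model :: 'k free_algebra set)"
    and "sub (keep UNIV {}) g = 0 \<Longrightarrow> g + f_4 \<notin> (exterior_id_model :: 'k free_algebra set)"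
proof -
  have parity: "parity_algebra (exterior4_scale :: 'k \<Rightarrow> _)"
    by (intro parity_algebra_twisted parity_algebra_poly)
  then interpret unital_algebra "exterior4_scale :: 'k \<Rightarrow> _"
    by (rule parity_algebra.axioms)
  interpret phi_algebra Automorphism "exterior4_scale :: 'k \<Rightarrow> _" "\<lambda>a. a"
    by (rule phi_algebra_id) (rule unital_algebra_axioms)
  show "T_ideal Automorphism (exterior_id_model :: 'k free_algebra set)"
    by (rule T_ideal_phi_identities)
  have vanish: "v (Z i) = 0" if "admissible_valuation (\<lambda>a. a) v" for i and v :: "letter \<Rightarrow> 'k exterior3 twisted"
    using that eq_uminus_iff by (simp add: admissible_valuation_def)
  then show "zv i \<in> (exterior_id_model :: 'k free_algebra set)"
    by (simp add: phi_identities_iff eval_simps)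
  show "lie [yv 3, yv 2, yv 1] \<in> (exterior_id_model :: 'k free_algebra set)"
    by (simp add: phi_identities_iff eval_simps supercommutative_Lie_nilpotent[OF parity])
  have keep: "eval exterior4_scale v (sub (keep UNIV {}) p) = eval exterior4_scale v p"
    if "admissible_valuation (\<lambda>a. a) v" for v :: "letter \<Rightarrow> 'k exterior3 twisted" and p
  proof -
    have "(\<lambda>l. eval exterior4_scale v (keep UNIV {} l)) = v"
      using vanish[OF that] by (auto simp: fun_eq_iff keep_def eval_simps split: letter.split)
    then show ?thesis by (simp add: eval_sub)
  qed
  then show "p - sub (keep UNIV {}) p \<in> (exterior_id_model :: 'k free_algebra set)"
    by (simp add: phi_identities_iff eval_simps)
  define e :: "nat \<Rightarrow> 'k exterior3 twisted" where
    "e i = (if i = 1 then Tw 0 1 else if i = 2 then Tw (Tw 0 1) 0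
      else if i = 3 then Tw (Tw (Tw 0 1) 0) 0 else Tw (Tw (Tw (Tw 0 1) 0) 0) 0)" for i
  define v where "v = case_letter e (\<lambda>_. 0)"
  have v: "admissible_valuation (\<lambda>a. a) v"
    by (simp add: admissible_valuation_def v_def)
  have g: "eval exterior4_scale v g = 0" if "sub (keep UNIV {}) g = 0"
    using keep[OF v, of g] that by (simp add: eval_zero)
  have "eval exterior4_scale v (lie [yv 2, yv 1]) \<noteq> 0"
    by (simp add: eval_simps v_def) (simp add: e_def commutator_def twisted_defs par_poly_def)
  then show "g + lie [yv 2, yv 1] \<notin> (exterior_id_model :: 'k free_algebra set)" if "sub (keep UNIV {}) g = 0"
    using v g[OF that] by (auto simp: phi_identities_iff eval_add)
  have "eval exterior4_scale v f_4 \<noteq> 0"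
    by (simp add: eval_simps v_def f_4_def f_\<Gamma>3_def commutator_zero supercommutative_Lie_nilpotent[OF parity])
      (simp add: e_def commutator_def twisted_defs par_poly_def)
  then show "g + f_4 \<notin> (exterior_id_model :: 'k free_algebra set)" if "sub (keep UNIV {}) g = 0"
    using v g[OF that] by (auto simp: phi_identities_iff eval_add)
qed

section \<open>Proper multilinear polynomials of small degree\<close>

text \<open>The permutation is read off from the indices of the letters, and the choice between
  \<open>Y j\<close> and \<open>Z j\<close> from the letter with index \<open>j\<close>.\<close>

lemma monomial_in_V_space:
  assumes "distinct (map letter_index ls)" "length ls = n" "list_all (\<lambda>l. 1 \<le> letter_index l \<and> letter_index l \<le> n) ls"
  shows "monomial ls \<in> V_space n"
proof -
  define \<sigma> where "\<sigma> i = (if i \<in> {1..n} then letter_index (ls ! (i - 1)) else i)" for i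
  define v where "v j = (if j \<in> letter_index ` set ls then inv_into (set ls) letter_index j else Y j)" for j
  have inj: "inj_on letter_index (set ls)"
    using assms(1) by (simp add: distinct_map)
  have v: "v (letter_index l) = l" if "l \<in> set ls" for l
    using that inj by (simp add: v_def)
  have "letter_index (v j) = j" for j
    by (auto simp: v_def f_inv_into_f)
  moreover have "l \<in> {Y (letter_index l), Z (letter_index l)}" for l
    by (cases l) auto
  ultimately have "v j \<in> {Y j, Z j}" for j
    by metis
  moreover have "\<sigma> permutes {1..n}"
  proof (rule bij_imp_permutes)
    have "inj_on \<sigma> {1..n}"
    proof (rule inj_onI)
      fix i j
      assume ij: "i \<in> {1..n}" "j \<in> {1..n}" "\<sigma> i = \<sigma> j"
      then have "map letter_index ls ! (i - 1) = map letter_index ls ! (j - 1)"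
        using assms(2) by (auto simp: \<sigma>_def)
      then have "i - 1 = j - 1"
        using ij assms(2) by (subst (asm) nth_eq_iff_index_eq[OF assms(1)]) auto
      then show "i = j" using ij by auto
    qed
    moreover have "\<sigma> ` {1..n} \<subseteq> {1..n}"
      using assms(2,3) by (auto simp: \<sigma>_def list_all_length)
    ultimately show "bij_betw \<sigma> {1..n} {1..n}"
      by (simp add: bij_betw_def endo_inj_surj)
  qed (simp add: \<sigma>_def del: atLeastAtMost_iff)
  moreover have "ls = map (\<lambda>i. v (\<sigma> i)) [1..<Suc n]"
    using assms(2) by (intro nth_equalityI) (simp_all add: \<sigma>_def v del: upt_Suc)
  ultimately show ?thesis
    unfolding V_space_def by (intro free.span_base) blast
qed

lemma V_space_closed:
  "p \<in> V_space n \<Longrightarrow> q \<in> V_space n \<Longrightarrow> p + q \<in> V_space n"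
  "p \<in> V_space n \<Longrightarrow> q \<in> V_space n \<Longrightarrow> p - q \<in> V_space n"
  "p \<in> V_space n \<Longrightarrow> - p \<in> V_space n"
  by (simp_all add: V_space_def free.span_add free.span_diff free.span_neg)

lemmas expand = commutator_def jordan_def yv_def zv_def distrib_left distrib_right
  left_diff_distrib right_diff_distrib

lemmas V_space_simps = V_space_closed monomial_in_V_space monomial_append[symmetric]

lemma free_subalgebra_B_Y: "free_subalgebra B_Y"
  unfolding B_Y_def
  by (rule hull_in) (auto simp: free_subalgebra_def free.subspace_def)

lemma B_Y_closed:
  "p \<in> B_Y \<Longrightarrow> q \<in> B_Y \<Longrightarrow> p + q \<in> B_Y" "p \<in> B_Y \<Longrightarrow> q \<in> B_Y \<Longrightarrow> p * q \<in> B_Y"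
  using free_subalgebra_B_Y by (auto simp: free_subalgebra_def free.subspace_def)

lemma B_Y_generators:
  "zv i \<in> B_Y" "length vs \<ge> 2 \<Longrightarrow> set vs \<subseteq> range yv \<union> range zv \<Longrightarrow> lie vs \<in> B_Y"
  unfolding B_Y_def by (auto intro!: hull_inc)

lemma zv_in_\<Gamma>: "zv 1 \<in> \<Gamma> 1"
  by (simp add: \<Gamma>_def B_Y_generators) (simp add: expand V_space_simps)

lemma quadratic_in_\<Gamma>:
  "lie [yv 2, yv 1] \<in> \<Gamma> 2" "lie [zv 2, yv 1] \<in> \<Gamma> 2" "lie [yv 2, zv 1] \<in> \<Gamma> 2"
  "zv 1 \<odot> zv 2 \<in> \<Gamma> 2" "lie [zv 2, zv 1] \<in> \<Gamma> 2"
proof -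
  have "zv 1 \<odot> zv 2 \<in> B_Y"
    unfolding jordan_def by (intro B_Y_closed B_Y_generators)
  then show "lie [yv 2, yv 1] \<in> \<Gamma> 2" "lie [zv 2, yv 1] \<in> \<Gamma> 2" "lie [yv 2, zv 1] \<in> \<Gamma> 2"
    "zv 1 \<odot> zv 2 \<in> \<Gamma> 2" "lie [zv 2, zv 1] \<in> \<Gamma> 2"
    by (simp_all add: \<Gamma>_def B_Y_generators del: lie.simps) (simp_all add: expand V_space_simps)
qed

lemma cubic_in_\<Gamma>:
  "lie [yv 3, yv 2, yv 1] \<in> \<Gamma> 3" "lie [yv 3, zv 2, yv 1] \<in> \<Gamma> 3" "zv 3 * lie [yv 2, yv 1] \<in> \<Gamma> 3"
  "lie [yv 3, zv 2, zv 1] \<in> \<Gamma> 3" "zv 3 * lie [zv 2, yv 1] \<in> \<Gamma> 3" "zv 1 * zv 2 * zv 3 \<in> \<Gamma> 3"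
  by (simp_all add: \<Gamma>_def B_Y_generators B_Y_closed del: lie.simps) (simp_all add: expand V_space_simps)

lemma quartic_in_\<Gamma>: "lie [yv 2, yv 1] * lie [yv 4, yv 3] \<in> \<Gamma> 4"
  by (simp add: \<Gamma>_def B_Y_generators B_Y_closed del: lie.simps) (simp add: expand V_space_simps)

text \<open>Commutators do not see the constant added by a shift. This invariance bounds
  \<open>\<Gamma> 1\<close> and \<open>\<Gamma> 2\<close> from above.\<close>

lemma sub_shift_B_Y: "p \<in> B_Y \<Longrightarrow> sub (shift r) p = p"
proof -
  let ?B = "{p. sub (shift r) p = p} :: 'a free_algebra set"
  have letter: "sub (shift r) (commutator p q) = commutator p q"
    if "sub (shift r) p = p" "q \<in> range yv \<union> range zv" for p q :: "'a free_algebra"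
    using that by (auto simp: free.eval_simps shift_simps) (simp add: commutator_def algebra_simps)
  have fold: "sub (shift r) (foldl commutator p vs) = foldl commutator p vs"
    if "sub (shift r) p = p" "set vs \<subseteq> range yv \<union> range zv" for p :: "'a free_algebra" and vs
    using that
  proof (induction vs arbitrary: p)
    case (Cons q vs)
    then show ?case using letter[of p q] by simp
  qed simp
  have "lie vs \<in> ?B" if len: "length vs \<ge> 2" and letters: "set vs \<subseteq> range yv \<union> range zv" for vs :: "'a free_algebra list"
  proof -
    obtain p q ws where vs: "vs = p # q # ws"
      using len by (auto simp: Suc_le_length_iff numeral_2_eq_2)
    have "sub (shift r) (commutator p q) = commutator p q"
      using letters unfolding vs
      by (auto simp: free.eval_simps shift_simps) (simp_all add: commutator_def algebra_simps)
    then show ?thesis using fold[of "commutator p q" ws] letters by (simp add: vs)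
  qed
  then have "range zv \<union> {lie vs |vs. length vs \<ge> 2 \<and> set vs \<subseteq> range yv \<union> range zv} \<subseteq> ?B"
    by (auto simp: free.eval_simps shift_simps)
  moreover have "free_subalgebra ?B"
    by (auto simp: free_subalgebra_def free.subspace_def free.eval_simps)
  ultimately have "B_Y \<subseteq> ?B"
    unfolding B_Y_def by (rule hull_minimal)
  then show "p \<in> B_Y \<Longrightarrow> sub (shift r) p = p" by blast
qed

lemma lookup_letter:
  "Poly_Mapping.lookup (yv i) (Word w) = (if w = [Y i] then 1 else 0)"
  "Poly_Mapping.lookup (zv i) (Word w) = (if w = [Z i] then 1 else 0)"
  by (auto simp: yv_def zv_def monomial_def lookup_single when_def)

lemma lookup_monomial: "Poly_Mapping.lookup (monomial ls) (Word w) = (if w = ls then 1 else 0)"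
  by (auto simp: monomial_def lookup_single when_def)

lemma V_space_2_expansion:
  assumes "p \<in> V_space 2"
  obtains c1 c2 c3 c4 c5 c6 c7 c8 where
    "p = fscale c1 (yv 1 * yv 2) + fscale c2 (yv 2 * yv 1) + fscale c3 (yv 1 * zv 2) + fscale c4 (zv 2 * yv 1)
      + fscale c5 (zv 1 * yv 2) + fscale c6 (yv 2 * zv 1) + fscale c7 (zv 1 * zv 2) + fscale c8 (zv 2 * zv 1)"
proof -
  let ?S = "{yv 1 * yv 2, yv 2 * yv 1, yv 1 * zv 2, zv 2 * yv 1, zv 1 * yv 2, yv 2 * zv 1, zv 1 * zv 2, zv 2 * zv 1}"
  have "monomial (map (\<lambda>i. v (\<sigma> i)) [1..<Suc 2]) \<in> ?S"
    if \<sigma>: "\<sigma> permutes {1..2}" and v: "\<forall>i. v i \<in> {Y i, Z i}" for v and \<sigma> :: "nat \<Rightarrow> nat"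
  proof -
    have "\<sigma> 1 \<in> {1..2}" "\<sigma> 2 \<in> {1..2}" "\<sigma> 1 \<noteq> \<sigma> 2"
      using permutes_in_image[OF \<sigma>, of 1] permutes_in_image[OF \<sigma>, of 2]
        inj_eq[OF permutes_inj[OF \<sigma>], of 1 2] by simp_all
    then have "\<sigma> 1 = 1 \<and> \<sigma> 2 = 2 \<or> \<sigma> 1 = 2 \<and> \<sigma> 2 = 1"
      unfolding atLeastAtMost_iff by linarith
    moreover have "map (\<lambda>i. v (\<sigma> i)) [1..<Suc 2] = [v (\<sigma> 1), v (\<sigma> 2)]"
      by (simp add: numeral_2_eq_2)
    moreover have "v 1 = Y 1 \<or> v 1 = Z 1" "v 2 = Y 2 \<or> v 2 = Z 2"
      using v by blast+
    ultimately show ?thesis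
      unfolding yv_def zv_def monomial_append[symmetric] append.simps
      by (elim disjE conjE) (simp_all only: insert_iff simp_thms)
  qed
  then have "p \<in> free_span ?S"
    using assms free.span_mono[of "{monomial (map (\<lambda>i. v (\<sigma> i)) [1..<Suc 2]) |v \<sigma>.
      \<sigma> permutes {1..2} \<and> (\<forall>i. v i \<in> {Y i, Z i})}" ?S]
    unfolding V_space_def by blast
  then obtain c1 c2 c3 c4 c5 c6 c7 c8 where
    "p - fscale c1 (yv 1 * yv 2) - fscale c2 (yv 2 * yv 1) - fscale c3 (yv 1 * zv 2) - fscale c4 (zv 2 * yv 1)
      - fscale c5 (zv 1 * yv 2) - fscale c6 (yv 2 * zv 1) - fscale c7 (zv 1 * zv 2) - fscale c8 (zv 2 * zv 1) = 0"
    unfolding free.span_breakdown_eq free.span_empty singleton_iff by blast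
  then show ?thesis
    unfolding diff_diff_eq right_minus_eq by (rule that)
qed

text \<open>Shift invariance forces the two monomials that contain \<open>y\<^sub>1\<close> or
  \<open>y\<^sub>2\<close> and the same other letter to form a commutator.\<close>

lemma \<Gamma>_2_expansion:
  assumes "p \<in> \<Gamma> 2"
  obtains c1 c2 c3 c4 c5 where
    "p = fscale c1 (lie [yv 2, yv 1]) + fscale c2 (lie [zv 2, yv 1]) + fscale c3 (lie [yv 2, zv 1])
      + fscale c4 (zv 1 \<odot> zv 2) + fscale c5 (lie [zv 2, zv 1])"
proof -
  obtain c1 c2 c3 c4 c5 c6 c7 c8 where
    p: "p = fscale c1 (yv 1 * yv 2) + fscale c2 (yv 2 * yv 1) + fscale c3 (yv 1 * zv 2) + fscale c4 (zv 2 * yv 1)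
      + fscale c5 (zv 1 * yv 2) + fscale c6 (yv 2 * zv 1) + fscale c7 (zv 1 * zv 2) + fscale c8 (zv 2 * zv 1)"
    using assms unfolding \<Gamma>_def by (blast elim: V_space_2_expansion)
  have shift: "sub (shift r) p = p" for r
    using assms by (simp add: \<Gamma>_def sub_shift_B_Y)
  have "fscale c1 (yv 2) + fscale c2 (yv 2) + fscale c3 (zv 2) + fscale c4 (zv 2) = 0"
    using shift[of 1] unfolding p by (simp add: free.eval_simps shift_simps free.scale_right_distrib distrib_left distrib_right)
  from arg_cong[OF this, of "\<lambda>p. Poly_Mapping.lookup p (Word [Y 2])"]
    arg_cong[OF this, of "\<lambda>p. Poly_Mapping.lookup p (Word [Z 2])"]
  have c: "c1 = - c2" "c3 = - c4"
    by (simp_all add: lookup_add lookup_letter eq_neg_iff_add_eq_0)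
  have "fscale c5 (zv 1) + fscale c6 (zv 1) + (fscale c1 (yv 1) + fscale c2 (yv 1)) = 0"
    using shift[of 2] unfolding p
    by (simp add: free.eval_simps shift_simps free.scale_right_distrib distrib_left distrib_right) (simp add: ac_simps)
  from arg_cong[OF this, of "\<lambda>p. Poly_Mapping.lookup p (Word [Z 1])"]
  have c': "c5 = - c6"
    by (simp add: lookup_add lookup_letter eq_neg_iff_add_eq_0)
  have combine: "fscale s (q + r) + fscale t (r - q) = fscale (s - t) q + fscale (s + t) r"
    for s t and q r :: "'a free_algebra"
    by (simp add: free.scale_left_distrib free.scale_right_distrib free.scale_left_diff_distrib
        free.scale_right_diff_distrib)
  have "(c7 + c8) / 2 - (c8 - c7) / 2 = c7" "(c7 + c8) / 2 + (c8 - c7) / 2 = c8"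
    by (simp_all add: field_simps)
  then have zz: "fscale c7 (zv 1 * zv 2) + fscale c8 (zv 2 * zv 1)
      = fscale ((c7 + c8) / 2) (zv 1 \<odot> zv 2) + fscale ((c8 - c7) / 2) (lie [zv 2, zv 1])"
    using combine[of "(c7 + c8) / 2" "zv 1 * zv 2" "zv 2 * zv 1" "(c8 - c7) / 2"]
    by (simp add: jordan_def commutator_def)
  have "p = fscale c2 (lie [yv 2, yv 1]) + fscale c4 (lie [zv 2, yv 1]) + fscale c6 (lie [yv 2, zv 1])
      + (fscale c7 (zv 1 * zv 2) + fscale c8 (zv 2 * zv 1))"
    by (simp add: p c c' commutator_def free.scale_right_diff_distrib)
  then show ?thesis
    unfolding zz add.assoc[symmetric] by (rule that)
qed

lemma \<Gamma>_1_expansion: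
  assumes "p \<in> \<Gamma> 1"
  obtains c where "p = fscale c (zv 1)"
proof -
  have "monomial (map (\<lambda>i. v (\<sigma> i)) [1..<Suc 1]) \<in> {yv 1, zv 1}"
    if \<sigma>: "\<sigma> permutes {1..1}" and v: "\<forall>i. v i \<in> {Y i, Z i}" for v and \<sigma> :: "nat \<Rightarrow> nat"
  proof -
    have "\<sigma> 1 = 1" using permutes_in_image[OF \<sigma>, of 1] by simp
    moreover have "v 1 = Y 1 \<or> v 1 = Z 1" using v by auto
    ultimately show ?thesis by (auto simp: yv_def zv_def)
  qed
  then have "p \<in> free_span {yv 1, zv 1}"
    using assms free.span_mono[of "{monomial (map (\<lambda>i. v (\<sigma> i)) [1..<Suc 1]) |v \<sigma>.
      \<sigma> permutes {1..1} \<and> (\<forall>i. v i \<in> {Y i, Z i})}" "{yv 1, zv 1}"]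
    unfolding V_space_def \<Gamma>_def by blast
  then obtain c d where "p - fscale c (yv 1) - fscale d (zv 1) = 0"
    unfolding free.span_breakdown_eq free.span_empty singleton_iff by blast
  then have p: "p = fscale c (yv 1) + fscale d (zv 1)"
    unfolding diff_diff_eq right_minus_eq .
  moreover have "sub (shift 1) p = p"
    using assms by (simp add: \<Gamma>_def sub_shift_B_Y)
  then have "fscale c 1 = 0"
    unfolding p by (simp add: free.eval_simps shift_simps free.scale_right_distrib)
  then have "c = 0" by (simp add: free.scale_eq_0_iff)
  ultimately show ?thesis by (intro that[of d]) simp
qed

section \<open>Submodules of the proper polynomials of degree two\<close>

text \<open>One switch for each irreducible component of \<open>\<Gamma> 2\<close>, so that
  membership of the generators and sums of components reduce to Boolean computations.\<close>

definition component_sum :: "bool \<Rightarrow> bool \<Rightarrow> bool \<Rightarrow> bool \<Rightarrow> 'k::field_char_0 free_algebra set" where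
  "component_sum a b c d = free_span
    ((if a then {lie [yv 2, yv 1]} else {}) \<union> (if b then {lie [zv 2, yv 1], lie [yv 2, zv 1]} else {})
      \<union> (if c then {zv 1 \<odot> zv 2} else {}) \<union> (if d then {lie [zv 2, zv 1]} else {}))"

lemma component_sum_generators:
  "a \<Longrightarrow> lie [yv 2, yv 1] \<in> component_sum a b c d" "b \<Longrightarrow> lie [zv 2, yv 1] \<in> component_sum a b c d"
  "b \<Longrightarrow> lie [yv 2, zv 1] \<in> component_sum a b c d" "c \<Longrightarrow> zv 1 \<odot> zv 2 \<in> component_sum a b c d"
  "d \<Longrightarrow> lie [zv 2, zv 1] \<in> component_sum a b c d"
  unfolding component_sum_def by (auto intro!: free.span_base simp del: lie.simps)

text \<open>Membership in a sum of components is refuted by a linear functional that vanishes on its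
  generators.\<close>

lemma component_sum_functional:
  assumes p: "p \<in> component_sum a b c d"
    and T: "\<And>p q. T (p + q) = T p + T q" "\<And>c p. T (fscale c p) = c * T p"
    and zero: "a \<Longrightarrow> T (lie [yv 2, yv 1]) = 0" "b \<Longrightarrow> T (lie [zv 2, yv 1]) = 0"
      "b \<Longrightarrow> T (lie [yv 2, zv 1]) = 0" "c \<Longrightarrow> T (zv 1 \<odot> zv 2) = 0" "d \<Longrightarrow> T (lie [zv 2, zv 1]) = 0"
  shows "T p = (0 :: 'k::field_char_0)"
  using p unfolding component_sum_def
proof (rule free.span_induct)
  have "T 0 = 0" using T(2)[of 0 0] by simp
  then show "free_subspace {p. T p = 0}"
    by (simp add: free.subspace_def T)
qed (use zero in \<open>auto split: if_splits simp del: lie.simps\<close>)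

lemma lookup_quadratic:
  "Poly_Mapping.lookup (lie [yv i, yv j]) (Word w) = (if w = [Y i, Y j] then 1 else 0) - (if w = [Y j, Y i] then 1 else 0)"
  "Poly_Mapping.lookup (lie [zv i, yv j]) (Word w) = (if w = [Z i, Y j] then 1 else 0) - (if w = [Y j, Z i] then 1 else 0)"
  "Poly_Mapping.lookup (lie [yv i, zv j]) (Word w) = (if w = [Y i, Z j] then 1 else 0) - (if w = [Z j, Y i] then 1 else 0)"
  "Poly_Mapping.lookup (lie [zv i, zv j]) (Word w) = (if w = [Z i, Z j] then 1 else 0) - (if w = [Z j, Z i] then 1 else 0)"
  "Poly_Mapping.lookup (zv i \<odot> zv j) (Word w) = (if w = [Z i, Z j] then 1 else 0) + (if w = [Z j, Z i] then 1 else 0)"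
  by (simp_all add: commutator_def jordan_def yv_def zv_def monomial_append[symmetric] lookup_minus lookup_add lookup_monomial)

lemma component_sum_iff:
  "lie [yv 2, yv 1] \<in> component_sum a b c d \<longleftrightarrow> a"
  "lie [zv 2, yv 1] \<in> component_sum a b c d \<longleftrightarrow> b"
  "zv 1 \<odot> zv 2 \<in> component_sum a b c d \<longleftrightarrow> c"
  "lie [zv 2, zv 1] \<in> component_sum a b c d \<longleftrightarrow> d"
proof -
  note functional = component_sum_functional[of _ a b c d]
  let ?l = "\<lambda>p w. Poly_Mapping.lookup p (Word w)"
  have "\<not> a \<Longrightarrow> lie [yv 2, yv 1] \<notin> component_sum a b c d"
    using functional[of "lie [yv 2, yv 1]" "\<lambda>p. ?l p [Y 2, Y 1]"]
    by (auto simp: lookup_add lookup_quadratic simp del: lie.simps)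
  then show "lie [yv 2, yv 1] \<in> component_sum a b c d \<longleftrightarrow> a"
    using component_sum_generators(1) by blast
  have "\<not> b \<Longrightarrow> lie [zv 2, yv 1] \<notin> component_sum a b c d"
    using functional[of "lie [zv 2, yv 1]" "\<lambda>p. ?l p [Z 2, Y 1]"]
    by (auto simp: lookup_add lookup_quadratic simp del: lie.simps)
  then show "lie [zv 2, yv 1] \<in> component_sum a b c d \<longleftrightarrow> b"
    using component_sum_generators(2) by blast
  have "\<not> c \<Longrightarrow> zv 1 \<odot> zv 2 \<notin> component_sum a b c d"
    using functional[of "zv 1 \<odot> zv 2" "\<lambda>p. ?l p [Z 1, Z 2] + ?l p [Z 2, Z 1]"]
    by (auto simp: lookup_add lookup_quadratic distrib_left simp del: lie.simps)
  then show "zv 1 \<odot> zv 2 \<in> component_sum a b c d \<longleftrightarrow> c"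
    using component_sum_generators(4) by blast
  have "\<not> d \<Longrightarrow> lie [zv 2, zv 1] \<notin> component_sum a b c d"
    using functional[of "lie [zv 2, zv 1]" "\<lambda>p. ?l p [Z 2, Z 1] - ?l p [Z 1, Z 2]"]
    by (auto simp: lookup_add lookup_quadratic right_diff_distrib simp del: lie.simps)
  then show "lie [zv 2, zv 1] \<in> component_sum a b c d \<longleftrightarrow> d"
    using component_sum_generators(5) by blast
qed

text \<open>The four characters of the sign changes \<open>z\<^sub>1 \<mapsto> - z\<^sub>1\<close>
  and \<open>z\<^sub>2 \<mapsto> - z\<^sub>2\<close> separate all summands of an element of
  \<open>\<Gamma> 2\<close> except for the symmetric and the alternating product of
  \<open>z\<^sub>1\<close> and \<open>z\<^sub>2\<close>, which are separated by exchanging the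
  indices.\<close>

lemma hyp_submodule_2_eq:
  assumes M: "hyp_submodule 2 M"
  shows "M = component_sum (lie [yv 2, yv 1] \<in> M) (lie [zv 2, yv 1] \<in> M) (zv 1 \<odot> zv 2 \<in> M) (lie [zv 2, zv 1] \<in> M)"
proof
  have subspace: "free_subspace M" and "M \<subseteq> \<Gamma> 2"
    using M by (auto simp: hyp_submodule_def)
  note closed = free.subspace_add[OF subspace] free.subspace_diff[OF subspace]
    free.subspace_neg[OF subspace] free.subspace_scale[OF subspace]
  have act: "hyp_act (a, \<sigma>) p \<in> M" if "p \<in> M" "(a, \<sigma>) \<in> hyperoctahedral 2" for a \<sigma> p
    using M that by (auto simp: hyp_submodule_def)
  have halve: "fscale c q \<in> M \<Longrightarrow> c \<noteq> 0 \<Longrightarrow> q \<in> M" for c q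
    using closed(4)[of "fscale c q" "inverse c"] by simp
  let ?sign = "\<lambda>j i. if i = j then - 1 else (1 :: 'a)"
  let ?swap = "\<lambda>i :: nat. if i = 1 then 2 else if i = 2 then 1 else i"
  have sign: "hyp_act (?sign j, id) p \<in> M" if "p \<in> M" "j \<in> {1, 2}" for j p
    using that by (intro act) (auto simp: hyperoctahedral_def permutes_id)
  have "?swap permutes {1..2}"
    by (rule bij_imp_permutes)
      (auto simp: bij_betw_def inj_on_def image_def numeral_2_eq_2 Bex_def split: if_splits)
  then have swap: "hyp_act (\<lambda>_. 1, ?swap) p \<in> M" if "p \<in> M" for p
    using that by (intro act) (auto simp: hyperoctahedral_def)
  note hyp_act_simps = hyp_act_def free.eval_simps
  have mixed: "lie [yv 2, zv 1] \<in> M \<longleftrightarrow> lie [zv 2, yv 1] \<in> M"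
  proof -
    have act: "hyp_act (\<lambda>_. 1, ?swap) (lie [zv 2, yv 1]) = - lie [yv 2, zv 1]"
      "hyp_act (\<lambda>_. 1, ?swap) (lie [yv 2, zv 1]) = - lie [zv 2, yv 1]"
      by (simp_all add: hyp_act_simps) (simp_all add: commutator_def)
    have "- lie [yv 2, zv 1] \<in> M" if "lie [zv 2, yv 1] \<in> M"
      using swap[OF that] by (simp only: act)
    moreover have "- lie [zv 2, yv 1] \<in> M" if "lie [yv 2, zv 1] \<in> M"
      using swap[OF that] by (simp only: act)
    ultimately show ?thesis
      using closed(3)[of "- lie [yv 2, zv 1]"] closed(3)[of "- lie [zv 2, yv 1]"]
      by (auto simp del: lie.simps)
  qed
  let ?C = "component_sum (lie [yv 2, yv 1] \<in> M) (lie [zv 2, yv 1] \<in> M) (zv 1 \<odot> zv 2 \<in> M) (lie [zv 2, zv 1] \<in> M)"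
  show "?C \<subseteq> M"
    unfolding component_sum_def using mixed subspace
    by (intro free.span_minimal) (auto simp del: lie.simps)
  show "M \<subseteq> ?C"
  proof
    fix p
    assume p: "p \<in> M"
    obtain c1 c2 c3 c4 c5 where
      expansion: "p = fscale c1 (lie [yv 2, yv 1]) + fscale c2 (lie [zv 2, yv 1]) + fscale c3 (lie [yv 2, zv 1])
        + fscale c4 (zv 1 \<odot> zv 2) + fscale c5 (lie [zv 2, zv 1])"
      using p \<open>M \<subseteq> \<Gamma> 2\<close> by (blast elim: \<Gamma>_2_expansion)
    define q1 q2 q3 q4 q5 where "q1 = fscale c1 (lie [yv 2, yv 1])" and "q2 = fscale c2 (lie [zv 2, yv 1])"
      and "q3 = fscale c3 (lie [yv 2, zv 1])" and "q4 = fscale c4 (zv 1 \<odot> zv 2)" and "q5 = fscale c5 (lie [zv 2, zv 1])"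
    note q_defs = q1_def q2_def q3_def q4_def q5_def
    have p_eq: "p = q1 + q2 + q3 + q4 + q5"
      by (simp add: expansion q_defs del: lie.simps)
    define A1 A2 where "A1 = hyp_act (?sign 1, id)" and "A2 = hyp_act (?sign 2, id)"
    have A_add: "A1 (x + y) = A1 x + A1 y" "A2 (x + y) = A2 x + A2 y"
      and A_diff: "A1 (x - y) = A1 x - A1 y" "A2 (x - y) = A2 x - A2 y"
      and A_minus: "A1 (- x) = - A1 x" "A2 (- x) = - A2 x" for x y
      by (simp_all add: A1_def A2_def hyp_act_simps)
    have A1_q: "A1 q1 = q1" "A1 q2 = q2" "A1 q3 = - q3" "A1 q4 = - q4" "A1 q5 = - q5"
      by (simp_all add: A1_def A2_def q_defs hyp_act_simps)
        (simp_all add: jordan_def commutator_def free.scale_right_diff_distrib free.scale_right_distrib)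
    have A2_q: "A2 q1 = q1" "A2 q2 = - q2" "A2 q3 = q3" "A2 q4 = - q4" "A2 q5 = - q5"
      by (simp_all add: A1_def A2_def q_defs hyp_act_simps)
        (simp_all add: jordan_def commutator_def free.scale_right_diff_distrib free.scale_right_distrib)
    have p1: "A1 p \<in> M" and p2: "A2 p \<in> M" and p12: "A1 (A2 p) \<in> M"
      unfolding A1_def A2_def using p sign by simp_all
    have four: "fscale 4 x = x + x + x + x" for x :: "'a free_algebra"
      using free.scale_left_distrib[of 2 2 x] by (simp add: fscale_two)
    \<comment> \<open>Projections to the four characters of the group of sign changes.\<close>
    have "fscale 4 q1 = p + A1 p + A2 p + A1 (A2 p)" "fscale 4 q2 = p + A1 p - A2 p - A1 (A2 p)"
      "fscale 4 q3 = p - A1 p + A2 p - A1 (A2 p)" "fscale 4 (q4 + q5) = p - A1 p - A2 p + A1 (A2 p)"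
      unfolding four p_eq by (simp_all add: A_add A_diff A1_q A2_q A_minus algebra_simps)
    then have "fscale 4 q1 \<in> M" "fscale 4 q2 \<in> M" "fscale 4 q3 \<in> M" "fscale 4 (q4 + q5) \<in> M"
      using p p1 p2 p12 by (simp_all add: closed)
    then have q: "q1 \<in> M" "q2 \<in> M" "q3 \<in> M" "q4 + q5 \<in> M"
      using halve[of 4] by auto
    have "hyp_act (\<lambda>_. 1, ?swap) (q4 + q5) = q4 - q5"
      by (simp add: q_defs hyp_act_simps)
        (simp add: jordan_def commutator_def free.scale_right_diff_distrib free.scale_right_distrib add.commute)
    then have "q4 - q5 \<in> M"
      using swap[OF q(4)] by simp
    then have "fscale 2 q4 \<in> M" "fscale 2 q5 \<in> M"
      using closed(1)[OF q(4), of "q4 - q5"] closed(2)[OF q(4), of "q4 - q5"] by (simp_all add: fscale_two)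
    then have q': "q4 \<in> M" "q5 \<in> M"
      using halve[of 2] by auto
    have C: "fscale c g \<in> ?C" if "fscale c g \<in> M" "g \<in> M \<Longrightarrow> g \<in> ?C" for c g
      using that halve[OF that(1)] unfolding component_sum_def
      by (cases "c = 0") (auto intro: free.span_scale free.span_zero simp del: lie.simps)
    have "q1 \<in> ?C"
      unfolding q1_def by (rule C[OF q(1)[unfolded q1_def] component_sum_generators(1)])
    moreover have "q2 \<in> ?C"
      unfolding q2_def by (rule C[OF q(2)[unfolded q2_def] component_sum_generators(2)])
    moreover have "q3 \<in> ?C"
      unfolding q3_def
      by (rule C[OF q(3)[unfolded q3_def] component_sum_generators(3)]) (simp only: mixed)
    moreover have "q4 \<in> ?C"
      unfolding q4_def by (rule C[OF q'(1)[unfolded q4_def] component_sum_generators(4)])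
    moreover have "q5 \<in> ?C"
      unfolding q5_def by (rule C[OF q'(2)[unfolded q5_def] component_sum_generators(5)])
    ultimately show "p \<in> ?C"
      unfolding p_eq component_sum_def by (intro free.span_add)
  qed
qed

lemma span_plus: "free_span A + free_span B = free_span (A \<union> B)"
  by (auto simp: free.span_Un set_plus_def)

lemma component_sum_eqs:
  "V_11_0 = component_sum True False False False"
  "V_1_1 + V_11_0 = component_sum True True False False"
  "V_0_2 + V_11_0 = component_sum True False True False"
  "V_0_11 + V_11_0 = component_sum True False False True"
  "V_1_1 + V_0_11 + V_11_0 = component_sum True True False True"
  "V_1_1 + V_0_2 + V_11_0 = component_sum True True True False"
  "V_0_2 + V_0_11 + V_11_0 = component_sum True False True True"
  "{0} = component_sum False False False False"
  "V_1_1 = component_sum False True False False"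
  "V_0_2 = component_sum False False True False"
  "V_0_11 = component_sum False False False True"
  "V_0_2 + V_0_11 = component_sum False False True True"
  "V_1_1 + V_0_11 = component_sum False True False True"
  "V_1_1 + V_0_2 = component_sum False True True False"
  "V_1_1 + V_0_2 + V_0_11 = component_sum False True True True"
  by (simp_all add: V_11_0_def V_1_1_def V_0_2_def V_0_11_def component_sum_def span_plus
      Un_ac insert_commute del: lie.simps)

lemma \<Gamma>_2_eq: "(\<Gamma> 2 :: 'a::field_char_0 free_algebra set) = component_sum True True True True"
proof
  show "(\<Gamma> 2 :: 'a free_algebra set) \<subseteq> component_sum True True True True"
  proof
    fix p :: "'a free_algebra"
    assume "p \<in> \<Gamma> 2"
    then obtain c1 c2 c3 c4 c5 where
      p: "p = fscale c1 (lie [yv 2, yv 1]) + fscale c2 (lie [zv 2, yv 1]) + fscale c3 (lie [yv 2, zv 1])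
        + fscale c4 (zv 1 \<odot> zv 2) + fscale c5 (lie [zv 2, zv 1])"
      by (rule \<Gamma>_2_expansion)
    show "p \<in> component_sum True True True True"
      unfolding p component_sum_def
      by (intro free.span_add free.span_scale component_sum_generators[OF TrueI, unfolded component_sum_def])
  qed
  have "free_subspace (\<Gamma> 2 :: 'a free_algebra set)"
    using free_subalgebra_B_Y unfolding \<Gamma>_def V_space_def free_subalgebra_def
    by (intro free.subspace_inter) auto
  then show "component_sum True True True True \<subseteq> (\<Gamma> 2 :: 'a free_algebra set)"
    unfolding component_sum_def using quadratic_in_\<Gamma>
    by (intro free.span_minimal) (auto simp del: lie.simps)
qed

section \<open>Identities of small degree\<close>

context
  fixes kind :: phi_kind and I K :: "'k::field_char_0 free_algebra set"
  assumes I: "T_ideal kind I" "1 \<notin> I" and K: "T_ideal kind K"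
begin

lemma degree_zero_identity:
  assumes g: "g \<in> I" "total_degree g \<le> 0"
  shows "g \<in> K"
proof (rule T_ideal_subset_of_proper[OF I(1) g T_ideal_zero[OF K] T_ideal_add[OF K] T_ideal_mult_left[OF K]])
  fix n q
  assume q: "proper n 0 q" "q \<in> I"
  have "q \<in> free_span {1}"
    using proper_in_span_atoms[OF q(1)] by (simp add: atoms_def)
  then obtain c where "q = fscale c 1"
    unfolding free.span_breakdown_eq free.span_empty singleton_iff right_minus_eq by blast
  then show "q \<in> K"
    using T_ideal_fscale_iff[OF I(1), of c 1] q(2) I(2) T_ideal_zero[OF K] by (cases "c = 0") auto
qed

lemma degree_one_identity:
  assumes g: "g \<in> I" "total_degree g \<le> 1" and z: "zv 1 \<in> I \<Longrightarrow> zv 1 \<in> K"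
  shows "g \<in> K"
proof (rule T_ideal_subset_of_proper[OF I(1) g T_ideal_zero[OF K] T_ideal_add[OF K] T_ideal_mult_left[OF K]])
  fix n q
  assume q: "proper n 1 q" "q \<in> I"
  obtain c a where q_eq: "q = low_form {..<n} {..<n} c a (\<lambda>_ _. 0) (\<lambda>_ _. 0) (\<lambda>_ _. 0)"
    using linear_form_of_span[OF proper_in_span_atoms[OF q(1)]] by auto
  note components = low_form_components[OF I finite_lessThan finite_lessThan q(2)[unfolded q_eq]]
  have "fscale (a i) (zv i) \<in> K" if "i < n" for i
  proof (cases "a i = 0")
    case False
    then have "zv i \<in> I"
      using components(2)[of i] that T_ideal_fscale_iff[OF I(1), of "a i" "zv i"] by simp
    then have "zv i \<in> K"
      using z zv_in_T_ideal_iff[OF I(1), of i] zv_in_T_ideal_iff[OF K, of i] by blast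
    then show ?thesis by (rule T_ideal_fscale[OF K])
  qed (simp add: T_ideal_zero[OF K])
  then have "(\<Sum>i\<in>{..<n}. fscale (a i) (zv i)) \<in> K"
    by (intro T_ideal_sum[OF K]) simp
  then show "q \<in> K"
    unfolding q_eq components(1) by (simp add: low_form_def)
qed

lemma degree_two_identity:
  assumes g: "g \<in> I" "total_degree g \<le> 2" and transfer: "atoms_transfer I K"
  shows "g \<in> K"
proof (rule T_ideal_subset_of_proper[OF I(1) g T_ideal_zero[OF K] T_ideal_add[OF K] T_ideal_mult_left[OF K]])
  fix n q
  assume q: "proper n 2 q" "q \<in> I"
  obtain c a b d e where "q = low_form {..<n} {..<n} c a b d e"
    using low_form_of_span[OF proper_in_span_atoms[OF q(1)]] by auto
  then show "q \<in> K"
    using low_form_transfer[OF I K transfer, of "{..<n}" "{..<n}" c a b d e] q(2) by simp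
qed

end

text \<open>After all \<open>z\<close>'s are set to zero, which changes nothing in the model, a
  proper polynomial of degree at most three is a combination of \<open>1\<close>, commutators
  \<open>[y\<^sub>i,y\<^sub>j]\<close> and elements of the T-ideal of common identities, where
  \<open>[y\<^sub>i,y\<^sub>j,y\<^sub>k]\<close> lies. A product of two commutators has degree four
  and cannot occur.\<close>

lemma degree_three_identity:
  fixes I :: "'k::field_char_0 free_algebra set"
  assumes I: "T_ideal Automorphism I" "1 \<notin> I" and yy: "lie [yv 2, yv 1] \<notin> I"
    and yyy: "lie [yv 3, yv 2, yv 1] \<in> I" and g: "g \<in> I" "total_degree g \<le> 3"
  shows "g \<in> exterior_id_model"
proof -
  let ?E = "exterior_id_model :: 'k free_algebra set"
  let ?N = "I \<inter> ?E"
  let ?\<zeta> = "sub (keep UNIV {}) :: 'k free_algebra \<Rightarrow> _"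
  define B :: "nat \<Rightarrow> nat \<Rightarrow> 'k free_algebra set" where
    "B n d = insert 1 (if 2 \<le> d then {commutator (yv i) (yv j) |i j. i < n \<and> j < n} else {})" for n d
  note E = exterior_id_model(1)[where ?'k = 'k]
  have N: "T_ideal Automorphism ?N"
    by (rule T_ideal_Int[OF I(1) E])
  have triple: "commutator (commutator (yv i) (yv j)) (yv k) \<in> ?N" for i j k
  proof -
    define f where "f = (\<lambda>m :: nat. if m = 3 then i else if m = 2 then j else k)"
    have "lie [yv 3, yv 2, yv 1] \<in> ?N"
      using yyy exterior_id_model(3) by blast
    from T_ideal_rename[OF N this, of f f] show ?thesis
      by (simp only: lie.simps foldl.simps sub_rename letter.case) (simp add: f_def)
  qed
  have letters: "keep UNIV {} (Y i) = yv i" "keep UNIV {} (Z i) = (0 :: 'k free_algebra)" for i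
    by (simp_all add: keep_def)
  have zero: "0 \<in> free_span S" for S :: "'k free_algebra set"
    by (rule free.span_zero)
  have span: "?\<zeta> p \<in> free_span (B n d \<union> ?N)" if "proper n d p" "d \<le> 3" for n d p
    using that
  proof (induction rule: proper.induct)
    case (const d c)
    have "fscale c 1 \<in> free_span (B n d \<union> ?N)"
      by (intro free.span_scale free.span_base) (simp add: B_def)
    then show ?case by (simp add: free.eval_simps)
  next
    case (zv i d)
    show ?case by (simp add: free.eval_simps letters zero)
  next
    case (yv_yv i j d)
    then have "commutator (yv i) (yv j) \<in> B n d"
      unfolding B_def by auto
    then show ?case by (simp add: free.eval_simps letters free.span_base)
  next
    case (bracket d p i)
    have "commutator a (yv i) \<in> free_span (B n (Suc d) \<union> ?N)" if a: "a \<in> B n d \<union> ?N" for a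
    proof -
      consider "a = 1" | j k where "a = commutator (yv j) (yv k)" | "a \<in> ?N"
        using a unfolding B_def by (auto split: if_splits)
      then show ?thesis
      proof cases
        case 1
        then show ?thesis by (simp add: commutator_def zero)
      next
        case (2 j k)
        show ?thesis unfolding 2 by (intro free.span_base UnI2 triple)
      next
        case 3
        then have "commutator a (yv i) \<in> ?N"
          unfolding commutator_def
          by (intro T_ideal_diff[OF N] T_ideal_mult_left[OF N] T_ideal_mult_right[OF N])
        then show ?thesis by (intro free.span_base UnI2)
      qed
    qed
    from span_commutator_yv[OF bracket.IH this] bracket.prems show ?case
      by (simp add: free.eval_simps letters)
  next
    case (add d p q)
    then show ?case by (simp add: free.eval_add free.span_add)
  next
    case (mult d p e q)
    have "a * b \<in> free_span (B n (d + e) \<union> ?N)" if ab: "a \<in> B n d \<union> ?N" "b \<in> B n e \<union> ?N" for a b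
    proof -
      have mono: "B n d \<subseteq> B n (d + e)" "B n e \<subseteq> B n (d + e)"
        by (auto simp: B_def)
      \<comment> \<open>Two commutators would need degree \<open>d + e \<ge> 4\<close>.\<close>
      consider "a \<in> ?N" | "b \<in> ?N" | "a = 1" | "b = 1"
        using ab mult.prems unfolding B_def by (auto split: if_splits)
      then have "a * b \<in> B n (d + e) \<union> ?N"
      proof cases
        case 1
        then show ?thesis by (intro UnI2 T_ideal_mult_right[OF N])
      next
        case 2
        then show ?thesis by (intro UnI2 T_ideal_mult_left[OF N])
      next
        case 3
        then show ?thesis using ab mono by auto
      next
        case 4
        then show ?thesis using ab mono by auto
      qed
      then show ?thesis by (rule free.span_base)
    qed
    from span_mult[OF mult.IH this] mult.prems show ?case
      by (simp add: free.eval_mult)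
  qed
  show ?thesis
  proof (rule T_ideal_subset_of_proper[OF I(1) g T_ideal_zero[OF E] T_ideal_add[OF E] T_ideal_mult_left[OF E]])
    fix n q
    assume q: "proper n 3 q" "q \<in> I"
    have "free_subspace ?N"
      by (intro free.subspaceI T_ideal_zero[OF N] T_ideal_add[OF N] T_ideal_fscale[OF N])
    then have "free_span ?N = ?N"
      by (rule free.span_eq_iff[THEN iffD2])
    with span[OF q(1) order_refl] obtain r j where r: "r \<in> free_span (B n 3)" "j \<in> ?N" "?\<zeta> q = r + j"
      unfolding free.span_Un by blast
    have "r \<in> I"
      using T_ideal_diff[OF I(1) T_ideal_sub[OF I(1) admissible_keep q(2), of UNIV "{}"], of j] r(2,3) by simp
    have "B n 3 \<subseteq> atoms n 2"
      unfolding B_def atoms_two quadratic_atoms_def by auto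
    then obtain c a b d e where "r = low_form {..<n} {..<n} c a b d e"
      using low_form_of_span[OF subsetD[OF free.span_mono r(1)]] by blast
    moreover have "atoms_transfer I ?E"
      using yy exterior_id_model(2)[where ?'k = 'k]
      unfolding atoms_transfer_def lie.simps foldl.simps commutator_def jordan_def
      by (simp add: T_ideal_add[OF E] T_ideal_diff[OF E] T_ideal_mult_left[OF E] T_ideal_mult_right[OF E])
    ultimately have "r \<in> ?E"
      using low_form_transfer[OF I E, of "{..<n}" "{..<n}" c a b d e] \<open>r \<in> I\<close> by simp
    then have "?\<zeta> q \<in> ?E"
      unfolding r(3) using r(2) by (intro T_ideal_add[OF E]) auto
    from T_ideal_add[OF E exterior_id_model(4)[where p = q] this] show "q \<in> ?E" by simp
  qed
qed

section \<open>Consequences of a multilinear polynomial\<close>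

definition specialize :: "nat set \<Rightarrow> nat set \<Rightarrow> letter \<Rightarrow> 'k::field_char_0 free_algebra" where
  "specialize Q P l = (case l of Y i \<Rightarrow> if i \<in> Q then 1 else yv i | Z i \<Rightarrow> if i \<in> P then 0 else zv i)"

lemma admissible_specialize: "admissible_valuation (free_phi kind) (specialize Q P)"
  by (simp add: admissible_valuation_def specialize_def free_phi_yv free_phi_zv free_phi_one free_phi_zero)

lemma commutator_one: "commutator 1 a = 0" "commutator a 1 = 0" for a :: "'a::ring_1"
  by (simp_all add: commutator_def)

lemmas sub_simps = free.eval_simps keep_def specialize_def commutator_zero commutator_one

text \<open>No two summands of \<open>f_\<Gamma>3\<close> assign the same sorts to the indices 1, 2,
  3, so each one survives alone when the other variables are set to zero.\<close>

lemma cubic_of_f_\<Gamma>3: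
  assumes J: "T_ideal kind J" and f: "f_\<Gamma>3 \<in> J" and "lie [yv 2, yv 1] * lie [yv 4, yv 3] \<in> J"
  shows "cubic_T_ideal kind J"
proof
  note keep = T_ideal_sub[OF J admissible_keep f]
  show "lie [yv 3, yv 2, yv 1] \<in> J"
    using keep[of "{1, 2, 3}" "{}"] by (simp add: f_\<Gamma>3_def sub_simps)
  show "lie [yv 3, zv 2, yv 1] \<in> J"
    using keep[of "{1, 3}" "{2}"] by (simp add: f_\<Gamma>3_def sub_simps)
  show "zv 3 * lie [yv 2, yv 1] \<in> J"
    using keep[of "{1, 2}" "{3}"] by (simp add: f_\<Gamma>3_def sub_simps)
  show "lie [yv 3, zv 2, zv 1] \<in> J"
    using keep[of "{3}" "{1, 2}"] by (simp add: f_\<Gamma>3_def sub_simps)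
  show "zv 3 * lie [zv 2, yv 1] \<in> J"
    using keep[of "{1}" "{2, 3}"] by (simp add: f_\<Gamma>3_def sub_simps)
  show "zv 1 * zv 2 * zv 3 \<in> J"
    using keep[of "{}" "{1, 2, 3}"] by (simp add: f_\<Gamma>3_def sub_simps)
qed (use assms in auto)

lemma admissible_case_letter:
  assumes "\<And>i. free_phi kind (f i) = f i" "\<And>i. free_phi kind (g i) = - g i"
  shows "admissible_valuation (free_phi kind) (case_letter f g)"
  using assms by (simp add: admissible_valuation_def)

lemmas phi_simps = free_phi_mult free_phi_add free.phi_diff free_phi_uminus free_phi_yv free_phi_zv

text \<open>For an antiautomorphism \<open>[y\<^sub>2,y\<^sub>1]\<close> is skew, so it may replace
  a \<open>z\<close>.\<close>

lemma commutator_product_of_skew: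
  assumes J: "T_ideal Antiautomorphism J" and "zv 3 * lie [yv 2, yv 1] \<in> J"
  shows "lie [yv 2, yv 1] * lie [yv 4, yv 3] \<in> J"
proof -
  have "admissible_valuation (free_phi Antiautomorphism)
      (case_letter (\<lambda>i. if i = 2 then yv 4 else yv 3) (\<lambda>_. commutator (yv 2) (yv 1)))"
    by (rule admissible_case_letter) (simp_all add: commutator_def phi_simps)
  from T_ideal_sub[OF J this assms(2)] show ?thesis
    by (simp add: free.eval_simps)
qed

text \<open>Read with \<open>q\<close> a polynomial in the variables with index at most two. The
  product \<open>z\<^sub>1 z\<^sub>2\<close> as component serves for both \<open>z\<^sub>1 \<odot>
  z\<^sub>2\<close> and \<open>[z\<^sub>2,z\<^sub>1]\<close>.\<close>

lemma atoms_transferI: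
  assumes J: "T_ideal kind J" and q: "q \<in> J" and z: "zv 1 \<notin> I"
    and "lie [yv 2, yv 1] \<in> I \<Longrightarrow> sub (keep {1, 2} {}) q = lie [yv 2, yv 1]"
    and "lie [zv 2, yv 1] \<in> I \<Longrightarrow> sub (keep {1} {2}) q = lie [zv 2, yv 1]"
    and "zv 1 \<odot> zv 2 \<in> I \<Longrightarrow> sub (keep {} {1, 2}) q \<in> {zv 2 \<odot> zv 1, zv 1 * zv 2}"
    and "lie [zv 2, zv 1] \<in> I \<Longrightarrow> sub (keep {} {1, 2}) q \<in> {lie [zv 2, zv 1], zv 1 * zv 2}"
  shows "atoms_transfer I J"
proof -
  note keep = T_ideal_sub[OF J admissible_keep q]
  have "zv 2 * zv 1 \<in> J" if "zv 1 * zv 2 \<in> J"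
    using T_ideal_rename[OF J that, of id "\<lambda>i. if i = 1 then 2 else 1"] by (simp add: sub_rename)
  then have product: "zv 1 \<odot> zv 2 \<in> J \<and> lie [zv 2, zv 1] \<in> J" if "zv 1 * zv 2 \<in> J"
    using that by (simp add: jordan_def commutator_def T_ideal_add[OF J] T_ideal_diff[OF J])
  have comm: "zv 2 \<odot> zv 1 = zv 1 \<odot> (zv 2 :: 'a free_algebra)"
    by (simp add: jordan_def add.commute)
  show ?thesis
    unfolding atoms_transfer_def ball_simps
    using z assms(4-) keep[of "{1, 2}" "{}"] keep[of "{1}" "{2}"] keep[of "{}" "{1, 2}"] product comm
    by (metis empty_iff insert_iff)
qed

lemma cubic_of_degree_two:
  assumes J: "T_ideal kind J" and J2: "lie [yv 2, yv 1] \<in> J" "lie [zv 2, yv 1] \<in> J" "zv 1 * zv 2 \<in> J"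
  shows "cubic_T_ideal kind J"
proof
  have zy: "commutator (zv i) (yv j) \<in> J" for i j
    using J2(2) commutator_zv_yv_in_T_ideal_iff[OF J] by blast
  have "commutator (yv i) (zv j) \<in> J" for i j
    using T_ideal_uminus[OF J zy[of j i]] by (simp add: commutator_def)
  moreover have "commutator (yv i) (yv j) \<in> J" if "i \<noteq> j" for i j
    using J2(1) commutator_yv_yv_in_T_ideal_iff[OF J that] by blast
  moreover have "commutator p q \<in> J" if "p \<in> J" for p q
    using that unfolding commutator_def by (intro T_ideal_diff[OF J] T_ideal_mult_left[OF J] T_ideal_mult_right[OF J])
  moreover note zy
  ultimately show "lie [yv 3, yv 2, yv 1] \<in> J" "lie [yv 3, zv 2, yv 1] \<in> J" "zv 3 * lie [yv 2, yv 1] \<in> J"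
    "lie [yv 3, zv 2, zv 1] \<in> J" "zv 3 * lie [zv 2, yv 1] \<in> J" "zv 1 * zv 2 * zv 3 \<in> J"
    "lie [yv 2, yv 1] * lie [yv 4, yv 3] \<in> J"
    using J2(3) by (simp_all add: T_ideal_mult_left[OF J] T_ideal_mult_right[OF J])
qed (rule J)

text \<open>Here the skew elements are closed under commutators and under \<open>\<odot>\<close>
  with symmetric elements. The former gives \<open>z\<^sub>1 z\<^sub>2 z\<^sub>3\<close>: modulo
  \<open>J\<close>, \<open>z\<^sub>1 z\<^sub>2\<close> is half of a commutator and so anticommutes
  with \<open>z\<^sub>3\<close>, while moving \<open>z\<^sub>3\<close> past both factors shows that
  it commutes. The latter gives \<open>z\<^sub>3[y\<^sub>2,y\<^sub>1]\<close>, since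
  \<open>z\<^sub>3 \<odot> y\<^sub>2\<close> commutes with \<open>y\<^sub>1\<close>.\<close>

lemma cubic_of_skew_mult:
  assumes J: "T_ideal Antiautomorphism J" and J2: "lie [zv 2, yv 1] \<in> J" "zv 1 \<odot> zv 2 \<in> J"
  shows "cubic_T_ideal Antiautomorphism J"
proof
  note closed = T_ideal_add[OF J] T_ideal_diff[OF J] T_ideal_uminus[OF J] T_ideal_fscale[OF J]
    T_ideal_mult_left[OF J] T_ideal_mult_right[OF J]
  let ?\<phi> = "free_phi Antiautomorphism"
  have central: "commutator x a \<in> J" if "?\<phi> x = - x" "?\<phi> a = a" for x a
    using T_ideal_sub[OF J admissible_case_letter J2(1), of "\<lambda>_. a" "\<lambda>_. x"] that
    by (simp add: free.eval_simps)
  have anticommute: "x \<odot> w \<in> J" if "?\<phi> x = - x" "?\<phi> w = - w" for x w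
    using T_ideal_sub[OF J admissible_case_letter J2(2), of yv "\<lambda>i. if i = 1 then x else w"] that
    by (simp add: free.eval_simps free_phi_yv)
  have halve: "p \<in> J" if "p + p \<in> J" for p
    using that T_ideal_fscale_iff[OF J, of 2 p] by (simp add: fscale_two)
  have bracket: "commutator p q \<in> J" if "p \<in> J" for p q
    using that unfolding commutator_def by (intro closed)
  have yz: "commutator (yv i) (zv j) \<in> J" for i j
    using closed(3)[OF central[of "zv j" "yv i"]] by (simp add: phi_simps commutator_def)
  show "lie [yv 3, yv 2, yv 1] \<in> J"
    using central[of "commutator (yv 3) (yv 2)" "yv 1"] by (simp add: commutator_def phi_simps)
  show "lie [yv 3, zv 2, yv 1] \<in> J" "lie [yv 3, zv 2, zv 1] \<in> J"
    using bracket[OF yz] by simp_all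
  show "zv 3 * lie [zv 2, yv 1] \<in> J"
    using closed(5)[OF J2(1)] by simp
  show C: "zv 3 * lie [yv 2, yv 1] \<in> J"
  proof -
    let ?x = "zv 3" and ?a = "yv 2" and ?b = "yv 1"
    have "commutator ?x ?a \<in> J" "commutator ?x ?b \<in> J" "commutator (?x \<odot> ?a) ?b \<in> J"
      by (rule central; simp add: phi_simps jordan_def)+
    then have "commutator (?x \<odot> ?a) ?b + commutator (commutator ?x ?a) ?b - (commutator ?x ?b * ?a + commutator ?x ?b * ?a) \<in> J"
      by (blast intro: closed(1,2,6) bracket)
    also have "commutator (?x \<odot> ?a) ?b + commutator (commutator ?x ?a) ?b - (commutator ?x ?b * ?a + commutator ?x ?b * ?a)
        = ?x * commutator ?a ?b + ?x * commutator ?a ?b"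
      by (simp add: jordan_def commutator_def algebra_simps)
    finally have "?x * commutator ?a ?b + ?x * commutator ?a ?b \<in> J" .
    from halve[OF this] show ?thesis by simp
  qed
  show "zv 1 * zv 2 * zv 3 \<in> J"
  proof -
    let ?x = "zv 1" and ?y = "zv 2" and ?w = "zv 3" and ?p = "zv 1 * zv 2 * zv 3"
    have r: "(?w \<odot> ?x) * ?y - ?x * (?w \<odot> ?y) \<in> J" (is "?r \<in> J")
      by (intro closed(2) closed(5)[OF anticommute] closed(6)[OF anticommute]) (simp_all add: phi_simps)
    have x: "commutator ?x ?y \<odot> ?w \<in> J"
      by (intro anticommute) (simp_all add: commutator_def phi_simps)
    have y: "(?x \<odot> ?y) \<odot> ?w \<in> J"
      unfolding jordan_def[of "?x \<odot> ?y"] by (intro closed(1) closed(5)[OF J2(2)] closed(6)[OF J2(2)])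
    have "commutator ?x ?y \<odot> ?w + (?x \<odot> ?y) \<odot> ?w - (?r + ?r) \<in> J"
      by (rule closed(2)[OF closed(1)[OF x y] closed(1)[OF r r]])
    also have "commutator ?x ?y \<odot> ?w + (?x \<odot> ?y) \<odot> ?w - (?r + ?r) = (?p + ?p) + (?p + ?p)"
      by (simp add: jordan_def commutator_def algebra_simps)
    finally have "(?p + ?p) + (?p + ?p) \<in> J" .
    from halve[OF halve[OF this]] show ?thesis .
  qed
  show "lie [yv 2, yv 1] * lie [yv 4, yv 3] \<in> J"
    using C by (rule commutator_product_of_skew[OF J])
qed (rule J)

text \<open>The commutator \<open>[y\<^sub>3,z\<^sub>2]\<close> is symmetric and \<open>z\<^sub>2
  \<odot> y\<^sub>1\<close> is skew. Multiplying the latter by \<open>z\<close> shows that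
  \<open>z\<^sub>i y\<^sub>k z\<^sub>j\<close> is a multiple of products \<open>z z\<close> modulo
  \<open>J\<close>.\<close>

lemma cubic_of_skew_square_zero:
  assumes J: "T_ideal Antiautomorphism J" and J2: "lie [yv 2, yv 1] \<in> J" "zv 1 * zv 2 \<in> J"
  shows "cubic_T_ideal Antiautomorphism J"
proof
  note closed = T_ideal_add[OF J] T_ideal_diff[OF J] T_ideal_uminus[OF J] T_ideal_fscale[OF J]
    T_ideal_mult_left[OF J] T_ideal_mult_right[OF J]
  let ?\<phi> = "free_phi Antiautomorphism"
  have zz: "x * w \<in> J" if "?\<phi> x = - x" "?\<phi> w = - w" for x w
    using T_ideal_sub[OF J admissible_case_letter J2(2), of yv "\<lambda>i. if i = 1 then x else w"] that
    by (simp add: free.eval_simps free_phi_yv)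
  have yy: "commutator a b \<in> J" if "?\<phi> a = a" "?\<phi> b = b" for a b
    using T_ideal_sub[OF J admissible_case_letter J2(1), of "\<lambda>i. if i = 2 then a else b" zv] that
    by (simp add: free.eval_simps free_phi_zv)
  have bracket: "commutator p q \<in> J" if "p \<in> J" for p q
    using that unfolding commutator_def by (intro closed)
  show "lie [yv 3, yv 2, yv 1] \<in> J"
    using bracket[OF yy[of "yv 3" "yv 2"]] by (simp add: phi_simps)
  show "lie [yv 3, zv 2, yv 1] \<in> J"
    using yy[of "commutator (yv 3) (zv 2)" "yv 1"] by (simp add: commutator_def phi_simps)
  show "zv 3 * lie [yv 2, yv 1] \<in> J"
    using J2(1) by (rule closed(5))
  show "lie [yv 2, yv 1] * lie [yv 4, yv 3] \<in> J"
    using J2(1) by (rule closed(6))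
  show "zv 1 * zv 2 * zv 3 \<in> J"
    using J2(2) by (rule closed(6))
  have z: "zv i * zv j \<in> J" "zv i * (zv j \<odot> yv k) \<in> J" "zv i * (yv k \<odot> zv j) \<in> J" for i j k
    by (intro zz; simp add: phi_simps jordan_def)+
  have "zv 3 * zv 2 * yv 1 + zv 3 * zv 2 * yv 1 - zv 3 * (zv 2 \<odot> yv 1) \<in> J"
    by (intro closed(1,2) closed(6)[OF z(1)] z)
  then show "zv 3 * lie [zv 2, yv 1] \<in> J"
    by (simp add: jordan_def commutator_def algebra_simps)
  have "yv 3 * (zv 2 * zv 1) + (zv 1 * zv 2) * yv 3 - zv 2 * (yv 3 \<odot> zv 1) + (zv 2 * zv 1) * yv 3
      - zv 1 * (yv 3 \<odot> zv 2) + (zv 1 * zv 2) * yv 3 \<in> J"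
    by (intro closed(1,2) closed(5)[OF z(1)] closed(6)[OF z(1)] z)
  then show "lie [yv 3, zv 2, zv 1] \<in> J"
    by (simp add: jordan_def commutator_def algebra_simps)
qed (rule J)

section \<open>Generating identities\<close>

lemma f_in_V_space: "f_\<Gamma>3 \<in> V_space 3" "f_4 \<in> V_space 4"
  by (simp_all add: f_\<Gamma>3_def f_4_def) (simp_all add: expand V_space_simps)

lemma cubic_of_f_4:
  assumes J: "T_ideal kind J" and f: "f_4 \<in> J"
  shows "cubic_T_ideal kind J"
proof -
  have f3: "f_\<Gamma>3 \<in> J"
    using T_ideal_sub[OF J admissible_specialize f, of "{4}" "{}"]
    by (simp add: f_4_def f_\<Gamma>3_def sub_simps)
  from T_ideal_diff[OF J f T_ideal_mult_right[OF J f3, of "yv 4"]]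
  have "lie [yv 2, yv 1] * lie [yv 4, yv 3] \<in> J"
    by (simp add: f_4_def)
  with f3 show ?thesis by (rule cubic_of_f_\<Gamma>3[OF J])
qed

lemma consequences_of_zv:
  assumes J: "T_ideal kind J" and "zv 1 \<in> J"
  shows "lie [zv 2, yv 1] \<in> J" "zv 1 * zv 2 \<in> J" "zv 1 \<odot> zv 2 \<in> J" "lie [zv 2, zv 1] \<in> J"
proof -
  have "zv i \<in> J" for i
    using assms zv_in_T_ideal_iff[OF J] by blast
  then show "lie [zv 2, yv 1] \<in> J" "zv 1 * zv 2 \<in> J" "zv 1 \<odot> zv 2 \<in> J" "lie [zv 2, zv 1] \<in> J"
    unfolding lie.simps foldl.simps commutator_def jordan_def
    by (simp_all add: T_ideal_add[OF J] T_ideal_diff[OF J] T_ideal_mult_left[OF J] T_ideal_mult_right[OF J])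
qed

lemma product_in_T_ideal_iff:
  assumes J: "T_ideal kind J"
  shows "zv 1 * zv 2 \<in> J \<longleftrightarrow> zv 1 \<odot> zv 2 \<in> J \<and> lie [zv 2, zv 1] \<in> J"
proof
  assume zz: "zv 1 * zv 2 \<in> J"
  have "zv 2 * zv 1 \<in> J"
    using T_ideal_rename[OF J zz, of id "\<lambda>i. if i = 1 then 2 else 1"] by (simp add: sub_rename)
  with zz show "zv 1 \<odot> zv 2 \<in> J \<and> lie [zv 2, zv 1] \<in> J"
    by (simp add: jordan_def commutator_def T_ideal_add[OF J] T_ideal_diff[OF J])
next
  assume "zv 1 \<odot> zv 2 \<in> J \<and> lie [zv 2, zv 1] \<in> J"
  then have "zv 1 \<odot> zv 2 - lie [zv 2, zv 1] \<in> J"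
    by (blast intro: T_ideal_diff[OF J])
  also have "zv 1 \<odot> zv 2 - lie [zv 2, zv 1] = fscale 2 (zv 1 * (zv 2 :: 'a free_algebra))"
    by (simp add: jordan_def commutator_def fscale_two)
  finally show "zv 1 * zv 2 \<in> J"
    using T_ideal_fscale_iff[OF J, of 2] by simp
qed

lemma T_ideal_singleton_zero: "T_ideal kind {0}"
proof -
  have "h 0 = 0" if "free_endomorphism h" for h :: "'a free_algebra \<Rightarrow> 'a free_algebra"
    using free_endomorphism_eq_sub[OF that, of 0] by (simp add: free.eval_zero)
  then show ?thesis by (auto simp: T_ideal_def two_sided_ideal_def)
qed

context phi_algebra
begin

abbreviation identities where "identities \<equiv> phi_identities scale \<phi>"

lemma one_notin_identities: "1 \<notin> identities"
proof -
  have "admissible_valuation \<phi> (\<lambda>_. 0)"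
    by (simp add: admissible_valuation_def phi_zero)
  then show ?thesis
    unfolding phi_identities_iff by (auto simp: eval_one intro!: exI[of _ "\<lambda>_. 0"])
qed

text \<open>Here \<open>K\<close> is a T-ideal that contains the identities of degree below
  \<open>n\<close>: if one of them generated all identities, then \<open>f\<close> would lie in
  \<open>K\<close>.\<close>

lemma generating_identityI:
  assumes f: "f \<in> V_space n" "f \<in> identities"
    and cubic: "cubic_T_ideal kind (T_generated kind {f})"
    and transfer: "atoms_transfer identities (T_generated kind {f})"
    and K: "T_ideal kind K" "\<And>g. g \<in> identities \<Longrightarrow> total_degree g < n \<Longrightarrow> g \<in> K" "f \<notin> K"
  shows "generating_identity kind scale \<phi> f"
proof -
  have "T_generated kind {f} \<subseteq> identities"
    using f(2) by (intro T_generated_subset T_ideal_phi_identities) simp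
  then have "identities = T_generated kind {f}"
    by (rule cubic_T_ideal.eq_of_atoms_transfer[OF cubic T_ideal_phi_identities one_notin_identities _ transfer])
  moreover have "T_generated kind {g} \<noteq> identities" if "g \<in> identities" "total_degree g < n" for g
    using T_generated_subset[OF K(1), of "{g}"] K(2)[OF that] K(3) f(2) by auto
  ultimately show ?thesis
    unfolding generating_identity_def using f(1) by blast
qed

lemma cubic_identities:
  assumes "\<And>i. 3 \<le> i \<Longrightarrow> \<Gamma> i \<subseteq> identities"
  shows "cubic_T_ideal kind identities"
proof
  have "\<Gamma> 3 \<subseteq> identities" "\<Gamma> 4 \<subseteq> identities"
    using assms by simp_all
  then show "lie [yv 3, yv 2, yv 1] \<in> identities" "lie [yv 3, zv 2, yv 1] \<in> identities" "zv 3 * lie [yv 2, yv 1] \<in> identities"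
    "lie [yv 3, zv 2, zv 1] \<in> identities" "zv 3 * lie [zv 2, yv 1] \<in> identities" "zv 1 * zv 2 * zv 3 \<in> identities"
    "lie [yv 2, yv 1] * lie [yv 4, yv 3] \<in> identities"
    using cubic_in_\<Gamma> quartic_in_\<Gamma> by blast+
qed (rule T_ideal_phi_identities)

lemma f_in_identities:
  assumes "cubic_T_ideal kind identities"
  shows "f_\<Gamma>3 \<in> identities" "f_4 \<in> identities"
proof -
  note closed = T_ideal_add[OF T_ideal_phi_identities] T_ideal_mult_right[OF T_ideal_phi_identities]
  show "f_\<Gamma>3 \<in> identities"
    unfolding f_\<Gamma>3_def by (intro closed(1) cubic_T_ideal.gens[OF assms])
  then show "f_4 \<in> identities"
    unfolding f_4_def by (intro closed cubic_T_ideal.gens[OF assms])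
qed

text \<open>Setting \<open>y\<^sub>3 = 1\<close> and \<open>z\<^sub>3 = 0\<close> kills
  \<open>f_\<Gamma>3\<close> and recovers \<open>q\<close>.\<close>

lemma generating_three:
  assumes cubic: "cubic_T_ideal kind identities" and z: "zv 1 \<notin> identities" and q: "q \<in> identities"
    and V: "q * yv 3 \<in> V_space 3" and low: "sub (specialize {3} {3}) q = q"
    and kind: "kind = Antiautomorphism \<or> sub (keep {1, 2} {}) q = lie [yv 2, yv 1]"
    and atoms: "lie [yv 2, yv 1] \<in> identities \<Longrightarrow> sub (keep {1, 2} {}) q = lie [yv 2, yv 1]"
      "lie [zv 2, yv 1] \<in> identities \<Longrightarrow> sub (keep {1} {2}) q = lie [zv 2, yv 1]"
      "zv 1 \<odot> zv 2 \<in> identities \<Longrightarrow> sub (keep {} {1, 2}) q \<in> {zv 2 \<odot> zv 1, zv 1 * zv 2}"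
      "lie [zv 2, zv 1] \<in> identities \<Longrightarrow> sub (keep {} {1, 2}) q \<in> {lie [zv 2, zv 1], zv 1 * zv 2}"
    and K: "T_ideal kind K" "atoms_transfer identities K" "q * yv 3 + f_\<Gamma>3 \<notin> K"
  shows "generating_identity kind scale \<phi> (q * yv 3 + f_\<Gamma>3)"
proof (rule generating_identityI[OF V_space_closed(1)[OF V f_in_V_space(1)] _ _ _ K(1) _ K(3)])
  let ?f = "q * yv 3 + f_\<Gamma>3"
  let ?J = "T_generated kind {?f}"
  note J = T_ideal_T_generated[of kind "{?f}"]
  have f: "?f \<in> ?J" by (simp add: in_T_generated)
  show "?f \<in> identities"
    by (intro T_ideal_add[OF T_ideal_phi_identities] T_ideal_mult_right[OF T_ideal_phi_identities] q
        f_in_identities cubic)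
  have "sub (specialize {3} {3}) (q * yv 3 + f_\<Gamma>3) = q"
    using low by (simp add: free.eval_add free.eval_mult f_\<Gamma>3_def) (simp add: sub_simps)
  then have qJ: "q \<in> ?J"
    using T_ideal_sub[OF J admissible_specialize f, of "{3}" "{3}"] by simp
  then have "f_\<Gamma>3 \<in> ?J"
    using T_ideal_diff[OF J f T_ideal_mult_right[OF J qJ, of "yv 3"]] by simp
  moreover have "lie [yv 2, yv 1] * lie [yv 4, yv 3] \<in> ?J"
    using kind
  proof
    assume anti: "kind = Antiautomorphism"
    have "zv 3 * lie [yv 2, yv 1] \<in> ?J"
      using T_ideal_sub[OF J admissible_keep \<open>f_\<Gamma>3 \<in> ?J\<close>, of "{1, 2}" "{3}"] by (simp add: f_\<Gamma>3_def sub_simps)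
    then show ?thesis
      using J unfolding anti by (intro commutator_product_of_skew)
  next
    assume "sub (keep {1, 2} {}) q = lie [yv 2, yv 1]"
    then show ?thesis
      using T_ideal_mult_right[OF J T_ideal_sub[OF J admissible_keep qJ, of "{1, 2}" "{}"]] by simp
  qed
  ultimately show "cubic_T_ideal kind ?J"
    by (rule cubic_of_f_\<Gamma>3[OF J])
  show "atoms_transfer identities ?J"
    by (rule atoms_transferI[OF J qJ z atoms])
  show "g \<in> K" if "g \<in> identities" "total_degree g < 3" for g
    using that by (intro degree_two_identity[OF T_ideal_phi_identities one_notin_identities K(1) _ _ K(2)]) auto
qed

text \<open>No nonzero identity has degree at most one, so the zero ideal takes the role of the
  model.\<close>

lemma generating_two:
  assumes z: "zv 1 \<notin> identities" and q: "q \<in> identities" "q \<in> V_space 2" "q \<noteq> 0"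
    and cubic: "\<And>J. T_ideal kind J \<Longrightarrow> q \<in> J \<Longrightarrow> cubic_T_ideal kind J"
    and atoms: "lie [yv 2, yv 1] \<in> identities \<Longrightarrow> sub (keep {1, 2} {}) q = lie [yv 2, yv 1]"
      "lie [zv 2, yv 1] \<in> identities \<Longrightarrow> sub (keep {1} {2}) q = lie [zv 2, yv 1]"
      "zv 1 \<odot> zv 2 \<in> identities \<Longrightarrow> sub (keep {} {1, 2}) q \<in> {zv 2 \<odot> zv 1, zv 1 * zv 2}"
      "lie [zv 2, zv 1] \<in> identities \<Longrightarrow> sub (keep {} {1, 2}) q \<in> {lie [zv 2, zv 1], zv 1 * zv 2}"
  shows "generating_identity kind scale \<phi> q"
proof (rule generating_identityI[OF q(2,1) _ _ T_ideal_singleton_zero])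
  note J = T_ideal_T_generated[of kind "{q}"]
  have qJ: "q \<in> T_generated kind {q}" by (simp add: in_T_generated)
  show "cubic_T_ideal kind (T_generated kind {q})"
    by (rule cubic[OF J qJ])
  show "atoms_transfer identities (T_generated kind {q})"
    by (rule atoms_transferI[OF J qJ z atoms])
  show "g \<in> {0}" if "g \<in> identities" "total_degree g < 2" for g
    by (rule degree_one_identity[OF T_ideal_phi_identities one_notin_identities T_ideal_singleton_zero that(1)])
      (use that(2) z in \<open>simp_all del: One_nat_def\<close>)
  show "q \<notin> {0}"
    using q(3) by simp
qed

text \<open>Setting \<open>y\<^sub>3 = y\<^sub>4 = 1\<close> and \<open>z\<^sub>3 = 0\<close> kills
  \<open>f_4\<close> and recovers \<open>q\<close>; then \<open>y\<^sub>4 = 1\<close> in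
  \<open>f_4\<close> recovers \<open>f_\<Gamma>3\<close>, as \<open>[1,y\<^sub>3] = 0\<close>. All
  terms of \<open>q\<close> contain some \<open>z\<close>, so the model distinguishes the polynomial
  by its last summand.\<close>

lemma generating_four:
  assumes cubic: "cubic_T_ideal kind identities" and z: "zv 1 \<notin> identities" and q: "q \<in> identities"
    and auto: "kind = Automorphism"
    and yy: "lie [yv 2, yv 1] \<notin> identities"
    and V: "q * yv 3 * yv 4 \<in> V_space 4" and low: "sub (specialize {3, 4} {3}) q = q"
    and q0: "sub (keep UNIV {}) q = 0"
    and atoms: "lie [zv 2, yv 1] \<in> identities \<Longrightarrow> sub (keep {1} {2}) q = lie [zv 2, yv 1]"
      "zv 1 \<odot> zv 2 \<in> identities \<Longrightarrow> sub (keep {} {1, 2}) q \<in> {zv 2 \<odot> zv 1, zv 1 * zv 2}"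
      "lie [zv 2, zv 1] \<in> identities \<Longrightarrow> sub (keep {} {1, 2}) q \<in> {lie [zv 2, zv 1], zv 1 * zv 2}"
  shows "generating_identity kind scale \<phi> (q * yv 3 * yv 4 + f_4)"
proof (rule generating_identityI[OF V_space_closed(1)[OF V f_in_V_space(2)], where K = exterior_id_model])
  let ?f = "q * yv 3 * yv 4 + f_4"
  let ?J = "T_generated kind {?f}"
  note J = T_ideal_T_generated[of kind "{?f}"]
  have f: "?f \<in> ?J" by (simp add: in_T_generated)
  show "?f \<in> identities"
    by (intro T_ideal_add[OF T_ideal_phi_identities] T_ideal_mult_right[OF T_ideal_phi_identities] q
        f_in_identities cubic)
  have "sub (specialize {3, 4} {3}) ?f = q"
    using low by (simp add: free.eval_add free.eval_mult f_4_def f_\<Gamma>3_def) (simp add: sub_simps)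
  then have qJ: "q \<in> ?J"
    using T_ideal_sub[OF J admissible_specialize f, of "{3, 4}" "{3}"] by simp
  have "f_4 \<in> ?J"
    using T_ideal_diff[OF J f T_ideal_mult_right[OF J T_ideal_mult_right[OF J qJ, of "yv 3"], of "yv 4"]] by simp
  then show "cubic_T_ideal kind ?J"
    by (rule cubic_of_f_4[OF J])
  show "atoms_transfer identities ?J"
    by (rule atoms_transferI[OF J qJ z notE[OF yy] atoms])
  show "T_ideal kind exterior_id_model"
    unfolding auto by (rule exterior_id_model)
  show "g \<in> exterior_id_model" if "g \<in> identities" "total_degree g < 4" for g
    by (rule degree_three_identity[OF T_ideal_phi_identities[unfolded auto] one_notin_identities yy
          cubic_T_ideal.gens(1)[OF cubic] that(1)]) (use that(2) in simp)
  show "?f \<notin> exterior_id_model"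
    by (rule exterior_id_model(6)) (simp add: free.eval_mult q0)
qed

lemma generating_pair:
  assumes cubic: "cubic_T_ideal kind identities" and z: "zv 1 \<in> identities"
    and auto: "kind = Automorphism" and yy: "lie [yv 2, yv 1] \<notin> identities"
  shows "generating_identity kind scale \<phi> (zv 1 * yv 2 * yv 3 * yv 4 + f_4)"
proof (rule generating_identityI[where n = 4 and K = exterior_id_model])
  let ?f = "zv 1 * yv 2 * yv 3 * yv 4 + f_4 :: 'k free_algebra"
  let ?J = "T_generated kind {?f}"
  note J = T_ideal_T_generated[of kind "{?f}"]
  have f: "?f \<in> ?J" by (simp add: in_T_generated)
  have "zv 1 * yv 2 * yv 3 * yv 4 \<in> V_space 4"
    by (simp add: expand V_space_simps)
  then show "?f \<in> V_space 4"
    by (intro V_space_closed f_in_V_space)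
  show "?f \<in> identities"
    by (intro T_ideal_add[OF T_ideal_phi_identities] T_ideal_mult_right[OF T_ideal_phi_identities] z
        f_in_identities cubic)
  have "sub (specialize {2, 3, 4} {2, 3}) ?f = zv 1"
    by (simp add: f_4_def f_\<Gamma>3_def) (simp add: sub_simps)
  then have zJ: "zv 1 \<in> ?J"
    using T_ideal_sub[OF J admissible_specialize f, of "{2, 3, 4}" "{2, 3}"] by simp
  have "f_4 \<in> ?J"
    using T_ideal_diff[OF J f T_ideal_mult_right[OF J T_ideal_mult_right[OF J T_ideal_mult_right[OF J zJ, of "yv 2"], of "yv 3"], of "yv 4"]]
    by simp
  then show "cubic_T_ideal kind ?J"
    by (rule cubic_of_f_4[OF J])
  show "atoms_transfer identities ?J"
    using consequences_of_zv[OF J zJ] zJ yy by (simp add: atoms_transfer_def del: lie.simps One_nat_def)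
  show "T_ideal kind exterior_id_model"
    unfolding auto by (rule exterior_id_model)
  show "g \<in> exterior_id_model" if "g \<in> identities" "total_degree g < 4" for g
    by (rule degree_three_identity[OF T_ideal_phi_identities[unfolded auto] one_notin_identities yy
          cubic_T_ideal.gens(1)[OF cubic] that(1)]) (use that(2) in simp)
  show "?f \<notin> exterior_id_model"
    by (rule exterior_id_model(6)) (simp add: free.eval_simps keep_def)
qed

lemma generating_zv:
  assumes "zv 1 \<in> identities" and kind: "kind = Antiautomorphism"
  shows "generating_identity kind scale \<phi> f_\<Gamma>1"
proof (rule generating_identityI[where n = 1, OF _ _ _ _ T_ideal_singleton_zero])
  let ?J = "T_generated kind {f_\<Gamma>1 :: 'k free_algebra}"
  note J = T_ideal_T_generated[of kind "{f_\<Gamma>1 :: 'k free_algebra}"]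
  have zJ: "zv 1 \<in> ?J"
    using in_T_generated[of f_\<Gamma>1 "{f_\<Gamma>1}" kind] by (simp add: f_\<Gamma>1_def)
  have "admissible_valuation (free_phi kind) (case_letter yv (\<lambda>_. lie [yv 2, yv 1]))"
    unfolding kind by (rule admissible_case_letter) (simp_all add: commutator_def phi_simps)
  from T_ideal_sub[OF J this zJ] have yyJ: "lie [yv 2, yv 1] \<in> ?J"
    by (simp add: free.eval_simps)
  show "cubic_T_ideal kind ?J"
    by (rule cubic_of_degree_two[OF J yyJ consequences_of_zv(1,2)[OF J zJ]])
  show "atoms_transfer identities ?J"
    using consequences_of_zv[OF J zJ] zJ yyJ by (simp add: atoms_transfer_def del: lie.simps One_nat_def)
  show "f_\<Gamma>1 \<in> V_space 1"
    by (simp add: f_\<Gamma>1_def expand V_space_simps)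
  show "f_\<Gamma>1 \<in> identities"
    using assms(1) by (simp add: f_\<Gamma>1_def)
  show "g \<in> {0}" if "g \<in> identities" "total_degree g < 1" for g
    by (rule degree_zero_identity[OF T_ideal_phi_identities one_notin_identities T_ideal_singleton_zero that(1)])
      (use that(2) in simp)
  have "Poly_Mapping.lookup (zv 1 :: 'k free_algebra) (Word [Z 1]) = 1"
    by (simp add: lookup_letter)
  then show "f_\<Gamma>1 \<notin> {0 :: 'k free_algebra}"
    unfolding f_\<Gamma>1_def by (metis lookup_zero singletonD zero_neq_one)
qed

lemma generating_zv_yy:
  assumes z: "zv 1 \<in> identities" and yy: "lie [yv 2, yv 1] \<in> identities" and kind: "kind = Automorphism"
  shows "generating_identity kind scale \<phi> (f_\<Gamma>1 * yv 2 + lie [yv 2, yv 1])"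
proof (rule generating_identityI[where n = 2 and K = exterior_id_model])
  let ?f = "f_\<Gamma>1 * yv 2 + lie [yv 2, yv 1] :: 'k free_algebra"
  let ?J = "T_generated kind {?f}"
  note J = T_ideal_T_generated[of kind "{?f}"]
  have f: "?f \<in> ?J" by (simp add: in_T_generated)
  have zJ: "zv 1 \<in> ?J"
    using T_ideal_sub[OF J admissible_specialize f, of "{2}" "{}"] by (simp add: f_\<Gamma>1_def sub_simps)
  have yyJ: "lie [yv 2, yv 1] \<in> ?J"
    using T_ideal_sub[OF J admissible_keep f, of UNIV "{}"] by (simp add: f_\<Gamma>1_def sub_simps)
  show "cubic_T_ideal kind ?J"
    by (rule cubic_of_degree_two[OF J yyJ consequences_of_zv(1,2)[OF J zJ]])
  show "atoms_transfer identities ?J"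
    using consequences_of_zv[OF J zJ] zJ yyJ by (simp add: atoms_transfer_def del: lie.simps One_nat_def)
  show "?f \<in> V_space 2"
    by (simp add: f_\<Gamma>1_def expand V_space_simps)
  show "?f \<in> identities"
    unfolding f_\<Gamma>1_def
    by (intro T_ideal_add[OF T_ideal_phi_identities] T_ideal_mult_right[OF T_ideal_phi_identities] z yy)
  show "T_ideal kind exterior_id_model"
    unfolding kind by (rule exterior_id_model)
  then show "g \<in> exterior_id_model" if "g \<in> identities" "total_degree g < 2" for g
    by (rule degree_one_identity[OF T_ideal_phi_identities one_notin_identities _ that(1)])
      (use that(2) in \<open>simp_all add: exterior_id_model(2)\<close>)
  show "?f \<notin> exterior_id_model"
    by (rule exterior_id_model(5)) (simp add: f_\<Gamma>1_def free.eval_simps keep_def)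
qed

end

section \<open>The polynomials attached to the submodules\<close>

lemma component_sum_plus:
  "component_sum a b c d + component_sum a' b' c' d' = component_sum (a \<or> a') (b \<or> b') (c \<or> c') (d \<or> d')"
proof -
  have "(A \<union> B \<union> C \<union> D) \<union> (A' \<union> B' \<union> C' \<union> D') = (A \<union> A') \<union> (B \<union> B') \<union> (C \<union> C') \<union> (D \<union> D')"
    for A B C D A' B' C' D' :: "'a free_algebra set"
    by blast
  moreover have "(if p then S else {}) \<union> (if q then S else {}) = (if p \<or> q then S else {})"
    for p q and S :: "'a free_algebra set"
    by simp
  ultimately show ?thesis
    unfolding component_sum_def span_plus by (simp only:)
qed

lemma sub_lie:
  "sub u (lie [a, b]) = lie [sub u a, sub u b]" "lie [0, a] = 0" "lie [a, 0] = 0"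
  "0 \<odot> a = 0" "a \<odot> 0 = 0"
  for a b :: "'k::field_char_0 free_algebra"
  by (simp_all add: free.eval_simps commutator_zero jordan_def)

lemma atoms_in_V_space:
  "lie [yv 2, yv 1] * yv 3 \<in> V_space 3" "lie [zv 2, yv 1] * yv 3 \<in> V_space 3"
  "(zv 1 \<odot> zv 2) * yv 3 \<in> V_space 3" "lie [zv 2, zv 1] * yv 3 \<in> V_space 3"
  "zv 1 * zv 2 * yv 3 \<in> V_space 3"
  "lie [yv 2, yv 1] * yv 3 * yv 4 \<in> V_space 4" "lie [zv 2, yv 1] * yv 3 * yv 4 \<in> V_space 4"
  "(zv 1 \<odot> zv 2) * yv 3 * yv 4 \<in> V_space 4" "lie [zv 2, zv 1] * yv 3 * yv 4 \<in> V_space 4"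
  "zv 1 * zv 2 * yv 3 * yv 4 \<in> V_space 4"
  "lie [yv 2, yv 1] \<in> V_space 2" "lie [zv 2, yv 1] \<in> V_space 2" "zv 1 \<odot> zv 2 \<in> V_space 2"
  "zv 1 * zv 2 \<in> V_space 2"
  by simp_all (simp_all add: expand V_space_simps)

lemma zero_in_V_space: "0 \<in> V_space n"
  by (simp add: V_space_def free.span_zero)

lemma jordan_zv_commute: "zv 2 \<odot> zv 1 = zv 1 \<odot> zv 2"
  by (simp add: jordan_def add.commute)

lemma lookup_product: "Poly_Mapping.lookup (zv 1 * zv 2) (Word w) = (if w = [Z 1, Z 2] then 1 else 0)"
  by (simp add: zv_def monomial_append[symmetric] lookup_monomial)

lemma quadratic_sums_nonzero:
  shows "f_\<Gamma>2 \<noteq> (0 :: 'a::field_char_0 free_algebra)"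
    and "lie [zv 2, yv 1] + zv 2 \<odot> zv 1 + lie [yv 2, yv 1] \<noteq> (0 :: 'a free_algebra)"
    and "zv 1 * zv 2 + lie [yv 2, yv 1] \<noteq> (0 :: 'a free_algebra)"
    and "lie [zv 2, yv 1] + zv 2 \<odot> zv 1 \<noteq> (0 :: 'a free_algebra)"
    and "lie [zv 2, yv 1] + zv 1 * zv 2 \<noteq> (0 :: 'a free_algebra)"
proof -
  have nonzero: "p \<noteq> 0" if "Poly_Mapping.lookup p (Word w) = 1" for p :: "'a free_algebra" and w
    using that by auto
  show "f_\<Gamma>2 \<noteq> (0 :: 'a free_algebra)" "lie [zv 2, yv 1] + zv 2 \<odot> zv 1 + lie [yv 2, yv 1] \<noteq> (0 :: 'a free_algebra)"
    "lie [zv 2, yv 1] + zv 2 \<odot> zv 1 \<noteq> (0 :: 'a free_algebra)" "lie [zv 2, yv 1] + zv 1 * zv 2 \<noteq> (0 :: 'a free_algebra)"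
    by (rule nonzero[of _ "[Z 2, Y 1]"];
        simp add: f_\<Gamma>2_def lookup_add lookup_quadratic lookup_product del: lie.simps One_nat_def)+
  show "zv 1 * zv 2 + lie [yv 2, yv 1] \<noteq> (0 :: 'a free_algebra)"
    by (rule nonzero[of _ "[Y 2, Y 1]"])
      (simp add: lookup_add lookup_quadratic lookup_product del: lie.simps One_nat_def)
qed

lemma cubic_of_quadratic:
  assumes J: "T_ideal kind J"
  shows "f_\<Gamma>2 \<in> J \<Longrightarrow> cubic_T_ideal kind J"
    and "kind = Antiautomorphism \<Longrightarrow> lie [zv 2, yv 1] + zv 2 \<odot> zv 1 + lie [yv 2, yv 1] \<in> J \<Longrightarrow> cubic_T_ideal kind J"
    and "kind = Antiautomorphism \<Longrightarrow> zv 1 * zv 2 + lie [yv 2, yv 1] \<in> J \<Longrightarrow> cubic_T_ideal kind J"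
    and "kind = Antiautomorphism \<Longrightarrow> lie [zv 2, yv 1] + zv 2 \<odot> zv 1 \<in> J \<Longrightarrow> cubic_T_ideal kind J"
    and "kind = Antiautomorphism \<Longrightarrow> lie [zv 2, yv 1] + zv 1 * zv 2 \<in> J \<Longrightarrow> cubic_T_ideal kind J"
proof -
  note keep = T_ideal_sub[OF J admissible_keep]
  note simps = sub_lie free.eval_simps keep_def jordan_zv_commute
  show "cubic_T_ideal kind J" if "f_\<Gamma>2 \<in> J"
    using keep[OF that, of "{1, 2}" "{}"] keep[OF that, of "{1}" "{2}"] keep[OF that, of "{}" "{1, 2}"]
    by (intro cubic_of_degree_two[OF J]) (simp_all add: f_\<Gamma>2_def simps del: lie.simps One_nat_def)
  assume kind: "kind = Antiautomorphism"
  note skew_mult = cubic_of_skew_mult[OF J[unfolded kind], folded kind]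
  show "cubic_T_ideal kind J" if "lie [zv 2, yv 1] + zv 2 \<odot> zv 1 + lie [yv 2, yv 1] \<in> J"
    using keep[OF that, of "{1}" "{2}"] keep[OF that, of "{}" "{1, 2}"]
    by (intro skew_mult) (simp_all add: simps del: lie.simps One_nat_def)
  show "cubic_T_ideal kind J" if "lie [zv 2, yv 1] + zv 2 \<odot> zv 1 \<in> J"
    using keep[OF that, of "{1}" "{2}"] keep[OF that, of "{}" "{1, 2}"]
    by (intro skew_mult) (simp_all add: simps del: lie.simps One_nat_def)
  show "cubic_T_ideal kind J" if "lie [zv 2, yv 1] + zv 1 * zv 2 \<in> J"
    using keep[OF that, of "{1}" "{2}"] keep[OF that, of "{}" "{1, 2}"] product_in_T_ideal_iff[OF J]
    by (intro skew_mult) (simp_all add: simps del: lie.simps One_nat_def)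
  show "cubic_T_ideal kind J" if "zv 1 * zv 2 + lie [yv 2, yv 1] \<in> J"
    using keep[OF that, of "{1, 2}" "{}"] keep[OF that, of "{}" "{1, 2}"]
    by (intro cubic_of_skew_square_zero[OF J[unfolded kind], folded kind])
      (simp_all add: simps del: lie.simps One_nat_def)
qed

lemma zv_nonzero: "zv i \<noteq> 0"
proof
  assume "zv i = (0 :: 'a free_algebra)"
  from arg_cong[OF this, of "\<lambda>p. Poly_Mapping.lookup p (Word [Z i])"] show False
    by (simp add: lookup_letter)
qed

theorem proposition3p6:
  fixes scale :: "'k::field_char_0 \<Rightarrow> 'a::ring_1 \<Rightarrow> 'a"
    and \<phi> :: "'a \<Rightarrow> 'a"
    and kind :: phi_kind
    and s k :: nat
    and M :: "nat \<Rightarrow> 'k free_algebra set"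
  assumes "phi_algebra kind scale \<phi>"
    and "(k = 0 \<and> associated_empty scale \<phi>) \<or>
         (admissible kind s k M \<and> associated scale \<phi> s k M)"
  shows
    "(k = 0 \<longrightarrow>
       (kind = Antiautomorphism \<longrightarrow> generating_identity kind scale \<phi> f_\<Gamma>1) \<and>
       (kind = Automorphism \<longrightarrow>
          generating_identity kind scale \<phi> (f_\<Gamma>1 * yv 2 + lie [yv 2, yv 1])))
     \<and>
     (k = 1 \<longrightarrow> generating_identity kind scale \<phi> f_\<Gamma>2)
     \<and>
     (k = 2 \<longrightarrow>
       \<comment> \<open>the cases below cover all possibilities\<close>
       ((s = 2 \<and> M 2 \<in> {V_11_0, V_1_1 + V_11_0, V_0_2 + V_11_0,
           V_0_11 + V_11_0, V_1_1 + V_0_11 + V_11_0, V_1_1 + V_0_2 + V_11_0,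
           V_0_2 + V_0_11 + V_11_0, {0}, V_1_1,
           V_0_2, V_0_11, V_0_2 + V_0_11,
           V_1_1 + V_0_11, V_1_1 + V_0_2, V_1_1 + V_0_2 + V_0_11}) \<or>
        (s = 1 \<and> kind = Automorphism \<and> M 1 = \<Gamma> 1 \<and> M 2 = V_1_1 + V_0_2 + V_0_11))
       \<and> (s = 2 \<and> M 2 = V_11_0 \<longrightarrow>
            generating_identity kind scale \<phi> (lie [yv 2, yv 1] * yv 3 + f_\<Gamma>3))
       \<and> (s = 2 \<and> M 2 = V_1_1 + V_11_0 \<longrightarrow>
            generating_identity kind scale \<phi> ((lie [zv 2, yv 1] + lie [yv 2, yv 1]) * yv 3 + f_\<Gamma>3))
       \<and> (s = 2 \<and> M 2 = V_0_2 + V_11_0 \<longrightarrow>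
            generating_identity kind scale \<phi> ((zv 2 \<odot> zv 1 + lie [yv 2, yv 1]) * yv 3 + f_\<Gamma>3))
       \<and> (s = 2 \<and> M 2 = V_0_11 + V_11_0 \<longrightarrow>
            generating_identity kind scale \<phi> ((lie [zv 2, zv 1] + lie [yv 2, yv 1]) * yv 3 + f_\<Gamma>3))
       \<and> (s = 2 \<and> M 2 = V_1_1 + V_0_11 + V_11_0 \<longrightarrow>
            generating_identity kind scale \<phi> ((lie [zv 2, yv 1] + lie [zv 2, zv 1] + lie [yv 2, yv 1]) * yv 3 + f_\<Gamma>3))
       \<and> (s = 2 \<and> M 2 = V_1_1 + V_0_2 + V_11_0 \<longrightarrow>
            (kind = Automorphism \<longrightarrow> generating_identity kind scale \<phi> ((lie [zv 2, yv 1] + zv 2 \<odot> zv 1 + lie [yv 2, yv 1]) * yv 3 + f_\<Gamma>3)) \<and>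
            (kind = Antiautomorphism \<longrightarrow> generating_identity kind scale \<phi> (lie [zv 2, yv 1] + zv 2 \<odot> zv 1 + lie [yv 2, yv 1])))
       \<and> (s = 2 \<and> M 2 = V_0_2 + V_0_11 + V_11_0 \<longrightarrow>
            (kind = Automorphism \<longrightarrow> generating_identity kind scale \<phi> ((zv 1 * zv 2 + lie [yv 2, yv 1]) * yv 3 + f_\<Gamma>3)) \<and>
            (kind = Antiautomorphism \<longrightarrow> generating_identity kind scale \<phi> (zv 1 * zv 2 + lie [yv 2, yv 1])))
       \<and> (s = 2 \<and> M 2 = {0} \<longrightarrow>
            (kind = Automorphism \<longrightarrow> generating_identity kind scale \<phi> f_4) \<and>
            (kind = Antiautomorphism \<longrightarrow> generating_identity kind scale \<phi> f_\<Gamma>3))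
       \<and> (s = 2 \<and> M 2 = V_1_1 \<longrightarrow>
            (kind = Automorphism \<longrightarrow> generating_identity kind scale \<phi> (lie [zv 2, yv 1] * yv 3 * yv 4 + f_4)) \<and>
            (kind = Antiautomorphism \<longrightarrow> generating_identity kind scale \<phi> (lie [zv 2, yv 1] * yv 3 + f_\<Gamma>3)))
       \<and> (s = 2 \<and> M 2 = V_0_2 \<longrightarrow>
            (kind = Automorphism \<longrightarrow> generating_identity kind scale \<phi> ((zv 2 \<odot> zv 1) * yv 3 * yv 4 + f_4)) \<and>
            (kind = Antiautomorphism \<longrightarrow> generating_identity kind scale \<phi> ((zv 2 \<odot> zv 1) * yv 3 + f_\<Gamma>3)))
       \<and> (s = 2 \<and> M 2 = V_0_11 \<longrightarrow>
            (kind = Automorphism \<longrightarrow> generating_identity kind scale \<phi> (lie [zv 2, zv 1] * yv 3 * yv 4 + f_4)) \<and>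
            (kind = Antiautomorphism \<longrightarrow> generating_identity kind scale \<phi> (lie [zv 2, zv 1] * yv 3 + f_\<Gamma>3)))
       \<and> (s = 2 \<and> M 2 = V_0_2 + V_0_11 \<longrightarrow>
            (kind = Automorphism \<longrightarrow> generating_identity kind scale \<phi> (zv 1 * zv 2 * yv 3 * yv 4 + f_4)) \<and>
            (kind = Antiautomorphism \<longrightarrow> generating_identity kind scale \<phi> (zv 1 * zv 2 * yv 3 + f_\<Gamma>3)))
       \<and> (s = 2 \<and> M 2 = V_1_1 + V_0_11 \<longrightarrow>
            (kind = Automorphism \<longrightarrow> generating_identity kind scale \<phi> ((lie [zv 2, yv 1] + lie [zv 2, zv 1]) * yv 3 * yv 4 + f_4)) \<and>
            (kind = Antiautomorphism \<longrightarrow> generating_identity kind scale \<phi> ((lie [zv 2, yv 1] + lie [zv 2, zv 1]) * yv 3 + f_\<Gamma>3)))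
       \<and> (s = 2 \<and> M 2 = V_1_1 + V_0_2 \<longrightarrow>
            (kind = Automorphism \<longrightarrow> generating_identity kind scale \<phi> ((lie [zv 2, yv 1] + zv 2 \<odot> zv 1) * yv 3 * yv 4 + f_4)) \<and>
            (kind = Antiautomorphism \<longrightarrow> generating_identity kind scale \<phi> (lie [zv 2, yv 1] + zv 2 \<odot> zv 1)))
       \<and> (s = 2 \<and> M 2 = V_1_1 + V_0_2 + V_0_11 \<longrightarrow>
            (kind = Automorphism \<longrightarrow> generating_identity kind scale \<phi> ((lie [zv 2, yv 1] + zv 1 * zv 2) * yv 3 * yv 4 + f_4)) \<and>
            (kind = Antiautomorphism \<longrightarrow> generating_identity kind scale \<phi> (lie [zv 2, yv 1] + zv 1 * zv 2)))
       \<and> (s = 1 \<and> M 1 = \<Gamma> 1 \<and> M 2 = V_1_1 + V_0_2 + V_0_11 \<longrightarrow>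
            generating_identity kind scale \<phi> (zv 1 * yv 2 * yv 3 * yv 4 + f_4)))"
proof -
  interpret phi_algebra kind scale \<phi> by fact
  note ident = T_ideal_phi_identities
  have \<Gamma>_1: "\<Gamma> 1 \<subseteq> identities" if "zv 1 \<in> identities"
  proof
    fix p :: "'k free_algebra"
    assume "p \<in> \<Gamma> 1"
    then obtain c where "p = fscale c (zv 1)" by (rule \<Gamma>_1_expansion)
    then show "p \<in> identities" using T_ideal_fscale[OF ident that] by simp
  qed
  have pos: "admissible kind s k M \<and> associated scale \<phi> s k M" if "k \<noteq> 0"
    using assms(2) that by blast
  have zero: "associated_empty scale \<phi>" if "k = 0"
    using assms(2) that by (auto simp: admissible_def)
  have zero_atoms: "zv 1 \<in> identities" "lie [yv 2, yv 1] \<in> identities" if "k = 0"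
    using zero[OF that] zv_in_\<Gamma> quadratic_in_\<Gamma>(1) unfolding associated_empty_def
    by (meson order_refl one_le_numeral subsetD)+
  have zero_anti: "generating_identity kind scale \<phi> f_\<Gamma>1" if "k = 0" "kind = Antiautomorphism"
    using zero_atoms(1)[OF that(1)] that(2) by (rule generating_zv)
  have zero_auto: "generating_identity kind scale \<phi> (f_\<Gamma>1 * yv 2 + lie [yv 2, yv 1])"
    if "k = 0" "kind = Automorphism"
    using zero_atoms[OF that(1)] that(2) by (rule generating_zv_yy)
  have above: "\<Gamma> i \<subseteq> identities" if "k \<noteq> 0" "k < i" for i
    using pos[OF that(1)] that(2) unfolding associated_def by blast
  have cubic: "cubic_T_ideal kind identities" if "k = 2"
    by (rule cubic_identities) (use above that in auto)
  have M_top: "M k = \<Gamma> k \<inter> identities" "M k \<subset> \<Gamma> k" "hyp_submodule k (M k)" "1 \<le> s" "s \<le> k" if "k \<noteq> 0"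
    using pos[OF that] unfolding associated_def admissible_def by auto
  note simps = sub_lie free.eval_simps keep_def specialize_def jordan_zv_commute T_ideal_add[OF ident]
    T_ideal_zero[OF ident] product_in_T_ideal_iff[OF ident] atoms_in_V_space distrib_right V_space_closed
    zero_in_V_space atoms_transfer_def
  have one: "generating_identity kind scale \<phi> f_\<Gamma>2" if k: "k = 1"
  proof -
    have z: "zv 1 \<notin> identities"
      using \<Gamma>_1 M_top(1,2) k by auto
    have "\<Gamma> 2 \<subseteq> identities"
      using above k by simp
    then have atoms: "lie [yv 2, yv 1] \<in> identities" "lie [zv 2, yv 1] \<in> identities"
      "zv 1 \<odot> zv 2 \<in> identities" "lie [zv 2, zv 1] \<in> identities"
      using quadratic_in_\<Gamma> by blast+
    show ?thesis
      by (rule generating_two[OF z _ _ quadratic_sums_nonzero(1) cubic_of_quadratic(1)])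
        (simp_all add: f_\<Gamma>2_def atoms simps del: lie.simps One_nat_def)
  qed
  have z: "zv 1 \<notin> identities" if "k = 2" "s = 2"
  proof -
    have "\<Gamma> 1 \<inter> identities = {0}"
      using pos that unfolding associated_def by simp
    then show ?thesis using zv_in_\<Gamma> zv_nonzero by blast
  qed
  have flags: "lie [yv 2, yv 1] \<in> identities \<longleftrightarrow> a" "lie [zv 2, yv 1] \<in> identities \<longleftrightarrow> b"
      "zv 1 \<odot> zv 2 \<in> identities \<longleftrightarrow> c" "lie [zv 2, zv 1] \<in> identities \<longleftrightarrow> d"
    if "k = 2" "s = 2" "M 2 = component_sum a b c d" for a b c d
  proof -
    have "\<Gamma> 2 \<inter> identities = component_sum a b c d"
      using M_top(1) that by simp
    then show "lie [yv 2, yv 1] \<in> identities \<longleftrightarrow> a" "lie [zv 2, yv 1] \<in> identities \<longleftrightarrow> b"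
      "zv 1 \<odot> zv 2 \<in> identities \<longleftrightarrow> c" "lie [zv 2, zv 1] \<in> identities \<longleftrightarrow> d"
      using component_sum_iff[of a b c d] quadratic_in_\<Gamma> by blast+
  qed
  have M_2: "M 2 = component_sum (lie [yv 2, yv 1] \<in> M 2) (lie [zv 2, yv 1] \<in> M 2) (zv 1 \<odot> zv 2 \<in> M 2) (lie [zv 2, zv 1] \<in> M 2)"
    "M 2 \<noteq> component_sum True True True True" if "k = 2"
  proof -
    show "M 2 = component_sum (lie [yv 2, yv 1] \<in> M 2) (lie [zv 2, yv 1] \<in> M 2) (zv 1 \<odot> zv 2 \<in> M 2) (lie [zv 2, zv 1] \<in> M 2)"
      by (rule hyp_submodule_2_eq) (use M_top(3) that in simp)
    show "M 2 \<noteq> component_sum True True True True"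
      unfolding \<Gamma>_2_eq[symmetric] using M_top(2) that by auto
  qed
  have linear: "zv 1 \<in> identities" "M 1 = \<Gamma> 1" "kind = Automorphism" "lie [yv 2, yv 1] \<notin> identities"
      "M 2 = V_1_1 + V_0_2 + V_0_11" if k: "k = 2" "s = 1"
  proof -
    have "M 1 \<noteq> {0}" "hyp_submodule 1 (M 1)" "\<Gamma> 1 \<inter> identities = M 1"
      using pos k unfolding admissible_def associated_def by auto
    then have "0 \<in> M 1" "M 1 \<subseteq> \<Gamma> 1"
      unfolding hyp_submodule_def by (auto dest: free.subspace_0)
    then obtain p where p: "p \<in> M 1" "p \<noteq> 0"
      using \<open>M 1 \<noteq> {0}\<close> by blast
    then obtain c where c: "p = fscale c (zv 1)"
      using \<open>M 1 \<subseteq> \<Gamma> 1\<close> by (blast elim: \<Gamma>_1_expansion)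
    then have "c \<noteq> 0" using p(2) by auto
    then show z: "zv 1 \<in> identities"
      using p(1) c \<open>\<Gamma> 1 \<inter> identities = M 1\<close> T_ideal_fscale_iff[OF ident, of c] by blast
    then show "M 1 = \<Gamma> 1"
      using \<Gamma>_1 \<open>\<Gamma> 1 \<inter> identities = M 1\<close> by blast
    note z_atoms = consequences_of_zv[OF ident z]
    have in_M: "q \<in> M 2 \<longleftrightarrow> q \<in> identities" if "q \<in> \<Gamma> 2" for q
      using M_top(1) k that by auto
    have atoms: "lie [zv 2, yv 1] \<in> M 2" "zv 1 \<odot> zv 2 \<in> M 2" "lie [zv 2, zv 1] \<in> M 2"
      using z_atoms in_M quadratic_in_\<Gamma> by blast+
    have yy: "lie [yv 2, yv 1] \<notin> M 2"
    proof
      assume yy: "lie [yv 2, yv 1] \<in> M 2"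
      have "component_sum (lie [yv 2, yv 1] \<in> M 2) (lie [zv 2, yv 1] \<in> M 2) (zv 1 \<odot> zv 2 \<in> M 2) (lie [zv 2, zv 1] \<in> M 2)
          = component_sum True True True True"
        by (simp only: yy atoms)
      from trans[OF M_2(1)[OF k(1)] this] M_2(2)[OF k(1)] show False
        by (rule notE[rotated])
    qed
    then show yy': "lie [yv 2, yv 1] \<notin> identities"
      using in_M quadratic_in_\<Gamma>(1) by blast
    have "component_sum (lie [yv 2, yv 1] \<in> M 2) (lie [zv 2, yv 1] \<in> M 2) (zv 1 \<odot> zv 2 \<in> M 2) (lie [zv 2, zv 1] \<in> M 2)
        = component_sum False True True True"
      by (simp only: yy atoms)
    from trans[OF trans[OF M_2(1)[OF k(1)] this] component_sum_eqs(15)[symmetric]]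
    show "M 2 = V_1_1 + V_0_2 + V_0_11" .
    \<comment> \<open>For an antiautomorphism \<open>[y\<^sub>2,y\<^sub>1]\<close> is skew, and \<open>z\<^sub>1\<close> would imply it.\<close>
    show "kind = Automorphism"
    proof (cases kind)
      case Antiautomorphism
      have "admissible_valuation (free_phi kind) (case_letter yv (\<lambda>_. lie [yv 2, yv 1]))"
        unfolding Antiautomorphism by (rule admissible_case_letter) (simp_all add: commutator_def phi_simps)
      from T_ideal_sub[OF ident this z] yy' show ?thesis
        by (simp add: free.eval_simps)
    qed
  qed
  have pair: "generating_identity kind scale \<phi> (zv 1 * yv 2 * yv 3 * yv 4 + f_4)" if "k = 2" "s = 1"
    by (rule generating_pair[OF cubic[OF that(1)] linear(1)[OF that] linear(3)[OF that] linear(4)[OF that]])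
  have cover: "(s = 2 \<and> M 2 \<in> {V_11_0, V_1_1 + V_11_0, V_0_2 + V_11_0,
           V_0_11 + V_11_0, V_1_1 + V_0_11 + V_11_0, V_1_1 + V_0_2 + V_11_0,
           V_0_2 + V_0_11 + V_11_0, {0}, V_1_1,
           V_0_2, V_0_11, V_0_2 + V_0_11,
           V_1_1 + V_0_11, V_1_1 + V_0_2, V_1_1 + V_0_2 + V_0_11}) \<or>
        (s = 1 \<and> kind = Automorphism \<and> M 1 = \<Gamma> 1 \<and> M 2 = V_1_1 + V_0_2 + V_0_11)" if k: "k = 2"
  proof (cases "s = 1")
    case True
    then show ?thesis by (intro disjI2 conjI linear[OF k])
  next
    case False
    then have "s = 2" using M_top(4,5) k by auto
    obtain a b c d where eq: "M 2 = component_sum a b c d"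
      using M_2(1)[OF k] by blast
    have "\<not> (a \<and> b \<and> c \<and> d)"
      using M_2(2)[OF k] unfolding eq by (intro notI) (simp only: simp_thms)
    then show ?thesis
      unfolding component_sum_eqs(1,8-11) component_sum_plus eq
      by (cases a; cases b; cases c; cases d) (simp_all only: \<open>s = 2\<close> insert_iff simp_thms)
  qed
  note quiver_negate = quiver_negate_model(1-3)
    product_in_T_ideal_iff[OF quiver_negate_model(1), THEN iffD1, OF quiver_negate_model(3)]
  note quiver_swap = quiver_swap_model(1,2)
    product_in_T_ideal_iff[OF quiver_swap_model(1), THEN iffD1, OF quiver_swap_model(2)]
  \<comment> \<open>In every case the components of the prefix in degree two are the quadratic polynomials that are identities, and the model satisfies these.\<close>
  have case_a: "generating_identity kind scale \<phi> (lie [yv 2, yv 1] * yv 3 + f_\<Gamma>3)"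
    if k: "k = 2" "s = 2" and M: "M 2 = V_11_0"
  proof -
    note flags = flags[OF k trans[OF M component_sum_eqs(1)]]
    show ?thesis
      by (rule generating_three[where K = "commutative_model", OF cubic[OF k(1)] z[OF k]
          _ _ _ _ _ _ _ _ _ _ commutative_model(5)])
        (simp_all add: z[OF k] flags simps commutative_model(1-4) del: lie.simps One_nat_def)
  qed
  have case_b: "generating_identity kind scale \<phi> ((lie [zv 2, yv 1] + lie [yv 2, yv 1]) * yv 3 + f_\<Gamma>3)"
    if k: "k = 2" "s = 2" and M: "M 2 = V_1_1 + V_11_0"
  proof -
    note flags = flags[OF k trans[OF M component_sum_eqs(2)]]
    show ?thesis
      by (rule generating_three[where K = "commutative_model", OF cubic[OF k(1)] z[OF k]
          _ _ _ _ _ _ _ _ _ _ commutative_model(5)])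
        (simp_all add: z[OF k] flags simps commutative_model(1-4) del: lie.simps One_nat_def)
  qed
  have case_c_auto: "generating_identity kind scale \<phi> ((zv 2 \<odot> zv 1 + lie [yv 2, yv 1]) * yv 3 + f_\<Gamma>3)"
    if k: "k = 2" "s = 2" and M: "M 2 = V_0_2 + V_11_0" and kind: "kind = Automorphism"
  proof -
    note flags = flags[OF k trans[OF M component_sum_eqs(3)]]
    show ?thesis
      by (rule generating_three[where K = "exterior_par_model", OF cubic[OF k(1)] z[OF k]
          _ _ _ _ _ _ _ _ _ _ exterior_par_model(5)])
        (simp_all add: z[OF k] flags kind simps exterior_par_model(1-4) del: lie.simps One_nat_def)
  qed
  have case_c_anti: "generating_identity kind scale \<phi> ((zv 2 \<odot> zv 1 + lie [yv 2, yv 1]) * yv 3 + f_\<Gamma>3)"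
    if k: "k = 2" "s = 2" and M: "M 2 = V_0_2 + V_11_0" and kind: "kind = Antiautomorphism"
  proof -
    note flags = flags[OF k trans[OF M component_sum_eqs(3)]]
    show ?thesis
      by (rule generating_three[where K = "exterior_reversal_model", OF cubic[OF k(1)] z[OF k]
          _ _ _ _ _ _ _ _ _ _ exterior_reversal_model(4)])
        (simp_all add: z[OF k] flags kind simps exterior_reversal_model(1-3) del: lie.simps One_nat_def)
  qed
  have case_c: "generating_identity kind scale \<phi> ((zv 2 \<odot> zv 1 + lie [yv 2, yv 1]) * yv 3 + f_\<Gamma>3)"
    if "k = 2" "s = 2" "M 2 = V_0_2 + V_11_0"
    using case_c_auto[OF that] case_c_anti[OF that] by (cases kind)
  have case_d: "generating_identity kind scale \<phi> ((lie [zv 2, zv 1] + lie [yv 2, yv 1]) * yv 3 + f_\<Gamma>3)"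
    if k: "k = 2" "s = 2" and M: "M 2 = V_0_11 + V_11_0"
  proof -
    note flags = flags[OF k trans[OF M component_sum_eqs(4)]]
    show ?thesis
      by (rule generating_three[where K = "commutative_model", OF cubic[OF k(1)] z[OF k]
          _ _ _ _ _ _ _ _ _ _ commutative_model(5)])
        (simp_all add: z[OF k] flags simps commutative_model(1-4) del: lie.simps One_nat_def)
  qed
  have case_e: "generating_identity kind scale \<phi> ((lie [zv 2, yv 1] + lie [zv 2, zv 1] + lie [yv 2, yv 1]) * yv 3 + f_\<Gamma>3)"
    if k: "k = 2" "s = 2" and M: "M 2 = V_1_1 + V_0_11 + V_11_0"
  proof -
    note flags = flags[OF k trans[OF M component_sum_eqs(5)]]
    show ?thesis
      by (rule generating_three[where K = "commutative_model", OF cubic[OF k(1)] z[OF k]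
          _ _ _ _ _ _ _ _ _ _ commutative_model(5)])
        (simp_all add: z[OF k] flags simps commutative_model(1-4) del: lie.simps One_nat_def)
  qed
  have case_f_auto: "generating_identity kind scale \<phi> ((lie [zv 2, yv 1] + zv 2 \<odot> zv 1 + lie [yv 2, yv 1]) * yv 3 + f_\<Gamma>3)"
    if k: "k = 2" "s = 2" and M: "M 2 = V_1_1 + V_0_2 + V_11_0" and kind: "kind = Automorphism"
  proof -
    note flags = flags[OF k trans[OF M component_sum_eqs(6)]]
    show ?thesis
      by (rule generating_three[where K = "exterior_par_model", OF cubic[OF k(1)] z[OF k]
          _ _ _ _ _ _ _ _ _ _ exterior_par_model(5)])
        (simp_all add: z[OF k] flags kind simps exterior_par_model(1-4) del: lie.simps One_nat_def)
  qed
  have case_f_anti: "generating_identity kind scale \<phi> (lie [zv 2, yv 1] + zv 2 \<odot> zv 1 + lie [yv 2, yv 1])"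
    if k: "k = 2" "s = 2" and M: "M 2 = V_1_1 + V_0_2 + V_11_0" and kind: "kind = Antiautomorphism"
  proof -
    note flags = flags[OF k trans[OF M component_sum_eqs(6)]]
    show ?thesis
      by (rule generating_two[OF z[OF k] _ _ quadratic_sums_nonzero(2) cubic_of_quadratic(2)[OF _ kind]])
        (simp_all add: z[OF k] flags simps del: lie.simps One_nat_def)
  qed
  have case_g_auto: "generating_identity kind scale \<phi> ((zv 1 * zv 2 + lie [yv 2, yv 1]) * yv 3 + f_\<Gamma>3)"
    if k: "k = 2" "s = 2" and M: "M 2 = V_0_2 + V_0_11 + V_11_0" and kind: "kind = Automorphism"
  proof -
    note flags = flags[OF k trans[OF M component_sum_eqs(7)]]
    show ?thesis
      by (rule generating_three[where K = "quiver_model negate_arrows", OF cubic[OF k(1)] z[OF k]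
          _ _ _ _ _ _ _ _ _ _ quiver_negate_model(4)])
        (simp_all add: z[OF k] flags kind simps quiver_negate del: lie.simps One_nat_def)
  qed
  have case_g_anti: "generating_identity kind scale \<phi> (zv 1 * zv 2 + lie [yv 2, yv 1])"
    if k: "k = 2" "s = 2" and M: "M 2 = V_0_2 + V_0_11 + V_11_0" and kind: "kind = Antiautomorphism"
  proof -
    note flags = flags[OF k trans[OF M component_sum_eqs(7)]]
    show ?thesis
      by (rule generating_two[OF z[OF k] _ _ quadratic_sums_nonzero(3) cubic_of_quadratic(3)[OF _ kind]])
        (simp_all add: z[OF k] flags simps del: lie.simps One_nat_def)
  qed
  have case_h_auto: "generating_identity kind scale \<phi> (f_4)"
    if k: "k = 2" "s = 2" and M: "M 2 = {0}" and kind: "kind = Automorphism"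
  proof -
    note flags = flags[OF k trans[OF M component_sum_eqs(8)]]
    have "generating_identity kind scale \<phi> (0 * yv 3 * yv 4 + f_4)"
      by (rule generating_four[where q = 0, OF cubic[OF k(1)] z[OF k]])
        (simp_all add: z[OF k] flags kind simps del: lie.simps One_nat_def)
    then show ?thesis by simp
  qed
  have case_h_anti: "generating_identity kind scale \<phi> (f_\<Gamma>3)"
    if k: "k = 2" "s = 2" and M: "M 2 = {0}" and kind: "kind = Antiautomorphism"
  proof -
    note flags = flags[OF k trans[OF M component_sum_eqs(8)]]
    have "generating_identity kind scale \<phi> (0 * yv 3 + f_\<Gamma>3)"
      by (rule generating_three[where q = 0 and K = "commutative_model", OF cubic[OF k(1)] z[OF k]
          _ _ _ _ _ _ _ _ _ _ commutative_model(5)])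
        (simp_all add: z[OF k] flags kind simps commutative_model(1-4) del: lie.simps One_nat_def)
    then show ?thesis by simp
  qed
  have case_i_auto: "generating_identity kind scale \<phi> (lie [zv 2, yv 1] * yv 3 * yv 4 + f_4)"
    if k: "k = 2" "s = 2" and M: "M 2 = V_1_1" and kind: "kind = Automorphism"
  proof -
    note flags = flags[OF k trans[OF M component_sum_eqs(9)]]
    show ?thesis
      by (rule generating_four[OF cubic[OF k(1)] z[OF k]])
        (simp_all add: z[OF k] flags kind simps del: lie.simps One_nat_def)
  qed
  have case_i_anti: "generating_identity kind scale \<phi> (lie [zv 2, yv 1] * yv 3 + f_\<Gamma>3)"
    if k: "k = 2" "s = 2" and M: "M 2 = V_1_1" and kind: "kind = Antiautomorphism"
  proof -
    note flags = flags[OF k trans[OF M component_sum_eqs(9)]]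
    show ?thesis
      by (rule generating_three[where K = "commutative_model", OF cubic[OF k(1)] z[OF k]
          _ _ _ _ _ _ _ _ _ _ commutative_model(5)])
        (simp_all add: z[OF k] flags kind simps commutative_model(1-4) del: lie.simps One_nat_def)
  qed
  have case_j_auto: "generating_identity kind scale \<phi> ((zv 2 \<odot> zv 1) * yv 3 * yv 4 + f_4)"
    if k: "k = 2" "s = 2" and M: "M 2 = V_0_2" and kind: "kind = Automorphism"
  proof -
    note flags = flags[OF k trans[OF M component_sum_eqs(10)]]
    show ?thesis
      by (rule generating_four[OF cubic[OF k(1)] z[OF k]])
        (simp_all add: z[OF k] flags kind simps del: lie.simps One_nat_def)
  qed
  have case_j_anti: "generating_identity kind scale \<phi> ((zv 2 \<odot> zv 1) * yv 3 + f_\<Gamma>3)"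
    if k: "k = 2" "s = 2" and M: "M 2 = V_0_2" and kind: "kind = Antiautomorphism"
  proof -
    note flags = flags[OF k trans[OF M component_sum_eqs(10)]]
    show ?thesis
      by (rule generating_three[where K = "exterior_reversal_model", OF cubic[OF k(1)] z[OF k]
          _ _ _ _ _ _ _ _ _ _ exterior_reversal_model(4)])
        (simp_all add: z[OF k] flags kind simps exterior_reversal_model(1-3) del: lie.simps One_nat_def)
  qed
  have case_k_auto: "generating_identity kind scale \<phi> (lie [zv 2, zv 1] * yv 3 * yv 4 + f_4)"
    if k: "k = 2" "s = 2" and M: "M 2 = V_0_11" and kind: "kind = Automorphism"
  proof -
    note flags = flags[OF k trans[OF M component_sum_eqs(11)]]
    show ?thesis
      by (rule generating_four[OF cubic[OF k(1)] z[OF k]])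
        (simp_all add: z[OF k] flags kind simps del: lie.simps One_nat_def)
  qed
  have case_k_anti: "generating_identity kind scale \<phi> (lie [zv 2, zv 1] * yv 3 + f_\<Gamma>3)"
    if k: "k = 2" "s = 2" and M: "M 2 = V_0_11" and kind: "kind = Antiautomorphism"
  proof -
    note flags = flags[OF k trans[OF M component_sum_eqs(11)]]
    show ?thesis
      by (rule generating_three[where K = "commutative_model", OF cubic[OF k(1)] z[OF k]
          _ _ _ _ _ _ _ _ _ _ commutative_model(5)])
        (simp_all add: z[OF k] flags kind simps commutative_model(1-4) del: lie.simps One_nat_def)
  qed
  have case_l_auto: "generating_identity kind scale \<phi> (zv 1 * zv 2 * yv 3 * yv 4 + f_4)"
    if k: "k = 2" "s = 2" and M: "M 2 = V_0_2 + V_0_11" and kind: "kind = Automorphism"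
  proof -
    note flags = flags[OF k trans[OF M component_sum_eqs(12)]]
    show ?thesis
      by (rule generating_four[OF cubic[OF k(1)] z[OF k]])
        (simp_all add: z[OF k] flags kind simps del: lie.simps One_nat_def)
  qed
  have case_l_anti: "generating_identity kind scale \<phi> (zv 1 * zv 2 * yv 3 + f_\<Gamma>3)"
    if k: "k = 2" "s = 2" and M: "M 2 = V_0_2 + V_0_11" and kind: "kind = Antiautomorphism"
  proof -
    note flags = flags[OF k trans[OF M component_sum_eqs(12)]]
    show ?thesis
      by (rule generating_three[where K = "quiver_model swap_arrows", OF cubic[OF k(1)] z[OF k]
          _ _ _ _ _ _ _ _ _ _ quiver_swap_model(3)])
        (simp_all add: z[OF k] flags kind simps quiver_swap del: lie.simps One_nat_def)
  qed
  have case_m_auto: "generating_identity kind scale \<phi> ((lie [zv 2, yv 1] + lie [zv 2, zv 1]) * yv 3 * yv 4 + f_4)"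
    if k: "k = 2" "s = 2" and M: "M 2 = V_1_1 + V_0_11" and kind: "kind = Automorphism"
  proof -
    note flags = flags[OF k trans[OF M component_sum_eqs(13)]]
    show ?thesis
      by (rule generating_four[OF cubic[OF k(1)] z[OF k]])
        (simp_all add: z[OF k] flags kind simps del: lie.simps One_nat_def)
  qed
  have case_m_anti: "generating_identity kind scale \<phi> ((lie [zv 2, yv 1] + lie [zv 2, zv 1]) * yv 3 + f_\<Gamma>3)"
    if k: "k = 2" "s = 2" and M: "M 2 = V_1_1 + V_0_11" and kind: "kind = Antiautomorphism"
  proof -
    note flags = flags[OF k trans[OF M component_sum_eqs(13)]]
    show ?thesis
      by (rule generating_three[where K = "commutative_model", OF cubic[OF k(1)] z[OF k]
          _ _ _ _ _ _ _ _ _ _ commutative_model(5)])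
        (simp_all add: z[OF k] flags kind simps commutative_model(1-4) del: lie.simps One_nat_def)
  qed
  have case_n_auto: "generating_identity kind scale \<phi> ((lie [zv 2, yv 1] + zv 2 \<odot> zv 1) * yv 3 * yv 4 + f_4)"
    if k: "k = 2" "s = 2" and M: "M 2 = V_1_1 + V_0_2" and kind: "kind = Automorphism"
  proof -
    note flags = flags[OF k trans[OF M component_sum_eqs(14)]]
    show ?thesis
      by (rule generating_four[OF cubic[OF k(1)] z[OF k]])
        (simp_all add: z[OF k] flags kind simps del: lie.simps One_nat_def)
  qed
  have case_n_anti: "generating_identity kind scale \<phi> (lie [zv 2, yv 1] + zv 2 \<odot> zv 1)"
    if k: "k = 2" "s = 2" and M: "M 2 = V_1_1 + V_0_2" and kind: "kind = Antiautomorphism"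
  proof -
    note flags = flags[OF k trans[OF M component_sum_eqs(14)]]
    show ?thesis
      by (rule generating_two[OF z[OF k] _ _ quadratic_sums_nonzero(4) cubic_of_quadratic(4)[OF _ kind]])
        (simp_all add: z[OF k] flags simps del: lie.simps One_nat_def)
  qed
  have case_o_auto: "generating_identity kind scale \<phi> ((lie [zv 2, yv 1] + zv 1 * zv 2) * yv 3 * yv 4 + f_4)"
    if k: "k = 2" "s = 2" and M: "M 2 = V_1_1 + V_0_2 + V_0_11" and kind: "kind = Automorphism"
  proof -
    note flags = flags[OF k trans[OF M component_sum_eqs(15)]]
    show ?thesis
      by (rule generating_four[OF cubic[OF k(1)] z[OF k]])
        (simp_all add: z[OF k] flags kind simps del: lie.simps One_nat_def)
  qed
  have case_o_anti: "generating_identity kind scale \<phi> (lie [zv 2, yv 1] + zv 1 * zv 2)"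
    if k: "k = 2" "s = 2" and M: "M 2 = V_1_1 + V_0_2 + V_0_11" and kind: "kind = Antiautomorphism"
  proof -
    note flags = flags[OF k trans[OF M component_sum_eqs(15)]]
    show ?thesis
      by (rule generating_two[OF z[OF k] _ _ quadratic_sums_nonzero(5) cubic_of_quadratic(5)[OF _ kind]])
        (simp_all add: z[OF k] flags simps del: lie.simps One_nat_def)
  qed
  show ?thesis
    by (intro conjI impI; (elim conjE)?;
      (rule zero_anti zero_auto one cover pair case_a case_b case_c case_d case_e case_f_anti case_f_auto case_g_anti case_g_auto case_h_anti case_h_auto case_i_anti case_i_auto case_j_anti case_j_auto case_k_anti case_k_auto case_l_anti case_l_auto case_m_anti case_m_auto case_n_anti case_n_auto case_o_anti case_o_auto; assumption))
qed

end
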